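(* Let $S$ be a self-adjoint restriction of $T_{\max}$ with separated boundary conditions, and let $z\in\rho(S)\setminus\{0\}$. Let $u_a,u_b$ be non-trivial solutions of $(\tau-z)u=0$ such that: - $u_a$ satisfies the boundary condition of $S$ at $a$ if $\tau$ is in the l.c. case at $a$, and lies in $H^1(a,b)$ near $a$ if $\tau$ is in the l.p. case at $a$; - $u_b$ satisfies the boundary condition of $S$ at $b$ if $\tau$ is in the l.c. case at $b$, and lies in $H^1(a,b)$ near $b$ if $\tau$ is in the l.p. case at $b$. Then the resolvent $R_z=(S-z)^{-1}$ is given by \[ R_zg(x)=\langle g, G_z(x,\cdot)^\ast\rangle,\quad x\in(a,b),\ g\in H^1(a,b), \] where \[ G_z(x,y)+\frac{\delta_x(y)}{z}=\frac{1}{V(u_b,u_a)}\begin{cases}u_a(y)u_b(x), & y\le x,\\ u_a(x)u_b(y), & y>x.\end{cases} \]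
   Context: Let $-\infty\le a<b\le\infty$ and let $\varrho,\varsigma,\chi$ be complex Borel measures on $(a,b)$, finite on compact subintervals, such that $\varrho$ is real-valued, $\varsigma$ is positive with support all of $(a,b)$, $\chi$ is positive and not identically zero, and $\varsigma(\{x\})\chi(\{x\})=\varsigma(\{x\})\varrho(\{x\})=0$ for all $x$. For such a measure $\mu$ write $\int_c^x h\,d\mu=\int_{[c,x)}h\,d\mu$ if $x>c$, $0$ if $x=c$, and $-\int_{[x,c)}h\,d\mu$ if $x<c$. $AC_{\mathrm{loc}}((a,b);\mu)$ is the set of functions $f(x)=f(c)+\int_c^x h\,d\mu$ with $h\in L^1_{\mathrm{loc}}(\mu)$, and $df/d\mu:=h$. $\mathfrak D_\tau$ is the set of $f\in AC_{\mathrm{loc}}((a,b);\varsigma)$ for which $x\mapsto-\frac{df}{d\varsigma}(x)+\int_c^xf\,d\chi$ has a (unique) representative in $AC_{\mathrm{loc}}((a,b);\varrho)$. For such $f$, $\tau f$ is the Radon–Nikodym derivative of that representative with respect to $\varrho$, and $f^{[1]}=df/d\varsigma$. A solution of $(\tau-z)u=g$ is some $u\in\mathfrak D_\tau$ with $\tau u-zu=g$ in $L^1_{\mathrm{loc}}(\varrho)$. $T_{\mathrm{loc}}$ is the set of pairs $(f,f_\tau)\in AC_{\mathrm{loc}}((a,b);\varsigma)^2$ with $f\in\mathfrak D_\tau$ and $\tau f=f_\tau$; a solution $u$ of $(\tau-z)u=0$ is identified with the pair $(u,zu)$. The modified Wronskian is $V(f,g)(x)=f_\tau(x)g^{[1]}(x)-f^{[1]}(x)g_\tau(x)$;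 for two solutions of $(\tau-z)u=0$ it is constant in $x$ and is then written $V(u_b,u_a)$. $H^1(a,b)$ is the Hilbert space of $f\in AC_{\mathrm{loc}}((a,b);\varsigma)$ with $f\in L^2(\chi)$ and $f^{[1]}\in L^2(\varsigma)$, with inner product $\langle f,g\rangle=\int fg^\ast d\chi+\int f^{[1]}(g^{[1]})^\ast d\varsigma$. A function lies in $H^1(a,b)$ near an endpoint if these integrals are finite over a neighbourhood of that endpoint. $T_{\max}=\{(f,f_\tau)\in T_{\mathrm{loc}}:f,f_\tau\in H^1(a,b)\}$; a pair lies in $T_{\max}$ near an endpoint if both components lie in $H^1(a,b)$ near it. For such pairs the limits $V(f,g)(a)=\lim_{x\to a}V(f,g)(x)$ and $V(f,g)(b)$ exist. $\tau$ is in the limit-circle (l.c.) case at an endpoint if for every $z\ne0$ all solutions of $(\tau-z)u=0$ lie in $H^1(a,b)$ near it, and in the limit-point (l.p.) case otherwise. A self-adjoint restriction with separated boundary conditions is $S=\{f\in T_{\max}:V(f,v_a^\ast)(a)=V(f,v_b^\ast)(b)=0\}$. Here $v_a\in T_{\max}$ satisfies $V(v_a,v_a^\ast)(a)=0$ and $V(f,v_a^\ast)(a)\neq0$ for some $f\in T_{\max}$ when $\tau$ is l.c. at $a$, and similarly for $v_b$ at $b$. A solution $u$ "satisfies the boundary condition at $a$" if $V((u,zu),v_a^\ast)(a)=0$, and similarly at $b$. For $x\in(a,b)$, $\delta_x\in H^1(a,b)$ denotes the element with $\langle f,\delta_x\rangle=f(x)$ for all $f\in H^1(a,b)$. *)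

theory Defs
  imports "HOL-Analysis.Analysis"
begin

text \<open>The endpoints a, b (extended reals) and the measures.  The real-valued
  (signed) measure rho is represented by its Jordan decomposition
  rho = rho_p - rho_m (two mutually singular positive measures); varsigma and
  chi are positive measures.  All measures live on the Borel sets of the real
  line; only their restrictions to the interval (a,b) matter.\<close>

record sl_data =
  lend :: ereal
  rend :: ereal
  rho_p :: "real measure"
  rho_m :: "real measure"
  vsig :: "real measure"
  chim :: "real measure"

definition Ivl :: "sl_data \<Rightarrow> real set" where
  "Ivl P = {x. lend P < ereal x \<and> ereal x < rend P}"

definition loc_finite :: "sl_data \<Rightarrow> real measure \<Rightarrow> bool" where
  "loc_finite P M \<longleftrightarrow> sets M = sets borel \<and>
     (\<forall>c d. c \<in> Ivl P \<longrightarrow> d \<in> Ivl P \<longrightarrow> emeasure M {c..d} < \<infinity>)"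

definition sl_setting :: "sl_data \<Rightarrow> bool" where
  "sl_setting P \<longleftrightarrow> lend P < rend P \<and>
     loc_finite P (rho_p P) \<and> loc_finite P (rho_m P) \<and>
     loc_finite P (vsig P) \<and> loc_finite P (chim P) \<and>
     (\<exists>A\<in>sets borel. emeasure (rho_p P) (Ivl P \<inter> A) = 0 \<and> emeasure (rho_m P) (Ivl P - A) = 0) \<and>
     (\<forall>c d. c \<in> Ivl P \<longrightarrow> d \<in> Ivl P \<longrightarrow> c < d \<longrightarrow> emeasure (vsig P) {c<..<d} > 0) \<and>
     emeasure (chim P) (Ivl P) \<noteq> 0 \<and>
     (\<forall>x\<in>Ivl P. measure (vsig P) {x} * measure (chim P) {x} = 0) \<and>
     (\<forall>x\<in>Ivl P. measure (vsig P) {x} * (measure (rho_p P) {x} - measure (rho_m P) {x}) = 0)"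

definition mint :: "real measure \<Rightarrow> real \<Rightarrow> real \<Rightarrow> (real \<Rightarrow> complex) \<Rightarrow> complex" where
  "mint M c x h = (if c < x then set_lebesgue_integral M {c..<x} h
                   else if x = c then 0 else - set_lebesgue_integral M {x..<c} h)"

definition loc_int :: "sl_data \<Rightarrow> real measure \<Rightarrow> (real \<Rightarrow> complex) \<Rightarrow> bool" where
  "loc_int P M h \<longleftrightarrow> (\<forall>c d. c \<in> Ivl P \<longrightarrow> d \<in> Ivl P \<longrightarrow> set_integrable M {c..d} h)"

text \<open>acd P M f h: f is in AC_loc((a,b);M) with df/dM = h.\<close>
definition acd :: "sl_data \<Rightarrow> real measure \<Rightarrow> (real \<Rightarrow> complex) \<Rightarrow> (real \<Rightarrow> complex) \<Rightarrow> bool" where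
  "acd P M f h \<longleftrightarrow> loc_int P M h \<and> (\<forall>c\<in>Ivl P. \<forall>x\<in>Ivl P. f x = f c + mint M c x h)"

definition acd_rho :: "sl_data \<Rightarrow> (real \<Rightarrow> complex) \<Rightarrow> (real \<Rightarrow> complex) \<Rightarrow> bool" where
  "acd_rho P f h \<longleftrightarrow> loc_int P (rho_p P) h \<and> loc_int P (rho_m P) h \<and>
     (\<forall>c\<in>Ivl P. \<forall>x\<in>Ivl P. f x = f c + (mint (rho_p P) c x h - mint (rho_m P) c x h))"

text \<open>qd P f f1 tf: f is in D_tau, with (pointwise) quasi-derivative f^[1] = f1
  and tau f = tf (in L^1_loc(rho)): f1 = df/dvarsigma and
  x \<mapsto> -f1 x + int_c^x f dchi is in AC_loc((a,b);rho) with derivative tf.\<close>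
definition qd :: "sl_data \<Rightarrow> (real \<Rightarrow> complex) \<Rightarrow> (real \<Rightarrow> complex) \<Rightarrow> (real \<Rightarrow> complex) \<Rightarrow> bool" where
  "qd P f f1 tf \<longleftrightarrow> acd P (vsig P) f f1 \<and> loc_int P (chim P) f \<and>
     (\<exists>c\<in>Ivl P. acd_rho P (\<lambda>x. - f1 x + mint (chim P) c x f) tf)"

definition qder :: "sl_data \<Rightarrow> (real \<Rightarrow> complex) \<Rightarrow> real \<Rightarrow> complex" where
  "qder P f = (SOME f1. \<exists>tf. qd P f f1 tf)"

definition is_sol :: "sl_data \<Rightarrow> complex \<Rightarrow> (real \<Rightarrow> complex) \<Rightarrow> bool" where
  "is_sol P z u \<longleftrightarrow> (\<exists>u1. qd P u u1 (\<lambda>x. z * u x))"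

definition sq_int :: "real measure \<Rightarrow> real set \<Rightarrow> (real \<Rightarrow> complex) \<Rightarrow> bool" where
  "sq_int M A f \<longleftrightarrow> (\<integral>\<^sup>+ y. indicator A y * ennreal ((cmod (f y))\<^sup>2) \<partial>M) < \<infinity>"

text \<open>Elements of H^1 are functions on (a,b); we normalise them to vanish outside (a,b).\<close>
definition H1 :: "sl_data \<Rightarrow> (real \<Rightarrow> complex) set" where
  "H1 P = {f. (\<exists>h. acd P (vsig P) f h \<and> sq_int (chim P) (Ivl P) f \<and> sq_int (vsig P) (Ivl P) h)
              \<and> (\<forall>x. x \<notin> Ivl P \<longrightarrow> f x = 0)}"

definition sder :: "sl_data \<Rightarrow> (real \<Rightarrow> complex) \<Rightarrow> real \<Rightarrow> complex" where
  "sder P f = (SOME h. acd P (vsig P) f h)"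

definition h1_inner :: "sl_data \<Rightarrow> (real \<Rightarrow> complex) \<Rightarrow> (real \<Rightarrow> complex) \<Rightarrow> complex" where
  "h1_inner P f g = set_lebesgue_integral (chim P) (Ivl P) (\<lambda>y. f y * cnj (g y))
     + set_lebesgue_integral (vsig P) (Ivl P) (\<lambda>y. sder P f y * cnj (sder P g y))"

definition h1_norm :: "sl_data \<Rightarrow> (real \<Rightarrow> complex) \<Rightarrow> real" where
  "h1_norm P f = sqrt (Re (h1_inner P f f))"

definition H1_near_a :: "sl_data \<Rightarrow> (real \<Rightarrow> complex) \<Rightarrow> bool" where
  "H1_near_a P f \<longleftrightarrow> (\<exists>h. acd P (vsig P) f h \<and> (\<exists>c\<in>Ivl P.
      sq_int (chim P) {y\<in>Ivl P. y < c} f \<and> sq_int (vsig P) {y\<in>Ivl P. y < c} h))"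

definition H1_near_b :: "sl_data \<Rightarrow> (real \<Rightarrow> complex) \<Rightarrow> bool" where
  "H1_near_b P f \<longleftrightarrow> (\<exists>h. acd P (vsig P) f h \<and> (\<exists>c\<in>Ivl P.
      sq_int (chim P) {y\<in>Ivl P. c < y} f \<and> sq_int (vsig P) {y\<in>Ivl P. c < y} h))"

definition delta :: "sl_data \<Rightarrow> real \<Rightarrow> real \<Rightarrow> complex" where
  "delta P x = (THE d. d \<in> H1 P \<and> (\<forall>f\<in>H1 P. h1_inner P f d = f x))"

type_synonym cpair = "(real \<Rightarrow> complex) \<times> (real \<Rightarrow> complex)"

definition Tloc :: "sl_data \<Rightarrow> cpair set" where
  "Tloc P = {(f, ft). (\<exists>f1. qd P f f1 ft) \<and> (\<exists>h. acd P (vsig P) ft h)}"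

definition Tmax :: "sl_data \<Rightarrow> cpair set" where
  "Tmax P = {p \<in> Tloc P. fst p \<in> H1 P \<and> snd p \<in> H1 P}"

definition cnjp :: "cpair \<Rightarrow> cpair" where
  "cnjp p = ((\<lambda>x. cnj (fst p x)), (\<lambda>x. cnj (snd p x)))"

definition Vw :: "sl_data \<Rightarrow> cpair \<Rightarrow> cpair \<Rightarrow> real \<Rightarrow> complex" where
  "Vw P p q x = snd p x * qder P (fst q) x - qder P (fst p) x * snd q x"

definition Vw_a :: "sl_data \<Rightarrow> cpair \<Rightarrow> cpair \<Rightarrow> complex" where
  "Vw_a P p q = Lim (filtercomap ereal (at_right (lend P))) (Vw P p q)"

definition Vw_b :: "sl_data \<Rightarrow> cpair \<Rightarrow> cpair \<Rightarrow> complex" where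
  "Vw_b P p q = Lim (filtercomap ereal (at_left (rend P))) (Vw P p q)"

text \<open>V(u_b,u_a) for two solutions of (tau - z)u = 0 (constant in x).\<close>
definition Vsol :: "sl_data \<Rightarrow> complex \<Rightarrow> (real \<Rightarrow> complex) \<Rightarrow> (real \<Rightarrow> complex) \<Rightarrow> complex" where
  "Vsol P z ub ua = Vw P (ub, \<lambda>x. z * ub x) (ua, \<lambda>x. z * ua x) (SOME c. c \<in> Ivl P)"

definition lc_a :: "sl_data \<Rightarrow> bool" where
  "lc_a P \<longleftrightarrow> (\<forall>z u. z \<noteq> 0 \<longrightarrow> is_sol P z u \<longrightarrow> H1_near_a P u)"

definition lc_b :: "sl_data \<Rightarrow> bool" where
  "lc_b P \<longleftrightarrow> (\<forall>z u. z \<noteq> 0 \<longrightarrow> is_sol P z u \<longrightarrow> H1_near_b P u)"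

definition bc_fun_a :: "sl_data \<Rightarrow> cpair \<Rightarrow> bool" where
  "bc_fun_a P va \<longleftrightarrow> va \<in> Tmax P \<and>
     (lc_a P \<longrightarrow> Vw_a P va (cnjp va) = 0 \<and> (\<exists>f\<in>Tmax P. Vw_a P f (cnjp va) \<noteq> 0))"

definition bc_fun_b :: "sl_data \<Rightarrow> cpair \<Rightarrow> bool" where
  "bc_fun_b P vb \<longleftrightarrow> vb \<in> Tmax P \<and>
     (lc_b P \<longrightarrow> Vw_b P vb (cnjp vb) = 0 \<and> (\<exists>f\<in>Tmax P. Vw_b P f (cnjp vb) \<noteq> 0))"

definition Ssep :: "sl_data \<Rightarrow> cpair \<Rightarrow> cpair \<Rightarrow> cpair set" where
  "Ssep P va vb = {f \<in> Tmax P. Vw_a P f (cnjp va) = 0 \<and> Vw_b P f (cnjp vb) = 0}"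

text \<open>Resolvent of a linear relation S in H^1: (S - z)^{-1} g = f iff (f, g + z f) in S.\<close>
definition resolv :: "cpair set \<Rightarrow> complex \<Rightarrow> (real \<Rightarrow> complex) \<Rightarrow> (real \<Rightarrow> complex)" where
  "resolv S z g = (THE f. (f, \<lambda>x. g x + z * f x) \<in> S)"

definition res_set :: "sl_data \<Rightarrow> cpair set \<Rightarrow> complex set" where
  "res_set P S = {z. (\<forall>g\<in>H1 P. \<exists>!f. (f, \<lambda>x. g x + z * f x) \<in> S) \<and>
      (\<exists>C. \<forall>g\<in>H1 P. h1_norm P (resolv S z g) \<le> C * h1_norm P g)}"

definition Green :: "sl_data \<Rightarrow> complex \<Rightarrow> (real \<Rightarrow> complex) \<Rightarrow> (real \<Rightarrow> complex) \<Rightarrow> real \<Rightarrow> real \<Rightarrow> complex" where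
  "Green P z ua ub x y = (if y \<in> Ivl P then
      (if y \<le> x then ua y * ub x else ua x * ub y) / Vsol P z ub ua - delta P x y / z
     else 0)"

end

theory Submission
  imports Defs
begin

text \<open>Let \<open>f = R\<^sub>z g\<close>, so that \<open>\<tau> f = g + z f\<close>. For a solution \<open>u\<close> of \<open>(\<tau> - z) u = 0\<close> the Lagrange
  identity reads \<open>\<integral> g u d\<chi> + \<integral> g' u' d\<varsigma> = V(f, u)\<close> between the limits of integration. Applied to \<open>u\<^sub>a\<close> on
  \<open>(a, x)\<close> and to \<open>u\<^sub>b\<close> on \<open>[x, b)\<close>, where the boundary terms at \<open>a\<close> and \<open>b\<close> vanish, it yields the
  formula, because \<open>\<langle>g, \<delta>\<^sub>x\<rangle> = g x\<close>.

  The boundary terms vanish in the limit-circle case by the Pluecker relation between the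
  Wronskians, and in the limit-point case because a pair of elements of the maximal relation with
  nonzero boundary Wronskian forces all solutions to be in \<open>H\<^sup>1\<close> near that endpoint.
  The Wronskian of \<open>u\<^sub>a\<close> and \<open>u\<^sub>b\<close> does not vanish: otherwise multiples of the two solutions could be
  glued to an eigenfunction of \<open>S\<close> for the eigenvalue \<open>z\<close>. The element \<open>\<delta>\<^sub>x\<close> exists since \<open>H\<^sup>1\<close> is
  complete and point evaluations are bounded.\<close>

section \<open>Integrals over intervals and products of measures\<close>

text \<open>All the measures may have atoms, and the functions, being integrals over half-open
  intervals, are only left-continuous, so integration by parts in its symmetric form fails at common
  atoms. The modified Wronskian avoids them: each of its products pairs a primitive with respect to
  \<open>vsig\<close> with a quasi-derivative, whose increments come from \<open>chim\<close>,
  \<open>rho_p\<close> and \<open>rho_m\<close>, and none of these shares an atom with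
  \<open>vsig\<close> on (a,b). The rho-terms of the two products coincide, so the Lagrange identity
  contains only the two measures of the \<open>H1\<close> inner product.

  Vanishing initial data at c are propagated only to the right of c. This suffices: if u_a vanishes
  to the right of c, it satisfies the condition at b trivially and would be an eigenfunction, which
  z in the resolvent set excludes.

  As a Radon-Nikodym derivative df/dvarsigma is fixed only almost everywhere, but the
  quasi-derivative is fixed at every point: it is left-continuous and \<open>vsig\<close> charges
  every open interval. So \<open>Vw\<close> is well defined pointwise although \<open>qder\<close>
  is a choice.\<close>

lemma set_integral_shrink:
  fixes k :: "'a \<Rightarrow> 'b::{banach, second_countable_topology}"
  assumes k: "set_integrable M A k"
    and B: "\<And>n. B n \<in> sets M" "\<And>n. B n \<subseteq> A"
    and ev: "\<And>x. x \<in> A \<Longrightarrow> eventually (\<lambda>n. x \<notin> B n) sequentially"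
  shows "(\<lambda>n. set_lebesgue_integral M (B n) k) \<longlonglongrightarrow> 0"
proof -
  have eq: "indicator (B n) x *\<^sub>R k x = indicator (B n) x *\<^sub>R (indicator A x *\<^sub>R k x)" for n x
    using B(2)[of n] by (auto split: split_indicator)
  have m: "(\<lambda>x. indicator A x *\<^sub>R k x) \<in> borel_measurable M"
    using k unfolding set_integrable_def by (rule borel_measurable_integrable)
  have "(\<lambda>n. \<integral>x. indicator (B n) x *\<^sub>R k x \<partial>M) \<longlonglongrightarrow> (\<integral>x. 0 \<partial>M)"
  proof (rule integral_dominated_convergence[where w="\<lambda>x. norm (indicator A x *\<^sub>R k x)"])
    show "integrable M (\<lambda>x. norm (indicator A x *\<^sub>R k x))"
      using k unfolding set_integrable_def by (rule integrable_norm)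
    show "(\<lambda>x. indicator (B n) x *\<^sub>R k x) \<in> borel_measurable M" for n
      unfolding eq using m B(1)[of n] by measurable
    show "AE x in M. (\<lambda>n. indicator (B n) x *\<^sub>R k x) \<longlonglongrightarrow> 0"
    proof (rule AE_I2, rule tendsto_eventually)
      fix x
      show "\<forall>\<^sub>F n in sequentially. indicator (B n) x *\<^sub>R k x = 0"
      proof (cases "x \<in> A")
        case True
        show ?thesis using ev[OF True] by eventually_elim simp
      next
        case False
        then have "x \<notin> B n" for n using B(2)[of n] by auto
        then show ?thesis by simp
      qed
    qed
    show "AE x in M. norm (indicator (B n) x *\<^sub>R k x) \<le> norm (indicator A x *\<^sub>R k x)" for n
      using B(2)[of n] by (auto split: split_indicator)
  qed auto
  then show ?thesis unfolding set_lebesgue_integral_def by simp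
qed

text \<open>The measures with densities k+ and k- agree on all rays and hence coincide. They live on
  the disjoint sets k > 0 and k < 0, so both are zero.\<close>

lemma AE_zero_if_lessThan_integrals_zero_real:
  fixes k :: "real \<Rightarrow> real"
  assumes M: "sets M = sets borel" and k: "integrable M k"
    and z: "\<And>s. set_lebesgue_integral M {..<s} k = 0"
  shows "AE x in M. k x = 0"
proof -
  have kk: "set_integrable M A k" if "A \<in> sets borel" for A
    unfolding set_integrable_def using integrable_mult_indicator[OF _ k] that M by auto
  have sp: "space M = UNIV" using sets_eq_imp_space_eq[OF M] by simp
  have tot: "integral\<^sup>L M k = 0"
  proof -
    have "(\<lambda>n::nat. set_lebesgue_integral M {real n..} k) \<longlonglongrightarrow> 0"
    proof (rule set_integral_shrink[OF kk[of UNIV]])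
      show "\<forall>\<^sub>F n in sequentially. x \<notin> {real n..}" for x
        using eventually_gt_at_top[of "nat \<lceil>\<bar>x\<bar>\<rceil>"] by eventually_elim (auto; linarith)
    qed (auto simp: M)
    moreover have "integral\<^sup>L M k = set_lebesgue_integral M {real n..} k" for n
    proof -
      have "{..<real n} \<union> {real n..} = UNIV" by auto
      then have "integral\<^sup>L M k = set_lebesgue_integral M ({..<real n} \<union> {real n..}) k"
        by (simp add: set_lebesgue_integral_def)
      also have "\<dots> = set_lebesgue_integral M {real n..} k"
        using z by (subst set_integral_Un) (auto intro!: kk)
      finally show ?thesis .
    qed
    ultimately show ?thesis by (simp add: LIMSEQ_const_iff)
  qed
  \<comment> \<open>\<open>measure_eqI_lessThan\<close> tests open upper rays, while the complements
    of the given rays are closed. The ray beyond s is approximated by closed rays starting at s +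
    1/(n+1).\<close>
  have gt: "set_lebesgue_integral M {s<..} k = 0" for s
  proof -
    have *: "set_lebesgue_integral M {..<t} k + set_lebesgue_integral M {t..} k = 0" for t
    proof -
      have "{..<t} \<union> {t..} = UNIV" by auto
      then have "integral\<^sup>L M k = set_lebesgue_integral M ({..<t} \<union> {t..}) k"
        by (simp add: set_lebesgue_integral_def)
      then show ?thesis
        using tot by (subst (asm) set_integral_Un) (auto intro!: kk)
    qed
    have "(\<lambda>n::nat. set_lebesgue_integral M {s<..<s + 1 / real (Suc n)} k) \<longlonglongrightarrow> 0"
    proof (rule set_integral_shrink[OF kk[of UNIV]])
      show "\<forall>\<^sub>F n in sequentially. x \<notin> {s<..<s + 1 / real (Suc n)}" for x
      proof (cases "x > s")
        case True
        then obtain N where N: "1 / real (Suc N) < x - s" using nat_approx_posE[of "x - s"] by auto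
        show ?thesis using eventually_ge_at_top[of N]
        proof eventually_elim
          case (elim n)
          then have "1 / real (Suc n) \<le> 1 / real (Suc N)" by (simp add: frac_le)
          then show ?case using N by auto
        qed
      qed auto
    qed (auto simp: M)
    moreover have "set_lebesgue_integral M {s<..} k = set_lebesgue_integral M {s<..<s + 1 / real (Suc n)} k" for n
    proof -
      have "{s<..} = {s<..<s + 1 / real (Suc n)} \<union> {s + 1 / real (Suc n)..}"
        by (auto intro: less_le_trans[of s "s + 1 / (1 + real n)"] simp: add_pos_nonneg)
      then show ?thesis using *[of "s + 1 / real (Suc n)"] z
        by (simp del: of_nat_Suc) (subst set_integral_Un, auto intro!: kk)
    qed
    ultimately show ?thesis by (simp add: LIMSEQ_const_iff)
  qed
  define D where "D = density M (\<lambda>x. ennreal (k x))"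
  define D' where "D' = density M (\<lambda>x. ennreal (- k x))"
  have km[measurable]: "k \<in> borel_measurable M" using k by auto
  have fin: "(\<integral>\<^sup>+x. ennreal (k x) \<partial>M) < \<infinity>" "(\<integral>\<^sup>+x. ennreal (- k x) \<partial>M) < \<infinity>"
    using integrableD(2)[OF k] integrableD(3)[OF k] by (auto simp: top.not_eq_extremum)
  have le: "(\<integral>\<^sup>+x. ennreal (k x) * indicator A x \<partial>M) \<le> (\<integral>\<^sup>+x. ennreal (k x) \<partial>M)"
     "(\<integral>\<^sup>+x. ennreal (- k x) * indicator A x \<partial>M) \<le> (\<integral>\<^sup>+x. ennreal (- k x) \<partial>M)" for A
    by (auto intro!: nn_integral_mono split: split_indicator)
  have eq: "D = D'"
  proof (rule measure_eqI_lessThan)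
    show "sets D = sets borel" "sets D' = sets borel" by (auto simp: D_def D'_def M)
    fix s :: real
    have sM: "{s<..} \<in> sets M" by (simp add: M)
    show "emeasure D {s<..} < \<infinity>"
      using le(1)[of "{s<..}"] fin(1) by (simp add: D_def emeasure_density sM)
    have i: "integrable M (\<lambda>x. indicator {s<..} x *\<^sub>R k x)"
      using kk[of "{s<..}"] by (simp add: set_integrable_def)
    have e1: "(\<integral>\<^sup>+x. ennreal (indicator {s<..} x *\<^sub>R k x) \<partial>M) = emeasure D {s<..}"
      by (simp add: D_def emeasure_density sM) (intro nn_integral_cong, auto split: split_indicator)
    have e2: "(\<integral>\<^sup>+x. ennreal (- (indicator {s<..} x *\<^sub>R k x)) \<partial>M) = emeasure D' {s<..}"
      by (simp add: D'_def emeasure_density sM) (intro nn_integral_cong, auto split: split_indicator)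
    have "enn2real (emeasure D {s<..}) - enn2real (emeasure D' {s<..}) = 0"
      using gt[of s] real_lebesgue_integral_def[OF i] unfolding e1 e2 set_lebesgue_integral_def by simp
    moreover have "emeasure D {s<..} < \<infinity>" "emeasure D' {s<..} < \<infinity>"
      using le[of "{s<..}"] fin by (simp_all add: D_def D'_def emeasure_density sM)
    ultimately show "emeasure D {s<..} = emeasure D' {s<..}"
      by (metis ennreal_enn2real diff_eq_diff_eq cancel_comm_monoid_add_class.diff_cancel infinity_ennreal_def eq_iff_diff_eq_0)
  qed
  have A: "{x. k x > 0} \<in> sets M" "{x. k x < 0} \<in> sets M"
    using km measurable_sets[OF km, of "{0<..}"] measurable_sets[OF km, of "{..<0}"]
    by (auto simp: vimage_def sp)
  have "emeasure D' {x. k x > 0} = 0" "emeasure D {x. k x < 0} = 0"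
    using A by (auto simp: D_def D'_def emeasure_density nn_integral_0_iff_AE ennreal_neg split: split_indicator)
  then have "emeasure D {x. k x > 0} = 0" "emeasure D' {x. k x < 0} = 0"
    using eq by auto
  then have "AE x in M. ennreal (k x) * indicator {x. k x > 0} x = 0"
    "AE x in M. ennreal (- k x) * indicator {x. k x < 0} x = 0"
    using A by (auto simp: D_def D'_def emeasure_density nn_integral_0_iff_AE)
  then show ?thesis
    by eventually_elim (auto split: split_indicator_asm simp: ennreal_eq_0_iff)
qed

lemma AE_zero_if_lessThan_integrals_zero:
  fixes k :: "real \<Rightarrow> complex"
  assumes M: "sets M = sets borel" and k: "integrable M k"
    and z: "\<And>s. set_lebesgue_integral M {..<s} k = 0"
  shows "AE x in M. k x = 0"
proof -
  have i: "integrable M (\<lambda>x. indicator {..<s} x *\<^sub>R k x)" for s :: real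
    using integrable_mult_indicator[OF _ k] M by auto
  have "AE x in M. Re (k x) = 0"
  proof (rule AE_zero_if_lessThan_integrals_zero_real[OF M])
    show "integrable M (\<lambda>x. Re (k x))" using k by simp
    show "set_lebesgue_integral M {..<s} (\<lambda>x. Re (k x)) = 0" for s
      using arg_cong[OF z[of s], of Re] integral_Re[OF i[of s]]
      unfolding set_lebesgue_integral_def by simp
  qed
  moreover have "AE x in M. Im (k x) = 0"
  proof (rule AE_zero_if_lessThan_integrals_zero_real[OF M])
    show "integrable M (\<lambda>x. Im (k x))" using k by simp
    show "set_lebesgue_integral M {..<s} (\<lambda>x. Im (k x)) = 0" for s
      using arg_cong[OF z[of s], of Im] integral_Im[OF i[of s]]
      unfolding set_lebesgue_integral_def by simp
  qed
  ultimately show ?thesis by eventually_elim (simp add: complex_eq_iff)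
qed

text \<open>Splitting the square at the diagonal puts the jump terms on the diagonal, whose product
  measure is the sum of the products of the atoms.\<close>
lemma product_integral_triangles:
  fixes p q :: "real \<Rightarrow> complex"
  assumes fM: "finite_measure M" and fN: "finite_measure N"
    and sM: "sets M = sets borel" and sN: "sets N = sets borel"
    and p: "integrable M p" and q: "integrable N q"
    and at: "\<And>t. measure M {t} * measure N {t} = 0"
  shows "integrable M (\<lambda>s. p s * set_lebesgue_integral N {..<s} q)"
    and "integrable N (\<lambda>t. q t * set_lebesgue_integral M {..<t} p)"
    and "integral\<^sup>L M p * integral\<^sup>L N q =
      (\<integral>s. p s * set_lebesgue_integral N {..<s} q \<partial>M) +
      (\<integral>t. q t * set_lebesgue_integral M {..<t} p \<partial>N)"
proof -
  interpret M: finite_measure M by fact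
  interpret N: finite_measure N by fact
  interpret MN: pair_sigma_finite M N ..
  have [measurable]: "p \<in> borel_measurable M" "q \<in> borel_measurable N" using p q by auto
  have [measurable_cong]: "sets M = sets borel" "sets N = sets borel" by fact+
  have pq: "integrable (M \<Otimes>\<^sub>M N) (\<lambda>(s, t). p s * q t)"
  proof (rule MN.Fubini_integrable)
    show "integrable M (\<lambda>x. \<integral>y. norm (case (x, y) of (s, t) \<Rightarrow> p s * q t) \<partial>N)"
      using p by (auto simp: norm_mult)
  qed (use q in auto)
  define F where "F s t = indicator {(s, t). t < s} (s, t) *\<^sub>R (p s * q t)" for s t :: real
  define G where "G s t = indicator {(s, t). s \<le> t} (s, t) *\<^sub>R (p s * q t)" for s t :: real
  have S: "{(s, t). t < s} \<in> sets (M \<Otimes>\<^sub>M N)" "{(s, t). s \<le> t} \<in> sets (M \<Otimes>\<^sub>M N)"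
  proof -
    have sp: "space (M \<Otimes>\<^sub>M N) = UNIV"
      using sets_eq_imp_space_eq[OF sM] sets_eq_imp_space_eq[OF sN] by (auto simp: space_pair_measure)
    have "{z \<in> space (M \<Otimes>\<^sub>M N). snd z < fst z} \<in> sets (M \<Otimes>\<^sub>M N)"
      "{z \<in> space (M \<Otimes>\<^sub>M N). fst z \<le> snd z} \<in> sets (M \<Otimes>\<^sub>M N)" by measurable
    then show "{(s, t). t < s} \<in> sets (M \<Otimes>\<^sub>M N)" "{(s, t). s \<le> t} \<in> sets (M \<Otimes>\<^sub>M N)"
      by (auto simp: sp case_prod_unfold)
  qed
  have iF: "integrable (M \<Otimes>\<^sub>M N) (case_prod F)"
    using integrable_mult_indicator[OF S(1) pq] by (simp add: F_def case_prod_unfold)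
  have iG: "integrable (M \<Otimes>\<^sub>M N) (case_prod G)"
    using integrable_mult_indicator[OF S(2) pq] by (simp add: G_def case_prod_unfold)
  have Feq: "(\<integral>t. F s t \<partial>N) = p s * set_lebesgue_integral N {..<s} q" for s
  proof -
    have "F s t = p s * (indicator {..<s} t *\<^sub>R q t)" for t
      by (auto simp: F_def split: split_indicator)
    then show ?thesis
      by (simp only: set_lebesgue_integral_def integral_mult_right_zero)
  qed
  have ptint: "set_integrable M A p" if "A \<in> sets borel" for A
    unfolding set_integrable_def using integrable_mult_indicator[OF _ p] that sM by auto
  have Geq: "(\<integral>s. G s t \<partial>M) = q t * set_lebesgue_integral M {..t} p" for t
  proof -
    have "G s t = q t * (indicator {..t} s *\<^sub>R p s)" for s
      by (auto simp: G_def split: split_indicator)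
    then show ?thesis
      by (simp only: set_lebesgue_integral_def integral_mult_right_zero)
  qed
  \<comment> \<open>The inner integral over \<open>G\<close> runs up to and including t. The atoms
    of M are countably many and null for N, so for N-almost every t the endpoint may be
    dropped.\<close>
  have cnt: "countable {t. measure M {t} \<noteq> 0}" by (rule M.countable_support)
  have "AE t in N. t \<notin> {t. measure M {t} \<noteq> 0}"
  proof (rule AE_not_in)
    have "(\<Union>t\<in>{t. measure M {t} \<noteq> 0}. {t}) \<in> null_sets N"
    proof (rule null_sets_UN'[OF cnt])
      fix t assume "t \<in> {t. measure M {t} \<noteq> 0}"
      then have "measure N {t} = 0" using at[of t] by auto
      then show "{t} \<in> null_sets N" by (auto simp: null_sets_def N.emeasure_eq_measure sN)
    qed
    then show "{t. measure M {t} \<noteq> 0} \<in> null_sets N" by auto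
  qed
  then have ae: "AE t in N. (\<integral>s. G s t \<partial>M) = q t * set_lebesgue_integral M {..<t} p"
  proof eventually_elim
    case (elim t)
    have "set_lebesgue_integral M {t} p = 0"
    proof -
      have "{t} \<in> null_sets M" using elim by (auto simp: null_sets_def M.emeasure_eq_measure sM)
      then have "AE x in M. indicator {t} x *\<^sub>R p x = 0"
        by (rule AE_not_in[THEN eventually_mono]) auto
      then show ?thesis unfolding set_lebesgue_integral_def by (rule integral_eq_zero_AE)
    qed
    moreover have "{..t} = {..<t} \<union> {t}" by auto
    moreover have "set_lebesgue_integral M ({..<t} \<union> {t}) p
        = set_lebesgue_integral M {..<t} p + set_lebesgue_integral M {t} p"
      by (intro set_integral_Un ptint) auto
    ultimately show ?case
      unfolding Geq by (simp only: add_0_right)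
  qed
  show 1: "integrable M (\<lambda>s. p s * set_lebesgue_integral N {..<s} q)"
    using MN.integrable_fst[OF iF] by (simp add: Feq)
  have m2: "(\<lambda>t. q t * set_lebesgue_integral M {..<t} p) \<in> borel_measurable N"
    unfolding set_lebesgue_integral_def
  proof (intro borel_measurable_times)
    have "(\<lambda>(t, x). indicator {..<t} x *\<^sub>R p x) = (\<lambda>z. if snd z < fst z then p (snd z) else 0)"
      by (auto simp: fun_eq_iff)
    moreover have "(\<lambda>z. if snd z < fst z then p (snd z) else 0) \<in> borel_measurable (N \<Otimes>\<^sub>M M)"
      by measurable
    ultimately show "(\<lambda>t. \<integral>x. indicator {..<t} x *\<^sub>R p x \<partial>M) \<in> borel_measurable N"
      by (intro M.borel_measurable_lebesgue_integral) simp
  qed simp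
  have i2: "integrable N (\<lambda>t. \<integral>s. G s t \<partial>M)" using MN.integrable_snd[OF iG] .
  show 2: "integrable N (\<lambda>t. q t * set_lebesgue_integral M {..<t} p)"
    using integrable_cong_AE[OF borel_measurable_integrable[OF i2] m2 ae] i2 by simp
  have "integral\<^sup>L M p * integral\<^sup>L N q = (\<integral>s. (\<integral>t. p s * q t \<partial>N) \<partial>M)"
    by simp
  also have "\<dots> = integral\<^sup>L (M \<Otimes>\<^sub>M N) (\<lambda>(s, t). p s * q t)"
    using MN.integral_fst[OF pq] by simp
  also have "\<dots> = integral\<^sup>L (M \<Otimes>\<^sub>M N) (\<lambda>z. case_prod F z + case_prod G z)"
    by (intro Bochner_Integration.integral_cong) (auto simp: F_def G_def split: split_indicator)
  also have "\<dots> = integral\<^sup>L (M \<Otimes>\<^sub>M N) (case_prod F) + integral\<^sup>L (M \<Otimes>\<^sub>M N) (case_prod G)"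
    by (rule Bochner_Integration.integral_add[OF iF iG])
  also have "integral\<^sup>L (M \<Otimes>\<^sub>M N) (case_prod F) = (\<integral>s. p s * set_lebesgue_integral N {..<s} q \<partial>M)"
    using MN.integral_fst[OF iF] by (simp add: Feq)
  also have "integral\<^sup>L (M \<Otimes>\<^sub>M N) (case_prod G) = (\<integral>t. q t * set_lebesgue_integral M {..<t} p \<partial>N)"
    using MN.integral_snd[OF iG] integral_cong_AE[OF borel_measurable_integrable[OF i2] m2 ae] by simp
  finally show "integral\<^sup>L M p * integral\<^sup>L N q =
      (\<integral>s. p s * set_lebesgue_integral N {..<s} q \<partial>M) +
      (\<integral>t. q t * set_lebesgue_integral M {..<t} p \<partial>N)" .
qed

section \<open>Absolutely continuous functions and quasi-derivatives\<close>

lemma set_integral_empty [simp]: "set_lebesgue_integral M {} h = 0"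
  by (simp add: set_lebesgue_integral_def)

lemma mint_eq: "mint M c x h = set_lebesgue_integral M {c..<x} h - set_lebesgue_integral M {x..<c} h"
  by (auto simp: mint_def set_lebesgue_integral_def)

lemma set_borel_measurable_mult:
  fixes f g :: "'a \<Rightarrow> 'b::{second_countable_topology, real_normed_algebra}"
  assumes "set_borel_measurable M A f" "set_borel_measurable M A g"
  shows "set_borel_measurable M A (\<lambda>x. f x * g x)"
proof -
  have "(\<lambda>x. (indicator A x *\<^sub>R f x) * (indicator A x *\<^sub>R g x)) \<in> borel_measurable M"
    using assms unfolding set_borel_measurable_def by (rule borel_measurable_times)
  then show ?thesis unfolding set_borel_measurable_def
    by (rule measurable_cong[THEN iffD1, rotated]) (auto split: split_indicator)
qed

lemma set_borel_measurable_add: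
  fixes f g :: "'a \<Rightarrow> 'b::{second_countable_topology, real_normed_vector}"
  assumes "set_borel_measurable M A f" "set_borel_measurable M A g"
  shows "set_borel_measurable M A (\<lambda>x. f x + g x)"
  using borel_measurable_add[OF assms[unfolded set_borel_measurable_def]]
  unfolding set_borel_measurable_def scaleR_add_right .

lemma set_borel_measurable_diff:
  fixes f g :: "'a \<Rightarrow> 'b::{second_countable_topology, real_normed_vector}"
  assumes "set_borel_measurable M A f" "set_borel_measurable M A g"
  shows "set_borel_measurable M A (\<lambda>x. f x - g x)"
  using borel_measurable_diff[OF assms[unfolded set_borel_measurable_def]]
  unfolding set_borel_measurable_def scaleR_diff_right .

lemma set_borel_measurable_cmult:
  fixes f :: "'a \<Rightarrow> complex"
  assumes "set_borel_measurable M A f"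
  shows "set_borel_measurable M A (\<lambda>x. c * f x)"
proof -
  have "(\<lambda>x. c * (indicator A x *\<^sub>R f x)) \<in> borel_measurable M"
    using assms unfolding set_borel_measurable_def by measurable
  then show ?thesis unfolding set_borel_measurable_def
    by (rule measurable_cong[THEN iffD1, rotated]) (auto split: split_indicator)
qed

lemma set_borel_measurable_cnj:
  assumes "set_borel_measurable M A f"
  shows "set_borel_measurable M A (\<lambda>x. cnj (f x))"
proof -
  have "(\<lambda>x. cnj (indicator A x *\<^sub>R f x)) \<in> borel_measurable M"
    using assms unfolding set_borel_measurable_def
    by (intro borel_measurable_continuous_on[where f=cnj]) (auto intro: continuous_intros)
  then show ?thesis unfolding set_borel_measurable_def
    by (rule measurable_cong[THEN iffD1, rotated]) (auto split: split_indicator)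
qed

lemma set_borel_measurable_norm:
  fixes f :: "'a \<Rightarrow> 'b::{second_countable_topology, real_normed_vector}"
  assumes "set_borel_measurable M A f"
  shows "set_borel_measurable M A (\<lambda>x. norm (f x))"
proof -
  have "(\<lambda>x. norm (indicator A x *\<^sub>R f x)) \<in> borel_measurable M"
    using assms unfolding set_borel_measurable_def by measurable
  then show ?thesis unfolding set_borel_measurable_def
    by (rule measurable_cong[THEN iffD1, rotated]) (auto split: split_indicator)
qed

text \<open>Integrability of \<open>h\<close> is not assumed: where it fails, the Bochner integral
  is 0 by convention and the bound still holds because g is nonnegative.\<close>

lemma set_integral_norm_le:
  fixes h :: "real \<Rightarrow> 'b::{banach, second_countable_topology}"
  assumes g: "set_integrable M B g" and A: "A \<in> sets M" "A \<subseteq> B"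
    and le: "\<And>t. t \<in> A \<Longrightarrow> norm (h t) \<le> g t" and nn: "\<And>t. t \<in> B \<Longrightarrow> 0 \<le> (g t::real)"
  shows "norm (set_lebesgue_integral M A h) \<le> set_lebesgue_integral M B g"
proof (cases "set_integrable M A h")
  case True
  have "norm (set_lebesgue_integral M A h) \<le> (\<integral>t. norm (indicator A t *\<^sub>R h t) \<partial>M)"
    unfolding set_lebesgue_integral_def by (rule integral_norm_bound)
  also have "\<dots> \<le> (\<integral>t. indicator B t *\<^sub>R g t \<partial>M)"
  proof (rule integral_mono)
    show "integrable M (\<lambda>t. norm (indicator A t *\<^sub>R h t))"
      using True unfolding set_integrable_def by (rule integrable_norm)
    show "integrable M (\<lambda>t. indicator B t *\<^sub>R g t)" using g by (simp add: set_integrable_def)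
  qed (use A(2) le nn in \<open>auto split: split_indicator\<close>)
  finally show ?thesis by (simp add: set_lebesgue_integral_def)
next
  case False
  then have "set_lebesgue_integral M A h = 0"
    unfolding set_integrable_def set_lebesgue_integral_def by (rule not_integrable_integral_eq)
  moreover have "0 \<le> set_lebesgue_integral M B g"
    unfolding set_lebesgue_integral_def using nn by (intro integral_nonneg_AE) (auto split: split_indicator)
  ultimately show ?thesis by simp
qed

section \<open>The interval, its exhaustion and local integrability\<close>

locale sturm_liouville =
  fixes P :: sl_data
  assumes setting: "sl_setting P"
begin

abbreviation I where "I \<equiv> Ivl P"
abbreviation locfin where "locfin \<equiv> loc_finite P"
text \<open>Measurability refers to \<open>borel\<close> and not to one of the measures, so that a
  single fact about a function serves all four of them.\<close>

abbreviation borel_on :: "(real \<Rightarrow> complex) \<Rightarrow> bool" where "borel_on h \<equiv> set_borel_measurable borel (Ivl P) h"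

lemma locfin_measures [simp, intro]: "locfin (vsig P)" "locfin (chim P)" "locfin (rho_p P)" "locfin (rho_m P)"
  using setting unfolding sl_setting_def by blast+

lemma locfin_sets: "locfin M \<Longrightarrow> sets M = sets borel" by (simp add: loc_finite_def)

lemma sets_measures [simp, measurable_cong]: "sets (vsig P) = sets borel" "sets (chim P) = sets borel"
  "sets (rho_p P) = sets borel" "sets (rho_m P) = sets borel"
  using locfin_measures by (simp_all add: loc_finite_def)

lemma Ivl_einterval: "I = einterval (lend P) (rend P)" by (auto simp: Ivl_def einterval_def)

lemma open_Ivl: "open I" by (simp add: Ivl_einterval)

lemma borel_Ivl [simp, measurable]: "I \<in> sets borel" using open_Ivl by simp

lemma lend_less_rend: "lend P < rend P" using setting unfolding sl_setting_def by blast

lemma Ivl_between: "x \<in> I \<Longrightarrow> y \<in> I \<Longrightarrow> x \<le> t \<Longrightarrow> t \<le> y \<Longrightarrow> t \<in> I"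
  unfolding Ivl_def mem_Collect_eq by (metis ereal_less_eq(3) less_le_trans le_less_trans)

lemma Icc_sub_Ivl: "x \<in> I \<Longrightarrow> y \<in> I \<Longrightarrow> {x..y} \<subseteq> I"
  by (meson Ivl_between atLeastAtMost_iff subsetI)

lemma Ivl_exhaustion:
  obtains l u :: "nat \<Rightarrow> real" where
    "\<And>n. l n \<in> I" "\<And>n. u n \<in> I" "\<And>n. l n < u n" "decseq l" "incseq u"
    "\<And>x. x \<in> I \<Longrightarrow> eventually (\<lambda>n. l n < x \<and> x < u n) sequentially"
proof -
  obtain u l :: "nat \<Rightarrow> real" where ul:
    "einterval (lend P) (rend P) = (\<Union>i. {l i .. u i})"
    "incseq u" "decseq l" "\<And>i. l i < u i" "\<And>i. lend P < l i" "\<And>i. u i < rend P"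
    "(\<lambda>i. ereal (l i)) \<longlonglongrightarrow> lend P" "(\<lambda>i. ereal (u i)) \<longlonglongrightarrow> rend P"
    by (rule einterval_Icc_approximation[OF lend_less_rend]) blast
  show ?thesis
  proof (rule that[of l u])
    show "l n \<in> I" "u n \<in> I" for n
      unfolding Ivl_einterval ul(1) using ul(4)[of n] by (auto intro: less_imp_le)
    fix x assume "x \<in> I"
    then have "lend P < ereal x" "ereal x < rend P" by (auto simp: Ivl_def)
    then have "eventually (\<lambda>n. ereal (l n) < ereal x) sequentially"
      "eventually (\<lambda>n. ereal x < ereal (u n)) sequentially"
      using order_tendstoD[OF ul(7)] order_tendstoD[OF ul(8)] by blast+
    then show "eventually (\<lambda>n. l n < x \<and> x < u n) sequentially" by eventually_elim auto
  qed (use ul in auto)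
qed

lemma Ivl_nonempty: obtains c where "c \<in> I"
  using Ivl_exhaustion by metis

lemma Ivl_less: assumes "x \<in> I" obtains y where "y \<in> I" "y < x"
  using Ivl_exhaustion eventually_happens'[OF sequentially_bot] assms by (metis (no_types, lifting))

lemma Ivl_greater: assumes "x \<in> I" obtains y where "y \<in> I" "x < y"
  using Ivl_exhaustion eventually_happens'[OF sequentially_bot] assms by (metis (no_types, lifting))

lemma loc_int_sub:
  assumes "loc_int P M h" "locfin M" "A \<in> sets borel" "A \<subseteq> {c..d}" "c \<in> I" "d \<in> I"
  shows "set_integrable M A h"
  using assms unfolding loc_int_def by (auto intro: set_integrable_subset[of M "{c..d}"] simp: locfin_sets)

lemma loc_int_Ico: "loc_int P M h \<Longrightarrow> locfin M \<Longrightarrow> c \<in> I \<Longrightarrow> d \<in> I \<Longrightarrow> set_integrable M {c..<d} h"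
  by (rule loc_int_sub[where c=c and d=d]) auto

text \<open>Local integrability contains measurability on compact subintervals only; the exhaustion
  carries it over to (a,b).\<close>

lemma loc_int_borel_on:
  assumes h: "loc_int P M h" and M: "locfin M" shows "borel_on h"
  unfolding set_borel_measurable_def
proof -
  obtain l u where lu: "\<And>n. l n \<in> I" "\<And>n. u n \<in> I"
    "\<And>x. x \<in> I \<Longrightarrow> eventually (\<lambda>n. l n < x \<and> x < u n) sequentially"
    using Ivl_exhaustion by metis
  show "(\<lambda>x. indicator I x *\<^sub>R h x) \<in> borel_measurable borel"
  proof (rule borel_measurable_LIMSEQ_metric[where f="\<lambda>n x. indicator {l n..u n} x *\<^sub>R h x"])
    show "(\<lambda>x. indicator {l n..u n} x *\<^sub>R h x) \<in> borel_measurable borel" for n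
      using h[unfolded loc_int_def, rule_format, OF lu(1,2), of n n] unfolding set_integrable_def
      by (auto dest!: borel_measurable_integrable simp: measurable_cong_sets[OF locfin_sets[OF M] refl])
    fix x
    show "(\<lambda>n. indicator {l n..u n} x *\<^sub>R h x) \<longlonglongrightarrow> indicator I x *\<^sub>R h x"
    proof (cases "x \<in> I")
      case True
      show ?thesis
        by (rule tendsto_eventually, use lu(3)[OF True] in eventually_elim) (use True in auto)
    next
      case False
      then have "x \<notin> {l n..u n}" for n using Icc_sub_Ivl[OF lu(1,2)] by blast
      then show ?thesis using False by simp
    qed
  qed
qed

lemma borel_on_sub:
  fixes h :: "real \<Rightarrow> 'b::{banach, second_countable_topology}"
  assumes "set_borel_measurable borel I h" "locfin M" "A \<in> sets borel" "A \<subseteq> I" shows "set_borel_measurable M A h"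
proof -
  have "set_borel_measurable borel A h" using assms by (auto intro: set_borel_measurable_subset)
  then show ?thesis unfolding set_borel_measurable_def
    by (simp add: measurable_cong_sets[OF locfin_sets[OF assms(2)] refl])
qed

lemma locfin_finite:
  assumes M: "locfin M" and A: "A \<in> sets borel" "A \<subseteq> {c..d}" "c \<in> I" "d \<in> I"
  shows "emeasure M A < \<infinity>"
proof -
  have "emeasure M A \<le> emeasure M {c..d}" using A locfin_sets[OF M] by (intro emeasure_mono) auto
  also have "\<dots> < \<infinity>" using M A by (auto simp: loc_finite_def)
  finally show ?thesis .
qed

lemma borel_on_bounded_integrable:
  assumes h: "borel_on h" and M: "locfin M" and A: "A \<in> sets borel" "A \<subseteq> {c..d}" "c \<in> I" "d \<in> I"
    and b: "\<And>t. t \<in> A \<Longrightarrow> norm (h t) \<le> B"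
  shows "set_integrable M A h"
proof (rule set_integrable_bound[where f="\<lambda>_. B"])
  have "emeasure M A < \<infinity>" by (rule locfin_finite[OF M A])
  then show "set_integrable M A (\<lambda>_. B)"
    unfolding set_integrable_def using A(1) by (simp add: locfin_sets[OF M])
  show "set_borel_measurable M A h"
    by (rule borel_on_sub[OF h M A(1)]) (use A(2) Icc_sub_Ivl[OF A(3,4)] in blast)
  show "AE x in M. x \<in> A \<longrightarrow> norm (h x) \<le> norm B" using b by (force intro!: AE_I2)
qed

lemma borel_on_bounded_loc_int:
  assumes "borel_on h" "locfin M" "\<And>c d. c \<in> I \<Longrightarrow> d \<in> I \<Longrightarrow> \<exists>B. \<forall>t\<in>{c..d}. norm (h t) \<le> B"
  shows "loc_int P M h"
  unfolding loc_int_def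
proof (intro allI impI)
  fix c d assume cd: "c \<in> I" "d \<in> I"
  obtain B where "\<forall>t\<in>{c..d}. norm (h t) \<le> B" using assms(3)[OF cd] by blast
  then show "set_integrable M {c..d} h"
    by (intro borel_on_bounded_integrable[OF assms(1,2) _ _ cd, where B=B]) auto
qed

lemma Ico_split:
  assumes h: "loc_int P M h" and M: "locfin M" and x: "x \<in> I" "z \<in> I" and o: "x \<le> y" "y \<le> z"
  shows "set_lebesgue_integral M {x..<z} h =
    set_lebesgue_integral M {x..<y} h + set_lebesgue_integral M {y..<z} h"
proof -
  have "{x..<z} = {x..<y} \<union> {y..<z}" using o by auto
  moreover have "y \<in> I" using Ivl_between x o by blast
  ultimately show ?thesis using x
    by (simp only:) (intro set_integral_Un loc_int_Ico[OF h M], auto)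
qed

lemma mint_trans:
  assumes h: "loc_int P M h" and M: "locfin M" and x: "x \<in> I" "y \<in> I" "z \<in> I"
  shows "mint M x z h = mint M x y h + mint M y z h"
proof -
  have e: "{s..<t} = {}" if "t \<le> s" for s t :: real using that by auto
  note sp = Ico_split[OF h M]
  consider "x \<le> y" "y \<le> z" | "x \<le> z" "z \<le> y" | "y \<le> x" "x \<le> z" | "y \<le> z" "z \<le> x"
    | "z \<le> x" "x \<le> y" | "z \<le> y" "y \<le> x" by linarith
  then show ?thesis unfolding mint_eq
    by cases (use x in \<open>simp_all add: e sp[of x z y] sp[of x y z] sp[of y z x] sp[of y x z] sp[of z y x] sp[of z x y]\<close>)
qed

section \<open>Increments over half-open intervals\<close>

lemma mint_le: "x \<le> y \<Longrightarrow> mint M x y h = set_lebesgue_integral M {x..<y} h"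
  by (auto simp: mint_eq)

text \<open>An antisymmetric increment function is determined by its values for x < y, where
  \<open>mint\<close> is a plain integral over [x,y). This removes the case distinction of
  \<open>mint\<close> from both \<open>acd\<close> and \<open>acd_rho\<close>.\<close>

lemma increments_iff_mint:
  assumes sw: "\<And>x y. m x y = - (m y x :: complex)"
  shows "(\<forall>c\<in>I. \<forall>x\<in>I. f x = f c + m c x) \<longleftrightarrow>
    (\<forall>x\<in>I. \<forall>y\<in>I. x < y \<longrightarrow> f y - f x = m x y)" (is "?L \<longleftrightarrow> ?R")
proof
  assume ?R
  show ?L
  proof (intro ballI)
    fix c x assume cx: "c \<in> I" "x \<in> I"
    have "m c c = 0" using sw[of c c] by simp
    then show "f x = f c + m c x"
      using \<open>?R\<close>[rule_format, OF cx] \<open>?R\<close>[rule_format, OF cx(2,1)] sw[of c x]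
      by (cases x c rule: linorder_cases) (simp_all add: algebra_simps)
  qed
next
  assume L: ?L
  show ?R
  proof (intro ballI impI)
    fix x y assume "x \<in> I" "y \<in> I"
    then have "f y = f x + m x y" using L by blast
    then show "f y - f x = m x y" by (simp only: add_diff_cancel_left')
  qed
qed

lemma acd_iff:
  "acd P M f h \<longleftrightarrow> loc_int P M h \<and>
    (\<forall>x\<in>I. \<forall>y\<in>I. x < y \<longrightarrow> f y - f x = set_lebesgue_integral M {x..<y} h)"
  unfolding acd_def
  by (subst increments_iff_mint[where m="\<lambda>c x. mint M c x h"]) (auto simp: mint_eq)

lemma acdI:
  assumes "loc_int P M h"
    and "\<And>x y. x \<in> I \<Longrightarrow> y \<in> I \<Longrightarrow> x < y \<Longrightarrow> f y = f x + set_lebesgue_integral M {x..<y} h"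
  shows "acd P M f h"
  unfolding acd_iff using assms(1) by (auto simp: assms(2))

lemma acdD:
  assumes "acd P M f h"
  shows "loc_int P M h"
    and "\<And>x y. x \<in> I \<Longrightarrow> y \<in> I \<Longrightarrow> x \<le> y \<Longrightarrow> f y = f x + set_lebesgue_integral M {x..<y} h"
proof -
  fix x y assume xy: "x \<in> I" "y \<in> I" "x \<le> y"
  then have "f y = f x + mint M x y h" using assms unfolding acd_def by blast
  then show "f y = f x + set_lebesgue_integral M {x..<y} h" by (simp only: mint_le[OF xy(3)])
qed (use assms in \<open>simp add: acd_def\<close>)

definition qd_increment where
  "qd_increment x y f tf = set_lebesgue_integral (chim P) {x..<y} f
     - set_lebesgue_integral (rho_p P) {x..<y} tf + set_lebesgue_integral (rho_m P) {x..<y} tf"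

text \<open>Moving the base point c of the integral against \<open>chim\<close> changes the function
  in \<open>acd_rho\<close> by a constant, which cancels in increments. What remains is a condition
  on the increments of \<open>f1\<close> without c.\<close>

lemma qd_iff:
  "qd P f f1 tf \<longleftrightarrow> acd P (vsig P) f f1 \<and> loc_int P (chim P) f \<and>
    loc_int P (rho_p P) tf \<and> loc_int P (rho_m P) tf \<and>
    (\<forall>x\<in>I. \<forall>y\<in>I. x < y \<longrightarrow> f1 y - f1 x = qd_increment x y f tf)"
proof (cases "loc_int P (chim P) f")
  case True
  obtain c0 where c0: "c0 \<in> I" using Ivl_nonempty .
  have eq: "acd_rho P (\<lambda>x. - f1 x + mint (chim P) c x f) tf \<longleftrightarrow> loc_int P (rho_p P) tf \<and> loc_int P (rho_m P) tf \<and>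
    (\<forall>x\<in>I. \<forall>y\<in>I. x < y \<longrightarrow> f1 y - f1 x = qd_increment x y f tf)" if c: "c \<in> I" for c
  proof -
    have *: "mint (chim P) c y f = mint (chim P) c x f + set_lebesgue_integral (chim P) {x..<y} f"
      if "x \<in> I" "y \<in> I" "x < y" for x y
      using mint_trans[OF True locfin_measures(2) c that(1,2)] that by (simp add: mint_le)
    have "(\<forall>c'\<in>I. \<forall>x\<in>I. - f1 x + mint (chim P) c x f = - f1 c' + mint (chim P) c c' f +
        (mint (rho_p P) c' x tf - mint (rho_m P) c' x tf)) \<longleftrightarrow>
      (\<forall>x\<in>I. \<forall>y\<in>I. x < y \<longrightarrow> (- f1 y + mint (chim P) c y f) - (- f1 x + mint (chim P) c x f) =
        mint (rho_p P) x y tf - mint (rho_m P) x y tf)"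
      by (rule increments_iff_mint) (simp add: mint_eq)
    also have "\<dots> \<longleftrightarrow> (\<forall>x\<in>I. \<forall>y\<in>I. x < y \<longrightarrow> f1 y - f1 x = qd_increment x y f tf)"
      by (intro ball_cong refl imp_cong) (auto simp: * mint_le qd_increment_def algebra_simps)
    finally show ?thesis unfolding acd_rho_def by blast
  qed
  show ?thesis unfolding qd_def using eq True c0 by blast
qed (auto simp: qd_def)

lemma qdI:
  assumes "acd P (vsig P) f f1" "loc_int P (chim P) f" "loc_int P (rho_p P) tf" "loc_int P (rho_m P) tf"
    and "\<And>x y. x \<in> I \<Longrightarrow> y \<in> I \<Longrightarrow> x < y \<Longrightarrow> f1 y = f1 x + qd_increment x y f tf"
  shows "qd P f f1 tf"
  unfolding qd_iff using assms(1-4) by (auto simp: assms(5))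

lemma qdD:
  assumes "qd P f f1 tf"
  shows "acd P (vsig P) f f1" "loc_int P (vsig P) f1" "loc_int P (chim P) f" "loc_int P (rho_p P) tf" "loc_int P (rho_m P) tf"
    and "\<And>x y. x \<in> I \<Longrightarrow> y \<in> I \<Longrightarrow> x \<le> y \<Longrightarrow> f1 y = f1 x + qd_increment x y f tf"
proof -
  show "f1 y = f1 x + qd_increment x y f tf" if "x \<in> I" "y \<in> I" "x \<le> y" for x y
  proof (cases "x = y")
    case False
    then have "f1 y - f1 x = qd_increment x y f tf" using assms that unfolding qd_iff by auto
    then show ?thesis by (simp add: algebra_simps)
  qed (simp add: qd_increment_def)
qed (use assms in \<open>auto simp: qd_iff acd_iff\<close>)

text \<open>Left of u n and right of l n, f is a constant plus an integral depending on its upper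
  limit, which is a measurable function by the measurability of parameter integrals. The exhaustion
  does the rest.\<close>

lemma acd_borel_on:
  assumes f: "acd P M f h" and M: "locfin M" shows "borel_on f"
proof -
  note h = acdD(1)[OF f]
  note hm = loc_int_borel_on[OF h M]
  obtain l u where lu: "\<And>n. l n \<in> I" "\<And>n. u n \<in> I"
    "\<And>x. x \<in> I \<Longrightarrow> eventually (\<lambda>n. l n < x \<and> x < u n) sequentially"
    using Ivl_exhaustion by metis
  have sM[measurable_cong]: "sets M = sets borel" by (rule locfin_sets[OF M])
  define G where "G n x = f (l n) + set_lebesgue_integral M {l n..<x} h" for n x
  \<comment> \<open>M is controlled on compact subintervals of (a,b) only, so it is restricted to
    [l n, u n] to obtain a finite measure for the parameter integral.\<close>
  define G' where "G' n x = f (l n) + (\<integral>t. indicator {..<x} t *\<^sub>R (indicator I t *\<^sub>R h t)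
      \<partial>(density M (\<lambda>t. ennreal (indicator {l n..u n} t))))" for n x
  have hI[measurable]: "(\<lambda>x. indicator I x *\<^sub>R h x) \<in> borel_measurable borel"
    using hm by (simp add: set_borel_measurable_def)
  have G'm: "G' n \<in> borel_measurable borel" for n
  proof -
    interpret N: finite_measure "density M (\<lambda>t. ennreal (indicator {l n..u n} t))"
      using locfin_finite[OF M _ order_refl lu(1,2), of n n] sets_eq_imp_space_eq[OF sM]
      by (intro finite_measureI) (simp add: emeasure_density sM ennreal_indicator)
    have "(\<lambda>(x, t). indicator {..<x} t *\<^sub>R (indicator I t *\<^sub>R h t)) =
      (\<lambda>z. if snd z < fst z then indicator I (snd z) *\<^sub>R h (snd z) else 0)"
      by (auto simp: fun_eq_iff)
    moreover have "(\<lambda>z. if snd z < fst z then indicator I (snd z) *\<^sub>R h (snd z) else 0)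
      \<in> borel_measurable (borel \<Otimes>\<^sub>M density M (\<lambda>t. ennreal (indicator {l n..u n} t)))"
      by measurable
    ultimately have "(\<lambda>x. \<integral>t. indicator {..<x} t *\<^sub>R (indicator I t *\<^sub>R h t)
      \<partial>(density M (\<lambda>t. ennreal (indicator {l n..u n} t)))) \<in> borel_measurable borel"
      by (intro N.borel_measurable_lebesgue_integral) simp
    then show ?thesis unfolding G'_def by simp
  qed
  have GG': "G' n x = f x" if "x \<in> I" "l n < x" "x < u n" for n x
  proof -
    have "(\<integral>t. indicator {..<x} t *\<^sub>R (indicator I t *\<^sub>R h t) \<partial>(density M (\<lambda>t. ennreal (indicator {l n..u n} t)))) =
      (\<integral>t. indicator {l n..u n} t *\<^sub>R (indicator {..<x} t *\<^sub>R (indicator I t *\<^sub>R h t)) \<partial>M)"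
    proof (rule integral_density)
      show "(\<lambda>t. indicator {..<x} t *\<^sub>R (indicator I t *\<^sub>R h t)) \<in> borel_measurable M"
        by measurable
    qed auto
    also have "\<dots> = set_lebesgue_integral M {l n..<x} h"
      unfolding set_lebesgue_integral_def using that Ivl_between[OF lu(1)[of n] that(1)]
      by (intro Bochner_Integration.integral_cong) (auto split: split_indicator)
    finally show ?thesis unfolding G'_def using acdD(2)[OF f lu(1)[of n] that(1)] that by simp
  qed
  show ?thesis unfolding set_borel_measurable_def
  proof (rule borel_measurable_LIMSEQ_metric[where f="\<lambda>n x. indicator I x *\<^sub>R G' n x"])
    show "(\<lambda>x. indicator I x *\<^sub>R G' n x) \<in> borel_measurable borel" for n
      using G'm by measurable
    fix x
    show "(\<lambda>n. indicator I x *\<^sub>R G' n x) \<longlonglongrightarrow> indicator I x *\<^sub>R f x"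
    proof (cases "x \<in> I")
      case True
      show ?thesis
        by (rule tendsto_eventually, use lu(3)[OF True] in eventually_elim) (use True GG' in auto)
    qed simp
  qed
qed

lemma Ico_norm_bounded:
  assumes h: "loc_int P M (h :: real \<Rightarrow> complex)" and M: "locfin M" and cd: "c \<in> I" "d \<in> I"
  obtains B where "\<And>x y. c \<le> x \<Longrightarrow> y \<le> d \<Longrightarrow> norm (set_lebesgue_integral M {x..<y} h) \<le> B"
proof
  fix x y assume "c \<le> x" "y \<le> d"
  then show "norm (set_lebesgue_integral M {x..<y} h) \<le> set_lebesgue_integral M {c..d} (\<lambda>t. norm (h t))"
    using h cd locfin_sets[OF M] unfolding loc_int_def
    by (intro set_integral_norm_le) (auto intro: set_integrable_norm)
qed

text \<open>Atoms of M make f discontinuous, so boundedness on compact intervals cannot come from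
  continuity; the integral of |h| bounds all increments instead.\<close>

lemma acd_bounded:
  assumes f: "acd P M f h" and M: "locfin M" and cd: "c \<in> I" "d \<in> I"
  shows "\<exists>B. \<forall>t\<in>{c..d}. norm (f t) \<le> B"
proof -
  obtain B where B: "\<And>x y. c \<le> x \<Longrightarrow> y \<le> d \<Longrightarrow> norm (set_lebesgue_integral M {x..<y} h) \<le> B"
    by (rule Ico_norm_bounded[OF acdD(1)[OF f] M cd]) blast
  show ?thesis
  proof (intro exI ballI)
    fix t assume t: "t \<in> {c..d}"
    then have "f t = f c + set_lebesgue_integral M {c..<t} h"
      using Ivl_between[OF cd] cd by (intro acdD(2)[OF f]) auto
    then show "norm (f t) \<le> norm (f c) + B" using B[of c t] t by (auto intro: norm_triangle_le)
  qed
qed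

lemma qd_bounded:
  assumes f: "qd P f f1 tf" and cd: "c \<in> I" "d \<in> I"
  shows "\<exists>B. \<forall>t\<in>{c..d}. norm (f1 t) \<le> B"
proof -
  obtain B1 where B1: "\<And>x y. c \<le> x \<Longrightarrow> y \<le> d \<Longrightarrow> norm (set_lebesgue_integral (chim P) {x..<y} f) \<le> B1"
    using Ico_norm_bounded[OF qdD(3)[OF f] _ cd] by auto
  obtain B2 where B2: "\<And>x y. c \<le> x \<Longrightarrow> y \<le> d \<Longrightarrow> norm (set_lebesgue_integral (rho_p P) {x..<y} tf) \<le> B2"
    using Ico_norm_bounded[OF qdD(4)[OF f] _ cd] by auto
  obtain B3 where B3: "\<And>x y. c \<le> x \<Longrightarrow> y \<le> d \<Longrightarrow> norm (set_lebesgue_integral (rho_m P) {x..<y} tf) \<le> B3"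
    using Ico_norm_bounded[OF qdD(5)[OF f] _ cd] by auto
  show ?thesis
  proof (intro exI ballI)
    fix t assume t: "t \<in> {c..d}"
    then have "f1 t = f1 c + qd_increment c t f tf"
      using Ivl_between[OF cd] cd by (intro qdD(6)[OF f]) auto
    moreover have "norm (qd_increment c t f tf) \<le> B1 + B2 + B3"
      unfolding qd_increment_def using B1[of c t] B2[of c t] B3[of c t] t
      by (intro norm_triangle_le norm_triangle_le_diff add_mono) auto
    ultimately show "norm (f1 t) \<le> norm (f1 c) + (B1 + B2 + B3)" by (auto intro: norm_triangle_le)
  qed
qed

text \<open>After truncating h to [l n, u n), an integral over a left ray becomes one over a
  half-open subinterval of (a,b), so the statement for rays applies for each n.\<close>

lemma AE_zero_if_Ico_zero:
  assumes h: "loc_int P M h" and M: "locfin M"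
    and z: "\<And>x y. x \<in> I \<Longrightarrow> y \<in> I \<Longrightarrow> x < y \<Longrightarrow> set_lebesgue_integral M {x..<y} h = 0"
  shows "AE t in M. t \<in> I \<longrightarrow> h t = 0"
proof -
  obtain l u where lu: "\<And>n. l n \<in> I" "\<And>n. u n \<in> I" "\<And>n. l n < u n"
    "\<And>x. x \<in> I \<Longrightarrow> eventually (\<lambda>n. l n < x \<and> x < u n) sequentially"
    using Ivl_exhaustion by metis
  have "AE t in M. indicator {l n..<u n} t *\<^sub>R h t = 0" for n
  proof (rule AE_zero_if_lessThan_integrals_zero[OF locfin_sets[OF M]])
    show "integrable M (\<lambda>t. indicator {l n..<u n} t *\<^sub>R h t)"
      using loc_int_Ico[OF h M lu(1,2)] by (simp add: set_integrable_def)
    fix s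
    have "set_lebesgue_integral M {..<s} (\<lambda>t. indicator {l n..<u n} t *\<^sub>R h t) =
      set_lebesgue_integral M {l n..<min s (u n)} h"
      unfolding set_lebesgue_integral_def
      by (intro Bochner_Integration.integral_cong) (auto split: split_indicator)
    also have "\<dots> = 0"
    proof (cases "l n < s")
      case True
      then have "min s (u n) \<in> I" using lu(3)[of n] by (intro Ivl_between[OF lu(1,2)[of n]]) auto
      then show ?thesis using True lu(1,3)[of n] by (intro z) auto
    qed auto
    finally show "set_lebesgue_integral M {..<s} (\<lambda>t. indicator {l n..<u n} t *\<^sub>R h t) = 0" .
  qed
  then have "AE t in M. \<forall>n. indicator {l n..<u n} t *\<^sub>R h t = 0" unfolding AE_all_countable by blast
  then show ?thesis
  proof (eventually_elim, intro impI)
    fix t assume *: "\<forall>n. indicator {l n..<u n} t *\<^sub>R h t = 0" "t \<in> I"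
    obtain n where "l n < t \<and> t < u n" using eventually_happens'[OF sequentially_bot lu(4)[OF *(2)]] by blast
    then show "h t = 0" using *(1)[rule_format, of n] by auto
  qed
qed

section \<open>Linearity, conjugation and glueing\<close>

lemma loc_int_add: "loc_int P M f \<Longrightarrow> loc_int P M g \<Longrightarrow> loc_int P M (\<lambda>x. f x + g x)"
  by (auto simp: loc_int_def)
lemma loc_int_diff: "loc_int P M f \<Longrightarrow> loc_int P M g \<Longrightarrow> loc_int P M (\<lambda>x. f x - g x)"
  by (auto simp: loc_int_def)
lemma loc_int_cmult: "loc_int P M f \<Longrightarrow> loc_int P M (\<lambda>x. a * f x)"
  by (auto simp: loc_int_def)
lemma loc_int_cnj: "loc_int P M f \<Longrightarrow> loc_int P M (\<lambda>x. cnj (f x))"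
proof -
  have "(\<lambda>x. indicator A x *\<^sub>R cnj (f x)) = (\<lambda>x. cnj (indicator A x *\<^sub>R f x))" for A by auto
  then show "loc_int P M f \<Longrightarrow> loc_int P M (\<lambda>x. cnj (f x))"
    unfolding loc_int_def set_integrable_def by (metis bounded_linear_cnj integrable_bounded_linear)
qed

lemma set_integral_cnj: "set_lebesgue_integral M A (\<lambda>x. cnj (f x)) = cnj (set_lebesgue_integral M A f)"
proof -
  have "(\<lambda>x. indicator A x *\<^sub>R cnj (f x)) = (\<lambda>x. cnj (indicator A x *\<^sub>R f x))" by auto
  then show ?thesis by (simp only: set_lebesgue_integral_def Bochner_Integration.integral_cnj)
qed

lemma acd_AE_unique:
  assumes "acd P M f h" "acd P M f h'" "locfin M"
  shows "AE t in M. t \<in> I \<longrightarrow> h t = h' t"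
proof -
  have "AE t in M. t \<in> I \<longrightarrow> h t - h' t = 0"
  proof (rule AE_zero_if_Ico_zero)
    show "loc_int P M (\<lambda>t. h t - h' t)" using assms by (intro loc_int_diff acdD)
    fix x y assume "x \<in> I" "y \<in> I" "x < y"
    then show "set_lebesgue_integral M {x..<y} (\<lambda>t. h t - h' t) = 0"
      using acdD(2)[OF assms(1), of x y] acdD(2)[OF assms(2), of x y] assms(3)
      by (subst set_integral_diff) (auto intro!: loc_int_Ico acdD[OF assms(1)] acdD[OF assms(2)])
  qed (rule assms)
  then show ?thesis by eventually_elim auto
qed

lemma acd_add:
  assumes "acd P M f h" "acd P M g k" "locfin M"
  shows "acd P M (\<lambda>x. f x + g x) (\<lambda>x. h x + k x)"
  unfolding acd_iff
proof (intro conjI ballI impI)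
  show "loc_int P M (\<lambda>x. h x + k x)" using assms by (intro loc_int_add acdD)
  fix x y assume xy: "x \<in> I" "y \<in> I" "x < y"
  show "f y + g y - (f x + g x) = set_lebesgue_integral M {x..<y} (\<lambda>x. h x + k x)"
    using xy acdD(2)[OF assms(1) xy(1,2)] acdD(2)[OF assms(2) xy(1,2)] assms(3)
    by (subst set_integral_add) (auto intro!: loc_int_Ico acdD[OF assms(1)] acdD[OF assms(2)])
qed

lemma acd_cmult:
  assumes "acd P M f h" shows "acd P M (\<lambda>x. a * f x) (\<lambda>x. a * h x)"
proof (rule acdI)
  show "loc_int P M (\<lambda>x. a * h x)" by (intro loc_int_cmult acdD[OF assms])
  fix x y assume "x \<in> I" "y \<in> I" "x < y"
  then show "a * f y = a * f x + set_lebesgue_integral M {x..<y} (\<lambda>x. a * h x)"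
    using acdD(2)[OF assms, of x y] by (simp add: algebra_simps)
qed

lemma acd_diff:
  assumes "acd P M f h" "acd P M g k" "locfin M"
  shows "acd P M (\<lambda>x. f x - g x) (\<lambda>x. h x - k x)"
  using acd_add[OF assms(1) acd_cmult[OF assms(2), of "-1"] assms(3)] by simp

lemma acd_cnj:
  assumes "acd P M f h" shows "acd P M (\<lambda>x. cnj (f x)) (\<lambda>x. cnj (h x))"
proof (rule acdI)
  show "loc_int P M (\<lambda>x. cnj (h x))" by (intro loc_int_cnj acdD[OF assms])
  fix x y assume "x \<in> I" "y \<in> I" "x < y"
  then show "cnj (f y) = cnj (f x) + set_lebesgue_integral M {x..<y} (\<lambda>x. cnj (h x))"
    using acdD(2)[OF assms, of x y] by (simp add: set_integral_cnj)
qed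

lemma loc_int_cong: "(\<And>x. x \<in> I \<Longrightarrow> f x = g x) \<Longrightarrow> loc_int P M f \<longleftrightarrow> loc_int P M g"
  unfolding loc_int_def using Icc_sub_Ivl by (intro all_cong1 imp_cong refl set_integrable_cong) blast+

lemma Ico_integral_cong:
  assumes "x \<in> I" "y \<in> I" "\<And>t. x \<le> t \<Longrightarrow> t < y \<Longrightarrow> f t = g t"
  shows "set_lebesgue_integral M {x..<y} f = set_lebesgue_integral M {x..<y} g"
  unfolding set_lebesgue_integral_def using assms(3)
  by (intro Bochner_Integration.integral_cong) (auto split: split_indicator)

lemma acd_cong:
  assumes "acd P M f h" "\<And>x. x \<in> I \<Longrightarrow> f x = f' x" "\<And>x. x \<in> I \<Longrightarrow> h x = h' x"
  shows "acd P M f' h'"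
  unfolding acd_iff
proof (intro conjI ballI impI)
  show "loc_int P M h'" using loc_int_cong[OF assms(3)] acdD(1)[OF assms(1)] by simp
  fix x y assume xy: "x \<in> I" "y \<in> I" "x < y"
  have "set_lebesgue_integral M {x..<y} h = set_lebesgue_integral M {x..<y} h'"
    using Ivl_between[OF xy(1,2)] assms(3) by (intro Ico_integral_cong xy) auto
  then show "f' y - f' x = set_lebesgue_integral M {x..<y} h'"
    using acdD(2)[OF assms(1) xy(1,2)] xy assms(2)[OF xy(1)] assms(2)[OF xy(2)] by simp
qed

lemma qd_cong:
  assumes "qd P f f1 tf" "\<And>x. x \<in> I \<Longrightarrow> f x = g x" "\<And>x. x \<in> I \<Longrightarrow> f1 x = g1 x" "\<And>x. x \<in> I \<Longrightarrow> tf x = tg x"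
  shows "qd P g g1 tg"
  unfolding qd_iff
proof (intro conjI ballI impI)
  show "acd P (vsig P) g g1" by (rule acd_cong[OF qdD(1)[OF assms(1)] assms(2,3)])
  show "loc_int P (chim P) g" "loc_int P (rho_p P) tg" "loc_int P (rho_m P) tg"
    using loc_int_cong[OF assms(2)] loc_int_cong[OF assms(4)] qdD[OF assms(1)] by auto
  fix x y assume xy: "x \<in> I" "y \<in> I" "x < y"
  have "qd_increment x y f tf = qd_increment x y g tg"
    unfolding qd_increment_def using Ivl_between[OF xy(1,2)] assms(2,4)
    by (intro arg_cong2[where f="(+)"] arg_cong2[where f="(-)"] Ico_integral_cong xy) auto
  then show "g1 y - g1 x = qd_increment x y g tg"
    using qdD(6)[OF assms(1) xy(1,2)] xy assms(3)[OF xy(1)] assms(3)[OF xy(2)] by simp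
qed

lemma qd_cnj:
  assumes "qd P f f1 tf" shows "qd P (\<lambda>x. cnj (f x)) (\<lambda>x. cnj (f1 x)) (\<lambda>x. cnj (tf x))"
proof (rule qdI)
  fix x y assume "x \<in> I" "y \<in> I" "x < y"
  then show "cnj (f1 y) = cnj (f1 x) + qd_increment x y (\<lambda>x. cnj (f x)) (\<lambda>x. cnj (tf x))"
    using qdD(6)[OF assms, of x y] by (simp add: set_integral_cnj qd_increment_def)
qed (intro loc_int_cnj acd_cnj qdD[OF assms])+

lemma qd_cmult:
  assumes "qd P f f1 tf" shows "qd P (\<lambda>x. a * f x) (\<lambda>x. a * f1 x) (\<lambda>x. a * tf x)"
proof (rule qdI)
  fix x y assume "x \<in> I" "y \<in> I" "x < y"
  then have e: "f1 y = f1 x + qd_increment x y f tf" by (intro qdD(6)[OF assms]) auto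
  show "a * f1 y = a * f1 x + qd_increment x y (\<lambda>x. a * f x) (\<lambda>x. a * tf x)"
    unfolding e by (simp add: algebra_simps qd_increment_def)
qed (intro loc_int_cmult acd_cmult qdD[OF assms])+

lemma set_integrable_glue:
  fixes f g :: "real \<Rightarrow> complex"
  assumes "set_integrable M {x..y} f" "set_integrable M {x..y} g" "locfin M"
  shows "set_integrable M {x..y} (\<lambda>t. if t < (c::real) then f t else g t)"
proof -
  have "set_integrable M ({x..y} \<inter> {..<c}) (\<lambda>t. if t < c then f t else g t)"
    using set_integrable_subset[OF assms(1), of "{x..y} \<inter> {..<c}"] locfin_sets[OF assms(3)]
    by (subst set_integrable_cong[OF refl refl, of _ _ f]) auto
  moreover have "set_integrable M ({x..y} \<inter> {c..}) (\<lambda>t. if t < c then f t else g t)"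
    using set_integrable_subset[OF assms(2), of "{x..y} \<inter> {c..}"] locfin_sets[OF assms(3)]
    by (subst set_integrable_cong[OF refl refl, of _ _ g]) auto
  moreover have "{x..y} = {x..y} \<inter> {..<c} \<union> {x..y} \<inter> {c..}" by auto
  ultimately show ?thesis
    using set_integrable_Un[of M "{x..y} \<inter> {..<c}" _ "{x..y} \<inter> {c..}"] locfin_sets[OF assms(3)] by auto
qed

lemma loc_int_glue:
  assumes "loc_int P M f" "loc_int P M g" "locfin M"
  shows "loc_int P M (\<lambda>t. if t < c then f t else g t)"
  using assms unfolding loc_int_def by (auto intro: set_integrable_glue)

text \<open>Switching at t < c matches the half-open intervals: [x,c) sees only f and [c,y) only g,
  so an atom at c causes no ambiguity.\<close>

lemma Ico_glue:
  assumes f: "loc_int P M f" and g: "loc_int P M g" and M: "locfin M" and xy: "x \<in> I" "y \<in> I"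
  shows "x \<le> y \<Longrightarrow> y \<le> c \<Longrightarrow> set_lebesgue_integral M {x..<y} (\<lambda>t. if t < c then f t else g t) = set_lebesgue_integral M {x..<y} f"
    and "c \<le> x \<Longrightarrow> set_lebesgue_integral M {x..<y} (\<lambda>t. if t < c then f t else g t) = set_lebesgue_integral M {x..<y} g"
    and "x \<le> c \<Longrightarrow> c \<le> y \<Longrightarrow> set_lebesgue_integral M {x..<y} (\<lambda>t. if t < c then f t else g t) =
       set_lebesgue_integral M {x..<c} f + set_lebesgue_integral M {c..<y} g"
proof -
  show 1: "set_lebesgue_integral M {x..<y} (\<lambda>t. if t < c then f t else g t) = set_lebesgue_integral M {x..<y} f" if "x \<le> y" "y \<le> c" for x y
    unfolding set_lebesgue_integral_def using that
    by (intro Bochner_Integration.integral_cong) (auto split: split_indicator)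
  show 2: "set_lebesgue_integral M {x..<y} (\<lambda>t. if t < c then f t else g t) = set_lebesgue_integral M {x..<y} g" if "c \<le> x" for x y
    unfolding set_lebesgue_integral_def using that
    by (intro Bochner_Integration.integral_cong) (auto split: split_indicator)
  show "set_lebesgue_integral M {x..<y} (\<lambda>t. if t < c then f t else g t) =
       set_lebesgue_integral M {x..<c} f + set_lebesgue_integral M {c..<y} g" if "x \<le> c" "c \<le> y"
    using Ico_split[OF loc_int_glue[OF f g M, of c] M xy that] 1[OF that(1) order_refl] 2[OF order_refl, of y] by simp
qed

lemma acd_glue:
  assumes f: "acd P M f h" and g: "acd P M g k" and M: "locfin M" and c: "c \<in> I" "f c = g c"
  shows "acd P M (\<lambda>t. if t < c then f t else g t) (\<lambda>t. if t < c then h t else k t)"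
  unfolding acd_iff
proof (intro conjI ballI impI)
  note hk = acdD(1)[OF f] acdD(1)[OF g]
  show "loc_int P M (\<lambda>t. if t < c then h t else k t)" by (intro loc_int_glue hk M)
  fix x y assume xy: "x \<in> I" "y \<in> I" "x < y"
  note fi = acdD(2)[OF f] and gi = acdD(2)[OF g]
  note gl = Ico_glue[OF hk M xy(1,2), of c]
  consider "y < c" | "c \<le> x" | "x < c" "c \<le> y" by linarith
  then show "(if y < c then f y else g y) - (if x < c then f x else g x) =
      set_lebesgue_integral M {x..<y} (\<lambda>t. if t < c then h t else k t)"
  proof cases
    case 1
    then show ?thesis using gl(1) fi[OF xy(1,2)] xy by simp
  next
    case 2
    then show ?thesis using gl(2) gi[OF xy(1,2)] xy by simp
  next
    case 3
    then show ?thesis using gl(3) fi[OF xy(1) c(1)] gi[OF c(1) xy(2)] c(2) by simp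
  qed
qed

lemma qd_glue:
  assumes f: "qd P f f1 tf" and g: "qd P g g1 tg" and c: "c \<in> I" "f c = g c" "f1 c = g1 c"
  shows "qd P (\<lambda>t. if t < c then f t else g t) (\<lambda>t. if t < c then f1 t else g1 t) (\<lambda>t. if t < c then tf t else tg t)"
  unfolding qd_iff
proof (intro conjI ballI impI)
  note F = qdD[OF f] and G = qdD[OF g]
  show "acd P (vsig P) (\<lambda>t. if t < c then f t else g t) (\<lambda>t. if t < c then f1 t else g1 t)"
    by (intro acd_glue F G c) auto
  show "loc_int P (chim P) (\<lambda>t. if t < c then f t else g t)"
    "loc_int P (rho_p P) (\<lambda>t. if t < c then tf t else tg t)"
    "loc_int P (rho_m P) (\<lambda>t. if t < c then tf t else tg t)"
    by (intro loc_int_glue F G locfin_measures)+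
  fix x y assume xy: "x \<in> I" "y \<in> I" "x < y"
  note gl = Ico_glue[OF F(3) G(3) _ xy(1,2), of c] Ico_glue[OF F(4) G(4) _ xy(1,2), of c] Ico_glue[OF F(5) G(5) _ xy(1,2), of c]
  consider "y < c" | "c \<le> x" | "x < c" "c \<le> y" by linarith
  then show "(if y < c then f1 y else g1 y) - (if x < c then f1 x else g1 x) =
      qd_increment x y (\<lambda>t. if t < c then f t else g t) (\<lambda>t. if t < c then tf t else tg t)"
  proof cases
    case 1
    then show ?thesis using gl F(6)[OF xy(1,2)] xy by (simp add: qd_increment_def)
  next
    case 2
    then show ?thesis using gl G(6)[OF xy(1,2)] xy by (simp add: qd_increment_def)
  next
    case 3
    then show ?thesis using gl F(6)[OF xy(1) c(1)] G(6)[OF c(1) xy(2)] c(2,3) by (simp add: qd_increment_def)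
  qed
qed

section \<open>Pointwise uniqueness of the quasi-derivative\<close>

lemma vsig_open_pos: "c \<in> I \<Longrightarrow> d \<in> I \<Longrightarrow> c < d \<Longrightarrow> emeasure (vsig P) {c<..<d} > 0"
  using setting unfolding sl_setting_def by blast

text \<open>Both functions are derivatives of f and agree almost everywhere for \<open>vsig\<close>.
  Since \<open>vsig\<close> charges every interval (y,x), they agree at points t n increasing to x,
  and the increments over [t n, x) tend to 0.\<close>

lemma qd_unique:
  assumes f: "qd P f f1 tf" and g: "qd P f g1 tg" and x: "x \<in> I"
  shows "f1 x = g1 x"
proof -
  note F = qdD[OF f] and G = qdD[OF g]
  obtain y0 where y0: "y0 \<in> I" "y0 < x" using Ivl_less[OF x] .
  have ae: "AE t in vsig P. t \<in> I \<longrightarrow> f1 t = g1 t" by (rule acd_AE_unique[OF F(1) G(1)]) simp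
  have "\<exists>t. y < t \<and> t < x \<and> f1 t = g1 t" if y: "y \<in> I" "y < x" for y
  proof (rule ccontr)
    assume "\<not> ?thesis"
    then have *: "\<And>t. t \<in> {y<..<x} \<Longrightarrow> f1 t \<noteq> g1 t" by auto
    from ae have "AE t in vsig P. t \<notin> {y<..<x}"
    proof eventually_elim
      case (elim t)
      then show ?case using * Ivl_between[OF y(1) x, of t] by auto
    qed
    then have "emeasure (vsig P) {y<..<x} = 0"
      by (subst (asm) AE_iff_null_sets[symmetric]) auto
    then show False using vsig_open_pos[OF y(1) x y(2)] by simp
  qed
  moreover have "max y0 (x - 1 / real (Suc n)) \<in> I" "max y0 (x - 1 / real (Suc n)) < x" for n
    using y0 by (auto intro!: Ivl_between[OF y0(1) x] add_pos_nonneg)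
  ultimately have "\<exists>t. max y0 (x - 1 / real (Suc n)) < t \<and> t < x \<and> f1 t = g1 t" for n by blast
  then obtain t where t: "\<And>n. max y0 (x - 1 / real (Suc n)) < t n" "\<And>n. t n < x" "\<And>n. f1 (t n) = g1 (t n)"
    by metis
  have tI: "t n \<in> I" for n using t(1,2)[of n] by (intro Ivl_between[OF y0(1) x]) auto
  have sh: "(\<lambda>n. set_lebesgue_integral M {t n..<x} h) \<longlonglongrightarrow> 0" if h: "loc_int P M h" and M: "locfin M" for M and h :: "real \<Rightarrow> complex"
  proof (rule set_integral_shrink[OF loc_int_Ico[OF h M y0(1) x]])
    show "{t n..<x} \<in> sets M" "{t n..<x} \<subseteq> {y0..<x}" for n using locfin_sets[OF M] t(1)[of n] by auto
    fix s assume "s \<in> {y0..<x}"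
    then obtain N where N: "1 / real (Suc N) < x - s" using nat_approx_posE[of "x - s"] by auto
    show "\<forall>\<^sub>F n in sequentially. s \<notin> {t n..<x}"
      using eventually_ge_at_top[of N]
    proof eventually_elim
      case (elim n)
      then have "1 / real (Suc n) \<le> 1 / real (Suc N)" by (simp add: frac_le)
      then show ?case using N t(1)[of n] by auto
    qed
  qed
  have "f1 x - g1 x = qd_increment (t n) x f tf - qd_increment (t n) x f tg" for n
    using F(6)[OF tI[of n] x] G(6)[OF tI[of n] x] t(2,3)[of n] by simp
  moreover have "(\<lambda>n. qd_increment (t n) x f tf - qd_increment (t n) x f tg) \<longlonglongrightarrow> (0 - 0 + 0) - (0 - 0 + 0)"
    unfolding qd_increment_def by (intro tendsto_intros sh F G locfin_measures)
  ultimately have "(\<lambda>n. f1 x - g1 x) \<longlonglongrightarrow> 0" by simp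
  then show ?thesis by (simp add: LIMSEQ_const_iff)
qed

lemma qder_eq: "qd P f f1 tf \<Longrightarrow> x \<in> I \<Longrightarrow> qder P f x = f1 x"
  unfolding qder_def by (rule someI2[of _ f1]) (auto intro: qd_unique)

lemma sder_acd: "acd P (vsig P) f h \<Longrightarrow> acd P (vsig P) f (sder P f)"
  unfolding sder_def using someI[of "acd P (vsig P) f" h] by simp

lemma sder_AE: "acd P (vsig P) f h \<Longrightarrow> AE t in vsig P. t \<in> I \<longrightarrow> sder P f t = h t"
  by (rule acd_AE_unique[OF sder_acd]) auto

end

section \<open>Integration by parts and the Lagrange identity\<close>

lemma integral_density_indicator:
  fixes k :: "'a \<Rightarrow> 'b::{banach, second_countable_topology}"
  assumes k: "k \<in> borel_measurable M" and A: "A \<in> sets M"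
  shows "integral\<^sup>L (density M (\<lambda>t. ennreal (indicator A t))) k = set_lebesgue_integral M A k"
    and "integrable (density M (\<lambda>t. ennreal (indicator A t))) k \<longleftrightarrow> set_integrable M A k"
  unfolding set_lebesgue_integral_def set_integrable_def
  using k A by (simp_all add: integral_density integrable_density)

context sturm_liouville
begin

lemma loc_int_mult_bounded:
  assumes G: "borel_on G" "\<And>c d. c \<in> I \<Longrightarrow> d \<in> I \<Longrightarrow> \<exists>B. \<forall>t\<in>{c..d}. norm (G t) \<le> B"
    and p: "loc_int P M p" and M: "locfin M"
  shows "loc_int P M (\<lambda>t. G t * p t)"
  unfolding loc_int_def
proof (intro allI impI)
  fix c d assume cd: "c \<in> I" "d \<in> I"
  obtain B where B: "\<forall>t\<in>{c..d}. norm (G t) \<le> B" using G(2)[OF cd] by blast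
  have pi: "set_integrable M {c..d} p" using p cd by (simp add: loc_int_def)
  show "set_integrable M {c..d} (\<lambda>t. G t * p t)"
  proof (rule set_integrable_bound[where f="\<lambda>t. complex_of_real B * p t"])
    show "set_integrable M {c..d} (\<lambda>t. complex_of_real B * p t)" using pi by simp
    show "set_borel_measurable M {c..d} (\<lambda>t. G t * p t)"
      by (rule borel_on_sub[OF set_borel_measurable_mult[OF G(1) loc_int_borel_on[OF p M]] M]) (auto intro: subsetD[OF Icc_sub_Ivl[OF cd]])
    show "AE t in M. t \<in> {c..d} \<longrightarrow> norm (G t * p t) \<le> norm (complex_of_real B * p t)"
    proof (rule AE_I2, intro impI)
      fix t assume "t \<in> {c..d}"
      then have "norm (G t) \<le> \<bar>B\<bar>" using B by force
      then show "norm (G t * p t) \<le> norm (complex_of_real B * p t)"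
        by (simp add: norm_mult mult_right_mono)
    qed
  qed
qed

lemma finite_density_Ico:
  assumes M: "locfin M" and ab: "\<alpha> \<in> I" "\<beta> \<in> I"
  shows "finite_measure (density M (\<lambda>t. ennreal (indicator {\<alpha>..<\<beta>} t)))"
  using locfin_finite[OF M _ _ ab, of "{\<alpha>..<\<beta>}"] sets_eq_imp_space_eq[OF locfin_sets[OF M]] locfin_sets[OF M]
  by (intro finite_measureI) (simp add: emeasure_density ennreal_indicator subset_eq)

lemma density_Ico_singleton:
  assumes M: "locfin M"
  shows "measure (density M (\<lambda>t. ennreal (indicator {\<alpha>..<\<beta>} t))) {t} = (if t \<in> {\<alpha>..<\<beta>} then measure M {t} else 0)"
proof -
  have "emeasure (density M (\<lambda>t. ennreal (indicator {\<alpha>..<\<beta>} t))) {t} = (\<integral>\<^sup>+ s. indicator ({\<alpha>..<\<beta>} \<inter> {t}) s \<partial>M)"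
    using locfin_sets[OF M] by (subst emeasure_density) (auto intro!: nn_integral_cong split: split_indicator)
  also have "\<dots> = emeasure M ({\<alpha>..<\<beta>} \<inter> {t})" using locfin_sets[OF M] by (intro nn_integral_indicator) auto
  finally show ?thesis by (auto simp: measure_def)
qed

text \<open>Restricted to [\<alpha>,\<beta>) both measures are finite, and the product of the two
  total increments splits over the triangles of the square. By the half-open convention both
  triangles are strict, so each common atom would leave an extra product of jumps; \<open>at\<close>
  excludes this.\<close>

lemma integration_by_parts:
  assumes F: "acd P M F p" and G: "acd P N G q" and M: "locfin M" and N: "locfin N"
    and at: "\<And>t. t \<in> I \<Longrightarrow> measure M {t} * measure N {t} = 0"
    and ab: "\<alpha> \<in> I" "\<beta> \<in> I" "\<alpha> \<le> \<beta>"
  shows "F \<beta> * G \<beta> - F \<alpha> * G \<alpha> = set_lebesgue_integral M {\<alpha>..<\<beta>} (\<lambda>t. G t * p t)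
    + set_lebesgue_integral N {\<alpha>..<\<beta>} (\<lambda>t. F t * q t)"
proof -
  note p = acdD(1)[OF F] and q = acdD(1)[OF G]
  define M' where "M' = density M (\<lambda>t. ennreal (indicator {\<alpha>..<\<beta>} t))"
  define N' where "N' = density N (\<lambda>t. ennreal (indicator {\<alpha>..<\<beta>} t))"
  \<comment> \<open>The density is known to be measurable on (a,b) only; cutting it off there makes
    it Borel on the whole line.\<close>
  define p' where "p' t = indicator I t *\<^sub>R p t" for t
  define q' where "q' t = indicator I t *\<^sub>R q t" for t
  have sI: "{\<alpha>..<\<beta>} \<subseteq> I" using Icc_sub_Ivl[OF ab(1,2)] by (meson atLeastLessThan_subseteq_atLeastAtMost_iff order_refl subset_trans)
  have tI: "t \<in> I" if "\<alpha> \<le> t" "t < \<beta>" for t using sI that by (meson atLeastLessThan_iff subsetD)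
  have mM: "k \<in> borel_measurable M \<longleftrightarrow> k \<in> borel_measurable borel" for k :: "real \<Rightarrow> complex"
    using measurable_cong_sets[OF locfin_sets[OF M] refl] by blast
  have mN: "k \<in> borel_measurable N \<longleftrightarrow> k \<in> borel_measurable borel" for k :: "real \<Rightarrow> complex"
    using measurable_cong_sets[OF locfin_sets[OF N] refl] by blast
  have p'm: "p' \<in> borel_measurable borel" and q'm: "q' \<in> borel_measurable borel"
    using loc_int_borel_on[OF p M] loc_int_borel_on[OF q N] by (auto simp: p'_def[abs_def] q'_def[abs_def] set_borel_measurable_def)
  have iI: "indicator I t = (1::real)" if "\<alpha> \<le> t" "t < \<beta>" for t using tI[OF that] by simp
  have cong: "set_lebesgue_integral M {\<alpha>..<\<beta>} k = set_lebesgue_integral M {\<alpha>..<\<beta>} k'"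
     "set_integrable M {\<alpha>..<\<beta>} k \<longleftrightarrow> set_integrable M {\<alpha>..<\<beta>} k'"
    if "\<And>t. \<alpha> \<le> t \<Longrightarrow> t < \<beta> \<Longrightarrow> k t = k' t" for k k' :: "real \<Rightarrow> complex" and M
    by (rule Ico_integral_cong[OF ab(1,2)], use that in blast)
      (rule set_integrable_cong[OF refl refl], use that in auto)
  have lt: "set_lebesgue_integral (density L (\<lambda>t. ennreal (indicator {\<alpha>..<\<beta>} t))) {..<s} (\<lambda>t. indicator I t *\<^sub>R k t)
      = set_lebesgue_integral L {\<alpha>..<s} k" if s: "\<alpha> \<le> s" "s < \<beta>" and k: "loc_int P L k" and L: "locfin L"
    for s k and L :: "real measure"
  proof -
    have "(\<lambda>t. indicator {..<s} t *\<^sub>R (indicator I t *\<^sub>R k t)) \<in> borel_measurable borel"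
    proof -
      have [measurable]: "(\<lambda>t. indicator I t *\<^sub>R k t) \<in> borel_measurable borel"
        using loc_int_borel_on[OF k L] by (simp add: set_borel_measurable_def)
      show ?thesis by measurable
    qed
    then have "(\<lambda>t. indicator {..<s} t *\<^sub>R (indicator I t *\<^sub>R k t)) \<in> borel_measurable L"
      using measurable_cong_sets[OF locfin_sets[OF L] refl] by blast
    then have "set_lebesgue_integral (density L (\<lambda>t. ennreal (indicator {\<alpha>..<\<beta>} t))) {..<s} (\<lambda>t. indicator I t *\<^sub>R k t)
      = set_lebesgue_integral L {\<alpha>..<\<beta>} (\<lambda>t. indicator {..<s} t *\<^sub>R (indicator I t *\<^sub>R k t))"
      unfolding set_lebesgue_integral_def[of _ "{..<s}"] using locfin_sets[OF L] by (intro integral_density_indicator) auto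
    also have "\<dots> = set_lebesgue_integral L {\<alpha>..<s} k"
      unfolding set_lebesgue_integral_def using s tI
      by (intro Bochner_Integration.integral_cong) (auto split: split_indicator)
    finally show ?thesis .
  qed
  have dM: "integral\<^sup>L M' (\<lambda>t. indicator I t *\<^sub>R k t) = set_lebesgue_integral M {\<alpha>..<\<beta>} k"
      "integrable M' (\<lambda>t. indicator I t *\<^sub>R k t)" if "loc_int P M k" for k
  proof -
    have m: "(\<lambda>t. indicator I t *\<^sub>R k t) \<in> borel_measurable M"
      using loc_int_borel_on[OF that M] by (simp add: mM set_borel_measurable_def)
    show "integral\<^sup>L M' (\<lambda>t. indicator I t *\<^sub>R k t) = set_lebesgue_integral M {\<alpha>..<\<beta>} k"
      unfolding M'_def using locfin_sets[OF M] by (subst integral_density_indicator[OF m]) (auto intro!: cong simp: iI)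
    have "set_integrable M {\<alpha>..<\<beta>} (\<lambda>t. indicator I t *\<^sub>R k t)"
      by (subst cong(2)[of _ k]) (auto simp: iI intro!: loc_int_Ico that M ab)
    then show "integrable M' (\<lambda>t. indicator I t *\<^sub>R k t)"
      unfolding M'_def using locfin_sets[OF M] by (subst integral_density_indicator[OF m]) auto
  qed
  have dN: "integral\<^sup>L N' (\<lambda>t. indicator I t *\<^sub>R k t) = set_lebesgue_integral N {\<alpha>..<\<beta>} k"
      "integrable N' (\<lambda>t. indicator I t *\<^sub>R k t)" if "loc_int P N k" for k
  proof -
    have m: "(\<lambda>t. indicator I t *\<^sub>R k t) \<in> borel_measurable N"
      using loc_int_borel_on[OF that N] by (simp add: mN set_borel_measurable_def)
    show "integral\<^sup>L N' (\<lambda>t. indicator I t *\<^sub>R k t) = set_lebesgue_integral N {\<alpha>..<\<beta>} k"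
      unfolding N'_def using locfin_sets[OF N] by (subst integral_density_indicator[OF m]) (auto intro!: cong simp: iI)
    have "set_integrable N {\<alpha>..<\<beta>} (\<lambda>t. indicator I t *\<^sub>R k t)"
      by (subst cong(2)[of _ k]) (auto simp: iI intro!: loc_int_Ico that N ab)
    then show "integrable N' (\<lambda>t. indicator I t *\<^sub>R k t)"
      unfolding N'_def using locfin_sets[OF N] by (subst integral_density_indicator[OF m]) auto
  qed
  have Gp: "loc_int P M (\<lambda>t. G t * p t)" and Fq: "loc_int P N (\<lambda>t. F t * q t)"
    by (rule loc_int_mult_bounded[OF acd_borel_on[OF G N] acd_bounded[OF G N] p M]
      loc_int_mult_bounded[OF acd_borel_on[OF F M] acd_bounded[OF F M] q N]; assumption)+
  have aeM: "AE t in M'. t \<in> {\<alpha>..<\<beta>}" and aeN: "AE t in N'. t \<in> {\<alpha>..<\<beta>}"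
    unfolding M'_def N'_def using locfin_sets[OF M] locfin_sets[OF N]
    by (subst AE_density; simp add: indicator_def)+
  have fin: "finite_measure M'" "finite_measure N'" "sets M' = sets borel" "sets N' = sets borel"
    using finite_density_Ico[OF M ab(1,2)] finite_density_Ico[OF N ab(1,2)] locfin_sets[OF M] locfin_sets[OF N]
    by (simp_all add: M'_def N'_def)
  have int: "integrable M' p'" "integrable N' q'"
    using dM(2)[OF p] dN(2)[OF q] by (simp_all add: p'_def[abs_def] q'_def[abs_def])
  have at': "measure M' {t} * measure N' {t} = 0" for t
    unfolding M'_def N'_def density_Ico_singleton[OF M] density_Ico_singleton[OF N] using at tI by simp
  have ip: "integral\<^sup>L M' p' = set_lebesgue_integral M {\<alpha>..<\<beta>} p" "integral\<^sup>L N' q' = set_lebesgue_integral N {\<alpha>..<\<beta>} q"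
    using dM(1)[OF p] dN(1)[OF q] by (simp_all add: p'_def[abs_def] q'_def[abs_def])
  note tri = product_integral_triangles(3,1,2)[OF fin int at']
  have "(\<integral>s. p' s * set_lebesgue_integral N' {..<s} q' \<partial>M') = (\<integral>s. indicator I s *\<^sub>R (G s * p s) - G \<alpha> * p' s \<partial>M')"
  proof (rule integral_cong_AE)
    show "(\<lambda>s. indicator I s *\<^sub>R (G s * p s) - G \<alpha> * p' s) \<in> borel_measurable M'"
      by (intro borel_measurable_diff borel_measurable_times borel_measurable_const
        borel_measurable_integrable[OF dM(2)[OF Gp]] borel_measurable_integrable[OF int(1)])
    show "AE s in M'. p' s * set_lebesgue_integral N' {..<s} q' = indicator I s *\<^sub>R (G s * p s) - G \<alpha> * p' s"
      using aeM
    proof eventually_elim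
      case (elim s)
      then have s: "\<alpha> \<le> s" "s < \<beta>" by auto
      show ?case
        using lt[OF s q N] acdD(2)[OF G ab(1) tI[OF s] s(1)] tI[OF s]
        by (simp add: N'_def q'_def[abs_def] p'_def algebra_simps)
    qed
  qed (use tri(2) in auto)
  also have "\<dots> = set_lebesgue_integral M {\<alpha>..<\<beta>} (\<lambda>t. G t * p t) - G \<alpha> * set_lebesgue_integral M {\<alpha>..<\<beta>} p"
    unfolding ip[symmetric] dM(1)[OF Gp, symmetric] integral_mult_right_zero[symmetric]
    by (intro Bochner_Integration.integral_diff dM(2)[OF Gp] integrable_mult_right int(1))
  finally have e1: "(\<integral>s. p' s * set_lebesgue_integral N' {..<s} q' \<partial>M') = set_lebesgue_integral M {\<alpha>..<\<beta>} (\<lambda>t. G t * p t) - G \<alpha> * set_lebesgue_integral M {\<alpha>..<\<beta>} p" .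
  have "(\<integral>s. q' s * set_lebesgue_integral M' {..<s} p' \<partial>N') = (\<integral>s. indicator I s *\<^sub>R (F s * q s) - F \<alpha> * q' s \<partial>N')"
  proof (rule integral_cong_AE)
    show "(\<lambda>s. indicator I s *\<^sub>R (F s * q s) - F \<alpha> * q' s) \<in> borel_measurable N'"
      by (intro borel_measurable_diff borel_measurable_times borel_measurable_const
        borel_measurable_integrable[OF dN(2)[OF Fq]] borel_measurable_integrable[OF int(2)])
    show "AE s in N'. q' s * set_lebesgue_integral M' {..<s} p' = indicator I s *\<^sub>R (F s * q s) - F \<alpha> * q' s"
      using aeN
    proof eventually_elim
      case (elim s)
      then have s: "\<alpha> \<le> s" "s < \<beta>" by auto
      show ?case
        using lt[OF s p M] acdD(2)[OF F ab(1) tI[OF s] s(1)] tI[OF s]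
        by (simp add: M'_def q'_def p'_def[abs_def] algebra_simps)
    qed
  qed (use tri(3) in auto)
  also have "\<dots> = set_lebesgue_integral N {\<alpha>..<\<beta>} (\<lambda>t. F t * q t) - F \<alpha> * set_lebesgue_integral N {\<alpha>..<\<beta>} q"
    unfolding ip[symmetric] dN(1)[OF Fq, symmetric] integral_mult_right_zero[symmetric]
    by (intro Bochner_Integration.integral_diff dN(2)[OF Fq] integrable_mult_right int(2))
  finally have e2: "(\<integral>s. q' s * set_lebesgue_integral M' {..<s} p' \<partial>N') = set_lebesgue_integral N {\<alpha>..<\<beta>} (\<lambda>t. F t * q t) - F \<alpha> * set_lebesgue_integral N {\<alpha>..<\<beta>} q" .
  define Ip where "Ip = set_lebesgue_integral M {\<alpha>..<\<beta>} p"
  define Iq where "Iq = set_lebesgue_integral N {\<alpha>..<\<beta>} q"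
  define X where "X = set_lebesgue_integral M {\<alpha>..<\<beta>} (\<lambda>t. G t * p t)"
  define Y where "Y = set_lebesgue_integral N {\<alpha>..<\<beta>} (\<lambda>t. F t * q t)"
  have "Ip * Iq = (X - G \<alpha> * Ip) + (Y - F \<alpha> * Iq)"
    using tri(1)[unfolded e1 e2 ip] by (simp only: Ip_def Iq_def X_def Y_def)
  moreover have "F \<beta> = F \<alpha> + Ip" "G \<beta> = G \<alpha> + Iq"
    unfolding Ip_def Iq_def by (rule acdD(2)[OF F ab] acdD(2)[OF G ab])+
  ultimately have "F \<beta> * G \<beta> - F \<alpha> * G \<alpha> = X + Y" by (simp add: algebra_simps)
  then show ?thesis by (simp only: X_def Y_def)
qed

text \<open>The setting only controls the atoms of the difference of \<open>rho_p\<close> and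
  \<open>rho_m\<close>. Mutual singularity rules out cancellation, as at most one of the two has an
  atom at t.\<close>

lemma no_common_atoms:
  assumes "t \<in> I"
  shows "measure (vsig P) {t} * measure (chim P) {t} = 0"
    "measure (vsig P) {t} * measure (rho_p P) {t} = 0"
    "measure (vsig P) {t} * measure (rho_m P) {t} = 0"
proof -
  have 1: "\<forall>x\<in>I. measure (vsig P) {x} * measure (chim P) {x} = 0"
    "\<forall>x\<in>I. measure (vsig P) {x} * (measure (rho_p P) {x} - measure (rho_m P) {x}) = 0"
    "\<exists>A\<in>sets borel. emeasure (rho_p P) (I \<inter> A) = 0 \<and> emeasure (rho_m P) (I - A) = 0"
    using setting unfolding sl_setting_def by blast+
  show "measure (vsig P) {t} * measure (chim P) {t} = 0" using 1(1) assms by blast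
  obtain A where A: "A \<in> sets borel" "emeasure (rho_p P) (I \<inter> A) = 0" "emeasure (rho_m P) (I - A) = 0"
    using 1(3) by blast
  have "measure (rho_p P) {t} = 0 \<or> measure (rho_m P) {t} = 0"
  proof (cases "t \<in> A")
    case True
    have "emeasure (rho_p P) {t} \<le> emeasure (rho_p P) (I \<inter> A)"
      using A(1) True assms by (intro emeasure_mono) auto
    then show ?thesis using A(2) by (simp add: measure_def)
  next
    case False
    have "emeasure (rho_m P) {t} \<le> emeasure (rho_m P) (I - A)"
      using A(1) False assms by (intro emeasure_mono) auto
    then show ?thesis using A(3) by (simp add: measure_def)
  qed
  moreover have "measure (vsig P) {t} * (measure (rho_p P) {t} - measure (rho_m P) {t}) = 0"
    using 1(2) assms by blast
  ultimately show "measure (vsig P) {t} * measure (rho_p P) {t} = 0"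
    "measure (vsig P) {t} * measure (rho_m P) {t} = 0" by auto
qed

lemma acd_mint:
  assumes k: "loc_int P M k" and M: "locfin M" and c: "c \<in> I"
  shows "acd P M (\<lambda>x. mint M c x k) k"
proof (rule acdI[OF k])
  fix x y assume xy: "x \<in> I" "y \<in> I" "x < y"
  show "mint M c y k = mint M c x k + set_lebesgue_integral M {x..<y} k"
    using mint_trans[OF k M c xy(1,2)] xy(3) by (simp add: mint_le)
qed

text \<open>The quasi-derivative is not a primitive with respect to a single positive measure. It is
  split into its value at \<alpha> and primitives \<open>A\<close>, \<open>B\<close>,
  \<open>C\<close> for \<open>chim\<close>, \<open>rho_p\<close>, \<open>rho_m\<close>, and each is
  integrated by parts against F.\<close>

lemma acd_times_quasi_derivative:
  assumes F: "acd P (vsig P) F p" and g: "qd P g g1 tg" and ab: "\<alpha> \<in> I" "\<beta> \<in> I" "\<alpha> \<le> \<beta>"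
  shows "F \<beta> * g1 \<beta> - F \<alpha> * g1 \<alpha> = set_lebesgue_integral (vsig P) {\<alpha>..<\<beta>} (\<lambda>t. p t * g1 t)
    + set_lebesgue_integral (chim P) {\<alpha>..<\<beta>} (\<lambda>t. F t * g t)
    - set_lebesgue_integral (rho_p P) {\<alpha>..<\<beta>} (\<lambda>t. F t * tg t)
    + set_lebesgue_integral (rho_m P) {\<alpha>..<\<beta>} (\<lambda>t. F t * tg t)"
proof -
  note g' = qdD[OF g]
  define A where "A x = mint (chim P) \<alpha> x g" for x
  define B where "B x = mint (rho_p P) \<alpha> x tg" for x
  define C where "C x = mint (rho_m P) \<alpha> x tg" for x
  have a: "acd P (chim P) A g" "acd P (rho_p P) B tg" "acd P (rho_m P) C tg"
    unfolding A_def[abs_def] B_def[abs_def] C_def[abs_def] by (intro acd_mint g' ab locfin_measures)+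
  have z: "A \<alpha> = 0" "B \<alpha> = 0" "C \<alpha> = 0" by (auto simp: A_def B_def C_def mint_def)
  have g1: "g1 t = g1 \<alpha> + (A t - B t + C t)" if "t \<in> I" "\<alpha> \<le> t" for t
    using g'(6)[OF ab(1) that] that(2) by (simp add: A_def B_def C_def mint_le qd_increment_def)
  have li: "loc_int P (vsig P) (\<lambda>t. A t * p t)" "loc_int P (vsig P) (\<lambda>t. B t * p t)" "loc_int P (vsig P) (\<lambda>t. C t * p t)"
    by (intro loc_int_mult_bounded acdD[OF F] acd_borel_on[OF a(1)] acd_borel_on[OF a(2)] acd_borel_on[OF a(3)]
      acd_bounded[OF a(1)] acd_bounded[OF a(2)] acd_bounded[OF a(3)] locfin_measures; assumption)+
  note li' = loc_int_Ico[OF li(1) locfin_measures(1) ab(1,2)] loc_int_Ico[OF li(2) locfin_measures(1) ab(1,2)]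
    loc_int_Ico[OF li(3) locfin_measures(1) ab(1,2)] loc_int_Ico[OF acdD(1)[OF F] locfin_measures(1) ab(1,2)]
  have "set_lebesgue_integral (vsig P) {\<alpha>..<\<beta>} (\<lambda>t. p t * g1 t) =
     set_lebesgue_integral (vsig P) {\<alpha>..<\<beta>} (\<lambda>t. g1 \<alpha> * p t + (A t * p t - B t * p t + C t * p t))"
  proof (intro Ico_integral_cong ab)
    fix t assume t: "\<alpha> \<le> t" "t < \<beta>"
    have "t \<in> I" by (rule Ivl_between[OF ab(1,2)]) (use t in simp_all)
    from g1[OF this t(1)] have e: "g1 t = g1 \<alpha> + (A t - B t + C t)" .
    show "p t * g1 t = g1 \<alpha> * p t + (A t * p t - B t * p t + C t * p t)"
      unfolding e by (simp add: algebra_simps)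
  qed
  also have "\<dots> = g1 \<alpha> * set_lebesgue_integral (vsig P) {\<alpha>..<\<beta>} p +
     (set_lebesgue_integral (vsig P) {\<alpha>..<\<beta>} (\<lambda>t. A t * p t) - set_lebesgue_integral (vsig P) {\<alpha>..<\<beta>} (\<lambda>t. B t * p t)
     + set_lebesgue_integral (vsig P) {\<alpha>..<\<beta>} (\<lambda>t. C t * p t))"
    using li' by (simp add: set_integral_add set_integral_diff)
  finally have e: "set_lebesgue_integral (vsig P) {\<alpha>..<\<beta>} (\<lambda>t. p t * g1 t) = \<dots>" .
  have i: "F \<beta> * A \<beta> = set_lebesgue_integral (vsig P) {\<alpha>..<\<beta>} (\<lambda>t. A t * p t) + set_lebesgue_integral (chim P) {\<alpha>..<\<beta>} (\<lambda>t. F t * g t)"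
    "F \<beta> * B \<beta> = set_lebesgue_integral (vsig P) {\<alpha>..<\<beta>} (\<lambda>t. B t * p t) + set_lebesgue_integral (rho_p P) {\<alpha>..<\<beta>} (\<lambda>t. F t * tg t)"
    "F \<beta> * C \<beta> = set_lebesgue_integral (vsig P) {\<alpha>..<\<beta>} (\<lambda>t. C t * p t) + set_lebesgue_integral (rho_m P) {\<alpha>..<\<beta>} (\<lambda>t. F t * tg t)"
    using integration_by_parts[OF F a(1) _ _ no_common_atoms(1) ab] integration_by_parts[OF F a(2) _ _ no_common_atoms(2) ab]
      integration_by_parts[OF F a(3) _ _ no_common_atoms(3) ab] z by simp_all
  have "F \<beta> * g1 \<beta> - F \<alpha> * g1 \<alpha> = g1 \<alpha> * (F \<beta> - F \<alpha>) + (F \<beta> * A \<beta> - F \<beta> * B \<beta> + F \<beta> * C \<beta>)"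
    unfolding g1[OF ab(2,3)] by (simp add: algebra_simps)
  also have "F \<beta> - F \<alpha> = set_lebesgue_integral (vsig P) {\<alpha>..<\<beta>} p" using acdD(2)[OF F ab] by simp
  finally show ?thesis unfolding e i by simp
qed

text \<open>An element \<open>(f, f\<^sub>\<tau>)\<close> of the local relation comes with derivatives: \<open>f1\<close>, \<open>ft\<close>, \<open>ft1\<close> stand for
  \<open>f\<^sup>[\<^sup>1\<^sup>]\<close>, \<open>f\<^sub>\<tau>\<close> and \<open>df\<^sub>\<tau>/d\<varsigma>\<close>.\<close>

definition loc_pair where
  "loc_pair f f1 ft ft1 \<longleftrightarrow> qd P f f1 ft \<and> acd P (vsig P) ft ft1"

lemma loc_pairD: assumes "loc_pair f f1 ft ft1"
  shows "qd P f f1 ft" "acd P (vsig P) f f1" "acd P (vsig P) ft ft1"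
    "borel_on f" "borel_on f1" "borel_on ft" "borel_on ft1"
  using assms qdD[of f f1 ft] acd_borel_on[OF _ locfin_measures(1)] loc_int_borel_on[OF _ locfin_measures(1)] acdD(1)
  unfolding loc_pair_def by blast+

section \<open>The Lagrange identity\<close>

lemma lagrange_loc_int:
  assumes f: "loc_pair f f1 ft ft1" and g: "loc_pair g g1 gt gt1"
  shows "loc_int P (chim P) (\<lambda>t. ft t * g t)" "loc_int P (vsig P) (\<lambda>t. ft1 t * g1 t)"
proof -
  note f' = loc_pairD[OF f] and g' = loc_pairD[OF g]
  show "loc_int P (chim P) (\<lambda>t. ft t * g t)"
    by (intro loc_int_mult_bounded f' acd_bounded[OF f'(3)] qdD(3)[OF g'(1)] locfin_measures; assumption)
  have "loc_int P (vsig P) (\<lambda>t. g1 t * ft1 t)"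
    by (intro loc_int_mult_bounded g' qd_bounded[OF g'(1)] acdD(1)[OF f'(3)] locfin_measures; assumption)
  then show "loc_int P (vsig P) (\<lambda>t. ft1 t * g1 t)" by (simp add: mult.commute)
qed

text \<open>The modified Wronskian with the quasi-derivatives as arguments, which keeps the choice
  operator of \<open>qder\<close> out of the calculations.\<close>

definition wronsk :: "(real \<Rightarrow> complex) \<Rightarrow> (real \<Rightarrow> complex) \<Rightarrow> (real \<Rightarrow> complex) \<Rightarrow> (real \<Rightarrow> complex) \<Rightarrow> real \<Rightarrow> complex" where
  "wronsk f1 ft g1 gt x = ft x * g1 x - f1 x * gt x"

definition lagrange_chi :: "(real \<Rightarrow> complex) \<Rightarrow> (real \<Rightarrow> complex) \<Rightarrow> (real \<Rightarrow> complex) \<Rightarrow> (real \<Rightarrow> complex) \<Rightarrow> real \<Rightarrow> complex" where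
  "lagrange_chi f ft g gt t = ft t * g t - f t * gt t"

definition lagrange_sig :: "(real \<Rightarrow> complex) \<Rightarrow> (real \<Rightarrow> complex) \<Rightarrow> (real \<Rightarrow> complex) \<Rightarrow> (real \<Rightarrow> complex) \<Rightarrow> real \<Rightarrow> complex" where
  "lagrange_sig f1 ft1 g1 gt1 t = ft1 t * g1 t - f1 t * gt1 t"

lemma lagrange_integrands_loc_int:
  assumes f: "loc_pair f f1 ft ft1" and g: "loc_pair g g1 gt gt1"
  shows "loc_int P (chim P) (lagrange_chi f ft g gt)" "loc_int P (vsig P) (lagrange_sig f1 ft1 g1 gt1)"
  unfolding lagrange_chi_def[abs_def] lagrange_sig_def[abs_def]
  using lagrange_loc_int[OF f g] lagrange_loc_int[OF g f]
  by (auto intro!: loc_int_diff simp: mult.commute)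

text \<open>The increments of both products in the Wronskian contain the integral of
  \<open>ft\<close> times \<open>gt\<close> against rho. These terms cancel, and only integrals
  against \<open>chim\<close> and \<open>vsig\<close> remain.\<close>

lemma lagrange:
  assumes f: "loc_pair f f1 ft ft1" and g: "loc_pair g g1 gt gt1" and ab: "\<alpha> \<in> I" "\<beta> \<in> I" "\<alpha> \<le> \<beta>"
  shows "wronsk f1 ft g1 gt \<beta> - wronsk f1 ft g1 gt \<alpha> =
    set_lebesgue_integral (chim P) {\<alpha>..<\<beta>} (lagrange_chi f ft g gt) + set_lebesgue_integral (vsig P) {\<alpha>..<\<beta>} (lagrange_sig f1 ft1 g1 gt1)"
proof -
  note f' = loc_pairD[OF f] and g' = loc_pairD[OF g]
  note e = acd_times_quasi_derivative[OF f'(3) g'(1) ab] acd_times_quasi_derivative[OF g'(3) f'(1) ab]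
  have "set_lebesgue_integral (chim P) {\<alpha>..<\<beta>} (lagrange_chi f ft g gt) =
    set_lebesgue_integral (chim P) {\<alpha>..<\<beta>} (\<lambda>t. ft t * g t) - set_lebesgue_integral (chim P) {\<alpha>..<\<beta>} (\<lambda>t. gt t * f t)"
    unfolding lagrange_chi_def[abs_def] mult.commute[of "f t" for t]
    using lagrange_loc_int[OF f g] lagrange_loc_int[OF g f] by (intro set_integral_diff loc_int_Ico ab) auto
  moreover have "set_lebesgue_integral (vsig P) {\<alpha>..<\<beta>} (lagrange_sig f1 ft1 g1 gt1) =
    set_lebesgue_integral (vsig P) {\<alpha>..<\<beta>} (\<lambda>t. ft1 t * g1 t) - set_lebesgue_integral (vsig P) {\<alpha>..<\<beta>} (\<lambda>t. gt1 t * f1 t)"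
    unfolding lagrange_sig_def[abs_def] mult.commute[of "f1 t" for t]
    using lagrange_loc_int[OF f g] lagrange_loc_int[OF g f] by (intro set_integral_diff loc_int_Ico ab) auto
  moreover have "wronsk f1 ft g1 gt \<beta> - wronsk f1 ft g1 gt \<alpha> = (ft \<beta> * g1 \<beta> - ft \<alpha> * g1 \<alpha>) - (gt \<beta> * f1 \<beta> - gt \<alpha> * f1 \<alpha>)"
    by (simp add: wronsk_def)
  ultimately show ?thesis unfolding e mult.commute[of "gt t" "ft t" for t] by simp
qed

text \<open>Endpoints are encoded by Booleans: \<open>True\<close> is the left endpoint, \<open>False\<close> the right one.\<close>

definition tail :: "bool \<Rightarrow> real \<Rightarrow> real set" where
  "tail e c = {y \<in> I. if e then y < c else c < y}"

definition end_filter :: "bool \<Rightarrow> real filter" where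
  "end_filter e = (if e then filtercomap ereal (at_right (lend P)) else filtercomap ereal (at_left (rend P)))"

lemma tail_sub: "tail e c \<subseteq> I" by (auto simp: tail_def)

lemma tail_borel [simp, measurable]: "tail e c \<in> sets borel"
proof -
  have "tail e c = I \<inter> (if e then {..<c} else {c<..})" by (auto simp: tail_def)
  then show ?thesis by auto
qed

lemma tail_between: "x \<in> tail e c \<Longrightarrow> y \<in> tail e c \<Longrightarrow> x \<le> t \<Longrightarrow> t \<le> y \<Longrightarrow> t \<in> tail e c"
  unfolding tail_def mem_Collect_eq by (meson Ivl_between le_less_trans less_le_trans)

lemma tail_ne: "c \<in> I \<Longrightarrow> \<exists>x. x \<in> tail e c"
  by (cases e; rule Ivl_less[where x=c]; rule Ivl_greater[where x=c]) (auto simp: tail_def)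

lemma tail_inter: "c \<in> I \<Longrightarrow> d \<in> I \<Longrightarrow> \<exists>k\<in>I. tail e k \<subseteq> tail e c \<and> tail e k \<subseteq> tail e d"
proof -
  assume cd: "c \<in> I" "d \<in> I"
  define k where "k = (if e then min c d else max c d)"
  have "k \<in> I" using cd by (auto simp: k_def min_def max_def)
  moreover have "tail e k \<subseteq> tail e c \<and> tail e k \<subseteq> tail e d" by (auto simp: tail_def k_def)
  ultimately show ?thesis by blast
qed

text \<open>Tails of (a,b) form a basis of the endpoint filter, so that finite and infinite
  endpoints need no separate treatment from here on.\<close>

lemma eventually_end_filter: "eventually Q (end_filter e) \<longleftrightarrow> (\<exists>d\<in>I. \<forall>x\<in>tail e d. Q x)"
proof (cases e)
  case True
  show ?thesis
  proof
    assume "eventually Q (end_filter e)"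
    then obtain R where R: "eventually R (at_right (lend P))" "\<And>x. R (ereal x) \<Longrightarrow> Q x"
      using True by (auto simp: end_filter_def eventually_filtercomap)
    obtain b where b: "lend P < b" "\<And>y. lend P < y \<Longrightarrow> y < b \<Longrightarrow> R y"
      using R(1) unfolding eventually_at_right[OF lend_less_rend] by blast
    obtain d where d: "lend P < ereal d" "ereal d < min b (rend P)"
      using ereal_dense2[of "lend P" "min b (rend P)"] b(1) lend_less_rend by auto
    show "\<exists>d\<in>I. \<forall>x\<in>tail e d. Q x"
    proof (intro bexI ballI R(2) b(2))
      show "d \<in> I" using d by (auto simp: Ivl_def)
      fix x assume x: "x \<in> tail e d"
      then show "lend P < ereal x" by (auto simp: tail_def Ivl_def)
      have "ereal x < ereal d" using x True by (auto simp: tail_def)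
      also have "\<dots> < b" using d by simp
      finally show "ereal x < b" .
    qed
  next
    assume "\<exists>d\<in>I. \<forall>x\<in>tail e d. Q x"
    then obtain d where d: "d \<in> I" "\<forall>x\<in>tail e d. Q x" by blast
    have "eventually (\<lambda>y. y < ereal d \<and> lend P < y) (at_right (lend P))"
      unfolding eventually_at_right[OF lend_less_rend] using d(1) by (intro exI[of _ "ereal d"]) (auto simp: Ivl_def)
    then have "eventually (\<lambda>x. ereal x < ereal d \<and> lend P < ereal x) (end_filter e)"
      unfolding end_filter_def if_P[OF True] eventually_filtercomap by (intro exI conjI) auto
    then show "eventually Q (end_filter e)"
    proof eventually_elim
      case (elim x)
      then have "x \<in> I" using d(1) by (auto simp: Ivl_def) (metis less_ereal.simps(1) less_trans)
      then show ?case using elim d(2) True by (auto simp: tail_def)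
    qed
  qed
next
  case False
  show ?thesis
  proof
    assume "eventually Q (end_filter e)"
    then obtain R where R: "eventually R (at_left (rend P))" "\<And>x. R (ereal x) \<Longrightarrow> Q x"
      using False by (auto simp: end_filter_def eventually_filtercomap)
    obtain b where b: "b < rend P" "\<And>y. b < y \<Longrightarrow> y < rend P \<Longrightarrow> R y"
      using R(1) unfolding eventually_at_left[OF lend_less_rend] by blast
    obtain d where d: "max b (lend P) < ereal d" "ereal d < rend P"
      using ereal_dense2[of "max b (lend P)" "rend P"] b(1) lend_less_rend by auto
    show "\<exists>d\<in>I. \<forall>x\<in>tail e d. Q x"
    proof (intro bexI ballI R(2) b(2))
      show "d \<in> I" using d by (auto simp: Ivl_def)
      fix x assume x: "x \<in> tail e d"
      then show "ereal x < rend P" by (auto simp: tail_def Ivl_def)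
      have "b < ereal d" using d by simp
      also have "\<dots> < ereal x" using x False by (auto simp: tail_def)
      finally show "b < ereal x" .
    qed
  next
    assume "\<exists>d\<in>I. \<forall>x\<in>tail e d. Q x"
    then obtain d where d: "d \<in> I" "\<forall>x\<in>tail e d. Q x" by blast
    have "eventually (\<lambda>y. ereal d < y \<and> y < rend P) (at_left (rend P))"
      unfolding eventually_at_left[OF lend_less_rend] using d(1) by (intro exI[of _ "ereal d"]) (auto simp: Ivl_def)
    then have "eventually (\<lambda>x. ereal d < ereal x \<and> ereal x < rend P) (end_filter e)"
      unfolding end_filter_def if_not_P[OF False] eventually_filtercomap by (intro exI conjI) auto
    then show "eventually Q (end_filter e)"
    proof eventually_elim
      case (elim x)
      then have "x \<in> I" using d(1) by (auto simp: Ivl_def) (metis less_ereal.simps(1) less_trans)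
      then show ?case using elim d(2) False by (auto simp: tail_def)
    qed
  qed
qed

lemma end_filter_ne_bot: "end_filter e \<noteq> bot"
  using tail_ne by (auto simp: trivial_limit_def eventually_end_filter)

lemma end_filter_Ivl: "eventually (\<lambda>x. x \<in> I) (end_filter e)"
proof -
  obtain c where "c \<in> I" using Ivl_nonempty .
  then show ?thesis unfolding eventually_end_filter using tail_sub by blast
qed

section \<open>Limits of integrals and of Wronskians at the endpoints\<close>

lemma small_tail:
  fixes k :: "real \<Rightarrow> 'b::{banach, second_countable_topology}"
  assumes k: "set_integrable M (tail e c) k" and M: "locfin M" and c: "c \<in> I" and eps: "\<epsilon> > 0"
  obtains d where "d \<in> I" "tail e d \<subseteq> tail e c" "set_lebesgue_integral M (tail e d) (\<lambda>t. norm (k t)) < \<epsilon>"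
proof -
  obtain l u where lu: "\<And>n. l n \<in> I" "\<And>n. u n \<in> I"
    "\<And>x. x \<in> I \<Longrightarrow> eventually (\<lambda>n. l n < x \<and> x < u n) sequentially"
    using Ivl_exhaustion by metis
  define s where "s n = (if e then min c (l n) else max c (u n))" for n
  have s: "s n \<in> I" "tail e (s n) \<subseteq> tail e c" for n
    using c lu by (auto simp: s_def tail_def min_def max_def)
  have "(\<lambda>n. set_lebesgue_integral M (tail e (s n)) (\<lambda>t. norm (k t))) \<longlonglongrightarrow> 0"
  proof (rule set_integral_shrink)
    show "set_integrable M (tail e c) (\<lambda>t. norm (k t))" using k by (rule set_integrable_norm)
    fix x assume "x \<in> tail e c"
    then have "x \<in> I" using tail_sub by blast
    from lu(3)[OF this] show "\<forall>\<^sub>F n in sequentially. x \<notin> tail e (s n)"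
      by eventually_elim (auto simp: tail_def s_def)
  qed (use s locfin_sets[OF M] in auto)
  then have "eventually (\<lambda>n. set_lebesgue_integral M (tail e (s n)) (\<lambda>t. norm (k t)) < \<epsilon>) sequentially"
    using eps by (rule order_tendstoD)
  then obtain n where "set_lebesgue_integral M (tail e (s n)) (\<lambda>t. norm (k t)) < \<epsilon>"
    using eventually_happens'[OF sequentially_bot] by blast
  then show ?thesis using that s by blast
qed

lemma integral_tendsto_left:
  fixes k :: "real \<Rightarrow> complex"
  assumes k: "set_integrable M {y \<in> I. y < \<alpha>} k" and M: "locfin M" and \<alpha>: "\<alpha> \<in> I"
  shows "((\<lambda>x. set_lebesgue_integral M {x..<\<alpha>} k) \<longlongrightarrow> set_lebesgue_integral M {y \<in> I. y < \<alpha>} k) (end_filter True)"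
proof (rule tendstoI)
  fix \<epsilon> :: real assume "\<epsilon> > 0"
  have te: "{y \<in> I. y < \<alpha>} = tail True \<alpha>" by (auto simp: tail_def)
  obtain d where d: "d \<in> I" "tail True d \<subseteq> tail True \<alpha>" "set_lebesgue_integral M (tail True d) (\<lambda>t. norm (k t)) < \<epsilon>"
    using small_tail[OF k[unfolded te] M \<alpha> \<open>\<epsilon> > 0\<close>] .
  show "\<forall>\<^sub>F x in end_filter True. dist (set_lebesgue_integral M {x..<\<alpha>} k) (set_lebesgue_integral M {y \<in> I. y < \<alpha>} k) < \<epsilon>"
    unfolding eventually_end_filter
  proof (intro bexI[OF _ d(1)] ballI)
    fix x assume x: "x \<in> tail True d"
    have xI: "x \<in> I" "x < \<alpha>" "x < d" using x d(2) by (auto simp: tail_def)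
    have un: "tail True \<alpha> = {y \<in> I. y < x} \<union> {x..<\<alpha>}"
      using xI by (auto simp: tail_def intro: Ivl_between[OF xI(1) \<alpha>])
    have sb: "{y \<in> I. y < x} \<in> sets borel" using tail_borel[of True x] by (simp add: tail_def)
    note kk = k[unfolded te]
    have "set_lebesgue_integral M (tail True \<alpha>) k = set_lebesgue_integral M {y \<in> I. y < x} k + set_lebesgue_integral M {x..<\<alpha>} k"
      unfolding un by (rule set_integral_Un) (use un locfin_sets[OF M] sb in \<open>auto intro!: set_integrable_subset[OF kk]\<close>)
    moreover have "norm (set_lebesgue_integral M {y \<in> I. y < x} k) \<le> set_lebesgue_integral M (tail True d) (\<lambda>t. norm (k t))"
      by (rule set_integral_norm_le)
        (use xI locfin_sets[OF M] sb d(2) in \<open>auto intro!: set_integrable_norm set_integrable_subset[OF kk] simp: tail_def\<close>)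
    ultimately show "dist (set_lebesgue_integral M {x..<\<alpha>} k) (set_lebesgue_integral M {y \<in> I. y < \<alpha>} k) < \<epsilon>"
      using d(3) by (simp add: te dist_norm norm_minus_commute)
  qed
qed

text \<open>The point \<alpha> belongs to this side and not to the left one, because integrals run
  over half-open intervals and an atom at \<alpha> must be counted once.\<close>

lemma integral_tendsto_right:
  fixes k :: "real \<Rightarrow> complex"
  assumes k: "set_integrable M {y \<in> I. \<alpha> \<le> y} k" and M: "locfin M" and \<alpha>: "\<alpha> \<in> I"
  shows "((\<lambda>x. set_lebesgue_integral M {\<alpha>..<x} k) \<longlongrightarrow> set_lebesgue_integral M {y \<in> I. \<alpha> \<le> y} k) (end_filter False)"
proof (rule tendstoI)
  fix \<epsilon> :: real assume "\<epsilon> > 0"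
  have kk: "set_integrable M (tail False \<alpha>) k"
    by (rule set_integrable_subset[OF k]) (auto simp: tail_borel locfin_sets[OF M], auto simp: tail_def)
  obtain d where d: "d \<in> I" "tail False d \<subseteq> tail False \<alpha>" "set_lebesgue_integral M (tail False d) (\<lambda>t. norm (k t)) < \<epsilon>"
    using small_tail[OF kk M \<alpha> \<open>\<epsilon> > 0\<close>] .
  show "\<forall>\<^sub>F x in end_filter False. dist (set_lebesgue_integral M {\<alpha>..<x} k) (set_lebesgue_integral M {y \<in> I. \<alpha> \<le> y} k) < \<epsilon>"
    unfolding eventually_end_filter
  proof (intro bexI[OF _ d(1)] ballI)
    fix x assume x: "x \<in> tail False d"
    have xI: "x \<in> I" "\<alpha> < x" "d < x" using x d(2) by (auto simp: tail_def)
    have un: "{y \<in> I. \<alpha> \<le> y} = {\<alpha>..<x} \<union> {y \<in> I. x \<le> y}"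
      using xI by (auto intro: Ivl_between[OF \<alpha> xI(1)])
    have "{y \<in> I. x \<le> y} = I \<inter> {x..}" by auto
    then have sb: "{y \<in> I. x \<le> y} \<in> sets borel" by simp
    have "set_lebesgue_integral M {y \<in> I. \<alpha> \<le> y} k = set_lebesgue_integral M {\<alpha>..<x} k + set_lebesgue_integral M {y \<in> I. x \<le> y} k"
      unfolding un by (rule set_integral_Un) (use un locfin_sets[OF M] sb in \<open>auto intro!: set_integrable_subset[OF k]\<close>)
    moreover have "norm (set_lebesgue_integral M {y \<in> I. x \<le> y} k) \<le> set_lebesgue_integral M (tail False d) (\<lambda>t. norm (k t))"
      by (rule set_integral_norm_le)
        (use xI locfin_sets[OF M] sb d(2) in \<open>auto intro!: set_integrable_norm set_integrable_subset[OF kk] simp: tail_def\<close>)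
    ultimately show "dist (set_lebesgue_integral M {\<alpha>..<x} k) (set_lebesgue_integral M {y \<in> I. \<alpha> \<le> y} k) < \<epsilon>"
      using d(3) by (simp add: dist_norm norm_minus_commute)
  qed
qed

lemma wronsk_tendsto_left:
  assumes f: "loc_pair f f1 ft ft1" and g: "loc_pair g g1 gt gt1" and \<alpha>: "\<alpha> \<in> I"
    and i: "set_integrable (chim P) {y \<in> I. y < \<alpha>} (lagrange_chi f ft g gt)" "set_integrable (vsig P) {y \<in> I. y < \<alpha>} (lagrange_sig f1 ft1 g1 gt1)"
  shows "(wronsk f1 ft g1 gt \<longlongrightarrow> wronsk f1 ft g1 gt \<alpha> - (set_lebesgue_integral (chim P) {y \<in> I. y < \<alpha>} (lagrange_chi f ft g gt)
    + set_lebesgue_integral (vsig P) {y \<in> I. y < \<alpha>} (lagrange_sig f1 ft1 g1 gt1))) (end_filter True)"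
proof (rule Lim_transform_eventually)
  show "((\<lambda>x. wronsk f1 ft g1 gt \<alpha> - (set_lebesgue_integral (chim P) {x..<\<alpha>} (lagrange_chi f ft g gt)
    + set_lebesgue_integral (vsig P) {x..<\<alpha>} (lagrange_sig f1 ft1 g1 gt1))) \<longlongrightarrow> wronsk f1 ft g1 gt \<alpha> - (set_lebesgue_integral (chim P) {y \<in> I. y < \<alpha>} (lagrange_chi f ft g gt)
    + set_lebesgue_integral (vsig P) {y \<in> I. y < \<alpha>} (lagrange_sig f1 ft1 g1 gt1))) (end_filter True)"
    by (intro tendsto_intros integral_tendsto_left i \<alpha> locfin_measures)
  show "\<forall>\<^sub>F x in end_filter True. wronsk f1 ft g1 gt \<alpha> - (set_lebesgue_integral (chim P) {x..<\<alpha>} (lagrange_chi f ft g gt)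
    + set_lebesgue_integral (vsig P) {x..<\<alpha>} (lagrange_sig f1 ft1 g1 gt1)) = wronsk f1 ft g1 gt x"
    unfolding eventually_end_filter
  proof (intro bexI[OF _ \<alpha>] ballI)
    fix x assume "x \<in> tail True \<alpha>"
    then have "x \<in> I" "x \<le> \<alpha>" by (auto simp: tail_def)
    from lagrange[OF f g this(1) \<alpha> this(2)]
    show "wronsk f1 ft g1 gt \<alpha> - (set_lebesgue_integral (chim P) {x..<\<alpha>} (lagrange_chi f ft g gt)
      + set_lebesgue_integral (vsig P) {x..<\<alpha>} (lagrange_sig f1 ft1 g1 gt1)) = wronsk f1 ft g1 gt x" by (simp add: algebra_simps)
  qed
qed

lemma wronsk_tendsto_right:
  assumes f: "loc_pair f f1 ft ft1" and g: "loc_pair g g1 gt gt1" and \<alpha>: "\<alpha> \<in> I"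
    and i: "set_integrable (chim P) {y \<in> I. \<alpha> \<le> y} (lagrange_chi f ft g gt)" "set_integrable (vsig P) {y \<in> I. \<alpha> \<le> y} (lagrange_sig f1 ft1 g1 gt1)"
  shows "(wronsk f1 ft g1 gt \<longlongrightarrow> wronsk f1 ft g1 gt \<alpha> + (set_lebesgue_integral (chim P) {y \<in> I. \<alpha> \<le> y} (lagrange_chi f ft g gt)
    + set_lebesgue_integral (vsig P) {y \<in> I. \<alpha> \<le> y} (lagrange_sig f1 ft1 g1 gt1))) (end_filter False)"
proof (rule Lim_transform_eventually)
  show "((\<lambda>x. wronsk f1 ft g1 gt \<alpha> + (set_lebesgue_integral (chim P) {\<alpha>..<x} (lagrange_chi f ft g gt)
    + set_lebesgue_integral (vsig P) {\<alpha>..<x} (lagrange_sig f1 ft1 g1 gt1))) \<longlongrightarrow> wronsk f1 ft g1 gt \<alpha> + (set_lebesgue_integral (chim P) {y \<in> I. \<alpha> \<le> y} (lagrange_chi f ft g gt)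
    + set_lebesgue_integral (vsig P) {y \<in> I. \<alpha> \<le> y} (lagrange_sig f1 ft1 g1 gt1))) (end_filter False)"
    by (intro tendsto_intros integral_tendsto_right i \<alpha> locfin_measures)
  show "\<forall>\<^sub>F x in end_filter False. wronsk f1 ft g1 gt \<alpha> + (set_lebesgue_integral (chim P) {\<alpha>..<x} (lagrange_chi f ft g gt)
    + set_lebesgue_integral (vsig P) {\<alpha>..<x} (lagrange_sig f1 ft1 g1 gt1)) = wronsk f1 ft g1 gt x"
    unfolding eventually_end_filter
  proof (intro bexI[OF _ \<alpha>] ballI)
    fix x assume "x \<in> tail False \<alpha>"
    then have "x \<in> I" "\<alpha> \<le> x" by (auto simp: tail_def)
    from lagrange[OF f g \<alpha> this]
    show "wronsk f1 ft g1 gt \<alpha> + (set_lebesgue_integral (chim P) {\<alpha>..<x} (lagrange_chi f ft g gt)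
      + set_lebesgue_integral (vsig P) {\<alpha>..<x} (lagrange_sig f1 ft1 g1 gt1)) = wronsk f1 ft g1 gt x" by (simp add: algebra_simps)
  qed
qed

end

section \<open>Boundary behaviour of the Wronskian\<close>

context sturm_liouville
begin

section \<open>Square integrable functions\<close>

lemma sq_int_iff:
  assumes f: "borel_on f" and M: "locfin M" and A: "A \<in> sets borel" "A \<subseteq> I"
  shows "sq_int M A f \<longleftrightarrow> set_integrable M A (\<lambda>t. (cmod (f t))\<^sup>2)"
proof -
  have m: "(\<lambda>t. indicator A t *\<^sub>R (cmod (f t))\<^sup>2) \<in> borel_measurable M"
    using borel_on_sub[OF set_borel_measurable_mult[OF set_borel_measurable_norm set_borel_measurable_norm, OF f f] M A]
    by (simp add: set_borel_measurable_def power2_eq_square)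
  have "ennreal (norm (indicator A t *\<^sub>R (cmod (f t))\<^sup>2)) = indicator A t * ennreal ((cmod (f t))\<^sup>2)" for t
    by (auto split: split_indicator)
  then show ?thesis unfolding sq_int_def set_integrable_def integrable_iff_bounded using m by simp
qed

lemma sq_int_subset:
  assumes "sq_int M A f" "B \<subseteq> A" shows "sq_int M B f"
proof -
  have "(\<integral>\<^sup>+ y. indicator B y * ennreal ((cmod (f y))\<^sup>2) \<partial>M) \<le> (\<integral>\<^sup>+ y. indicator A y * ennreal ((cmod (f y))\<^sup>2) \<partial>M)"
    using assms(2) by (intro nn_integral_mono) (auto split: split_indicator)
  then show ?thesis using assms(1) unfolding sq_int_def by (rule le_less_trans)
qed

lemma sq_int_AE_cong:
  assumes "AE t in M. t \<in> I \<longrightarrow> f t = g t" "A \<subseteq> I"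
  shows "sq_int M A f \<longleftrightarrow> sq_int M A g"
proof -
  have "(\<integral>\<^sup>+ y. indicator A y * ennreal ((cmod (f y))\<^sup>2) \<partial>M) = (\<integral>\<^sup>+ y. indicator A y * ennreal ((cmod (g y))\<^sup>2) \<partial>M)"
    using assms by (intro nn_integral_cong_AE) (auto split: split_indicator)
  then show ?thesis by (simp add: sq_int_def)
qed

lemma sq_int_bound:
  assumes f: "borel_on f" "sq_int M A f" and g: "borel_on g" "sq_int M A g" and u: "borel_on u"
    and M: "locfin M" and A: "A \<in> sets borel" "A \<subseteq> I"
    and le: "\<And>t. t \<in> A \<Longrightarrow> cmod (u t) \<le> K * (cmod (f t) + cmod (g t))"
  shows "sq_int M A u"
  unfolding sq_int_iff[OF u M A]
proof (rule set_integrable_bound)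
  show "set_integrable M A (\<lambda>t. 2 * K\<^sup>2 * ((cmod (f t))\<^sup>2 + (cmod (g t))\<^sup>2))"
    using f(2) g(2) unfolding sq_int_iff[OF f(1) M A] sq_int_iff[OF g(1) M A] by (intro set_integrable_mult_right set_integral_add)
  show "set_borel_measurable M A (\<lambda>t. (cmod (u t))\<^sup>2)"
    using borel_on_sub[OF set_borel_measurable_mult[OF set_borel_measurable_norm set_borel_measurable_norm, OF u u] M A]
    by (simp add: power2_eq_square)
  show "AE t in M. t \<in> A \<longrightarrow> norm ((cmod (u t))\<^sup>2) \<le> norm (2 * K\<^sup>2 * ((cmod (f t))\<^sup>2 + (cmod (g t))\<^sup>2))"
  proof (rule AE_I2, intro impI)
    fix t assume "t \<in> A"
    then have "(cmod (u t))\<^sup>2 \<le> (K * (cmod (f t) + cmod (g t)))\<^sup>2" by (intro power_mono le) auto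
    also have "\<dots> = K\<^sup>2 * (cmod (f t) + cmod (g t))\<^sup>2" by (rule power_mult_distrib)
    also have "\<dots> \<le> K\<^sup>2 * (2 * ((cmod (f t))\<^sup>2 + (cmod (g t))\<^sup>2))"
      by (intro mult_left_mono) (use sum_squares_bound[of "cmod (f t)" "cmod (g t)"] in \<open>auto simp: power2_eq_square algebra_simps\<close>)
    finally show "norm ((cmod (u t))\<^sup>2) \<le> norm (2 * K\<^sup>2 * ((cmod (f t))\<^sup>2 + (cmod (g t))\<^sup>2))" by (simp add: algebra_simps)
  qed
qed

lemma sq_int_add:
  assumes f: "borel_on f" "sq_int M A f" and g: "borel_on g" "sq_int M A g"
    and M: "locfin M" and A: "A \<in> sets borel" "A \<subseteq> I"
  shows "sq_int M A (\<lambda>t. f t + g t)"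
  by (rule sq_int_bound[OF f g set_borel_measurable_add[OF f(1) g(1)] M A, where K=1]) (simp add: norm_triangle_ineq)

lemma sq_int_cmult:
  assumes f: "borel_on f" "sq_int M A f"
    and M: "locfin M" and A: "A \<in> sets borel" "A \<subseteq> I"
  shows "sq_int M A (\<lambda>t. a * f t)"
  by (rule sq_int_bound[OF f f set_borel_measurable_cmult[OF f(1)] M A, where K="cmod a"]) (simp add: norm_mult)

lemma sq_int_cnj: "sq_int M A (\<lambda>t. cnj (f t)) \<longleftrightarrow> sq_int M A f"
  by (simp add: sq_int_def)

lemma sq_int_mult:
  assumes f: "borel_on f" "sq_int M A f" and g: "borel_on g" "sq_int M A g"
    and M: "locfin M" and A: "A \<in> sets borel" "A \<subseteq> I"
  shows "set_integrable M A (\<lambda>t. f t * g t)"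
proof (rule set_integrable_bound)
  show "set_integrable M A (\<lambda>t. (cmod (f t))\<^sup>2 + (cmod (g t))\<^sup>2)"
    using f(2) g(2) unfolding sq_int_iff[OF f(1) M A] sq_int_iff[OF g(1) M A] by (intro set_integral_add)
  show "set_borel_measurable M A (\<lambda>t. f t * g t)"
    by (rule borel_on_sub[OF set_borel_measurable_mult[OF f(1) g(1)] M A])
  show "AE t in M. t \<in> A \<longrightarrow> norm (f t * g t) \<le> norm ((cmod (f t))\<^sup>2 + (cmod (g t))\<^sup>2)"
  proof (rule AE_I2, intro impI)
    fix t
    have "2 * (cmod (f t) * cmod (g t)) \<le> (cmod (f t))\<^sup>2 + (cmod (g t))\<^sup>2"
      using sum_squares_bound[of "cmod (f t)" "cmod (g t)"] by simp
    then have "cmod (f t) * cmod (g t) \<le> (cmod (f t))\<^sup>2 + (cmod (g t))\<^sup>2"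
      using mult_nonneg_nonneg[OF norm_ge_zero[of "f t"] norm_ge_zero[of "g t"]] by linarith
    then show "norm (f t * g t) \<le> norm ((cmod (f t))\<^sup>2 + (cmod (g t))\<^sup>2)" by (simp add: norm_mult)
  qed
qed

text \<open>Supplies one integrable weight that dominates every product of two of the four
  functions, as needed in \<open>solutions_near_if_wronsk_limit_nonzero\<close>.\<close>

lemma sq_int_sum4:
  assumes m: "borel_on a" "borel_on b" "borel_on c" "borel_on d" and s: "sq_int M A a" "sq_int M A b" "sq_int M A c" "sq_int M A d"
    and M: "locfin M" and A: "A \<in> sets borel" "A \<subseteq> I"
  shows "set_integrable M A (\<lambda>t. (cmod (a t) + cmod (b t) + cmod (c t) + cmod (d t))\<^sup>2)"
proof (rule set_integrable_bound)
  show "set_integrable M A (\<lambda>t. 4 * ((cmod (a t))\<^sup>2 + (cmod (b t))\<^sup>2 + (cmod (c t))\<^sup>2 + (cmod (d t))\<^sup>2))"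
    using s unfolding sq_int_iff[OF m(1) M A] sq_int_iff[OF m(2) M A] sq_int_iff[OF m(3) M A] sq_int_iff[OF m(4) M A]
    by (intro set_integrable_mult_right set_integral_add)
  have "set_borel_measurable borel I (\<lambda>t. cmod (a t) + cmod (b t) + cmod (c t) + cmod (d t))"
    by (intro set_borel_measurable_add set_borel_measurable_norm m)
  then show "set_borel_measurable M A (\<lambda>t. (cmod (a t) + cmod (b t) + cmod (c t) + cmod (d t))\<^sup>2)"
    unfolding power2_eq_square by (intro borel_on_sub[OF set_borel_measurable_mult M A])
  have "(x + y + z + w)\<^sup>2 \<le> 4 * (x\<^sup>2 + y\<^sup>2 + z\<^sup>2 + w\<^sup>2)" for x y z w :: real
    using sum_squares_bound[of x y] sum_squares_bound[of x z] sum_squares_bound[of x w]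
      sum_squares_bound[of y z] sum_squares_bound[of y w] sum_squares_bound[of z w]
    by (simp add: power2_eq_square algebra_simps)
  then show "AE t in M. t \<in> A \<longrightarrow> norm ((cmod (a t) + cmod (b t) + cmod (c t) + cmod (d t))\<^sup>2)
      \<le> norm (4 * ((cmod (a t))\<^sup>2 + (cmod (b t))\<^sup>2 + (cmod (c t))\<^sup>2 + (cmod (d t))\<^sup>2))"
    by (intro AE_I2 impI) simp
qed

section \<open>Pairs in the maximal relation near an endpoint\<close>

definition near_pair where
  "near_pair e f f1 ft ft1 \<longleftrightarrow> loc_pair f f1 ft ft1 \<and> (\<exists>c\<in>I. sq_int (chim P) (tail e c) f \<and> sq_int (vsig P) (tail e c) f1
     \<and> sq_int (chim P) (tail e c) ft \<and> sq_int (vsig P) (tail e c) ft1)"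

lemma near_pair_loc_pair: "near_pair e f f1 ft ft1 \<Longrightarrow> loc_pair f f1 ft ft1" by (simp add: near_pair_def)

lemma near_pair_common:
  assumes "near_pair e f f1 ft ft1" "near_pair e g g1 gt gt1"
  obtains c where "c \<in> I" "sq_int (chim P) (tail e c) f" "sq_int (vsig P) (tail e c) f1"
     "sq_int (chim P) (tail e c) ft" "sq_int (vsig P) (tail e c) ft1"
     "sq_int (chim P) (tail e c) g" "sq_int (vsig P) (tail e c) g1"
     "sq_int (chim P) (tail e c) gt" "sq_int (vsig P) (tail e c) gt1"
proof -
  obtain c where c: "c \<in> I" "sq_int (chim P) (tail e c) f" "sq_int (vsig P) (tail e c) f1"
     "sq_int (chim P) (tail e c) ft" "sq_int (vsig P) (tail e c) ft1" using assms(1) unfolding near_pair_def by blast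
  obtain d where d: "d \<in> I" "sq_int (chim P) (tail e d) g" "sq_int (vsig P) (tail e d) g1"
     "sq_int (chim P) (tail e d) gt" "sq_int (vsig P) (tail e d) gt1" using assms(2) unfolding near_pair_def by blast
  obtain k where k: "k \<in> I" "tail e k \<subseteq> tail e c" "tail e k \<subseteq> tail e d" using tail_inter[OF c(1) d(1)] by blast
  show thesis by (rule that[OF k(1)]) (rule c(2-5)[THEN sq_int_subset, OF k(2)] d(2-5)[THEN sq_int_subset, OF k(3)])+
qed

lemma lagrange_integrands_near:
  assumes F: "near_pair e f f1 ft ft1" and G: "near_pair e g g1 gt gt1"
  obtains c where "c \<in> I" "set_integrable (chim P) (tail e c) (lagrange_chi f ft g gt)" "set_integrable (vsig P) (tail e c) (lagrange_sig f1 ft1 g1 gt1)"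
proof -
  note f = loc_pairD[OF near_pair_loc_pair[OF F]] and g = loc_pairD[OF near_pair_loc_pair[OF G]]
  obtain c where c: "c \<in> I" "sq_int (chim P) (tail e c) f" "sq_int (vsig P) (tail e c) f1"
     "sq_int (chim P) (tail e c) ft" "sq_int (vsig P) (tail e c) ft1"
     "sq_int (chim P) (tail e c) g" "sq_int (vsig P) (tail e c) g1"
     "sq_int (chim P) (tail e c) gt" "sq_int (vsig P) (tail e c) gt1"
    using near_pair_common[OF F G] by blast
  show thesis
    by (rule that[OF c(1)]; unfold lagrange_chi_def[abs_def] lagrange_sig_def[abs_def]; intro set_integral_diff sq_int_mult f g c locfin_measures tail_borel tail_sub)
qed

lemma set_integrable_left_extend:
  assumes k: "loc_int P M k" "set_integrable M (tail True c) k" and M: "locfin M" and c: "c \<in> I" "\<alpha> \<in> I"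
  shows "set_integrable M {y \<in> I. y < \<alpha>} k"
proof (rule set_integrable_subset)
  show "set_integrable M (tail True c \<union> {c..\<alpha>}) k"
    using k c locfin_sets[OF M] unfolding loc_int_def by (intro set_integrable_Un) auto
  show "{y \<in> I. y < \<alpha>} \<in> sets M" using tail_borel[of True \<alpha>] by (simp add: tail_def locfin_sets[OF M])
qed (auto simp: tail_def)

lemma set_integrable_right_extend:
  assumes k: "loc_int P M k" "set_integrable M (tail False c) k" and M: "locfin M" and c: "c \<in> I" "\<alpha> \<in> I"
  shows "set_integrable M {y \<in> I. \<alpha> \<le> y} k"
proof (rule set_integrable_subset)
  show "set_integrable M (tail False c \<union> {\<alpha>..c}) k"
    using k c locfin_sets[OF M] unfolding loc_int_def by (intro set_integrable_Un) auto
  have "{y \<in> I. \<alpha> \<le> y} = I \<inter> {\<alpha>..}" by auto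
  then show "{y \<in> I. \<alpha> \<le> y} \<in> sets M" by (simp add: locfin_sets[OF M])
qed (auto simp: tail_def)

lemma wronsk_near_left:
  assumes F: "near_pair True f f1 ft ft1" and G: "near_pair True g g1 gt gt1" and \<alpha>: "\<alpha> \<in> I"
  shows "(wronsk f1 ft g1 gt \<longlongrightarrow> wronsk f1 ft g1 gt \<alpha> - (set_lebesgue_integral (chim P) {y \<in> I. y < \<alpha>} (lagrange_chi f ft g gt)
    + set_lebesgue_integral (vsig P) {y \<in> I. y < \<alpha>} (lagrange_sig f1 ft1 g1 gt1))) (end_filter True)"
proof -
  note t = near_pair_loc_pair[OF F] near_pair_loc_pair[OF G]
  obtain c where "c \<in> I" "set_integrable (chim P) (tail True c) (lagrange_chi f ft g gt)" "set_integrable (vsig P) (tail True c) (lagrange_sig f1 ft1 g1 gt1)"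
    using lagrange_integrands_near[OF F G] .
  then show ?thesis using lagrange_integrands_loc_int[OF t] \<alpha> by (intro wronsk_tendsto_left[OF t] set_integrable_left_extend) auto
qed

lemma wronsk_near_right:
  assumes F: "near_pair False f f1 ft ft1" and G: "near_pair False g g1 gt gt1" and \<alpha>: "\<alpha> \<in> I"
  shows "(wronsk f1 ft g1 gt \<longlongrightarrow> wronsk f1 ft g1 gt \<alpha> + (set_lebesgue_integral (chim P) {y \<in> I. \<alpha> \<le> y} (lagrange_chi f ft g gt)
    + set_lebesgue_integral (vsig P) {y \<in> I. \<alpha> \<le> y} (lagrange_sig f1 ft1 g1 gt1))) (end_filter False)"
proof -
  note t = near_pair_loc_pair[OF F] near_pair_loc_pair[OF G]
  obtain c where "c \<in> I" "set_integrable (chim P) (tail False c) (lagrange_chi f ft g gt)" "set_integrable (vsig P) (tail False c) (lagrange_sig f1 ft1 g1 gt1)"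
    using lagrange_integrands_near[OF F G] .
  then show ?thesis using lagrange_integrands_loc_int[OF t] \<alpha> by (intro wronsk_tendsto_right[OF t] set_integrable_right_extend) auto
qed

lemma wronsk_limit:
  assumes "near_pair e f f1 ft ft1" "near_pair e g g1 gt gt1"
  shows "\<exists>L. (wronsk f1 ft g1 gt \<longlongrightarrow> L) (end_filter e)"
proof -
  obtain c where "c \<in> I" using Ivl_nonempty .
  then show ?thesis using wronsk_near_left[of f f1 ft ft1 g g1 gt gt1 c] wronsk_near_right[of f f1 ft ft1 g g1 gt gt1 c] assms
    by (cases e) auto
qed

text \<open>The bound depends on T and the weights but not on x and y, so a tail T of small weight
  controls all increments inside it, in either direction.\<close>

lemma wronsk_increment_bound:
  assumes f: "loc_pair f f1 ft ft1" and g: "loc_pair g g1 gt gt1" and T: "T \<in> sets borel"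
    and xy: "x \<in> I" "y \<in> I" and sub: "{min x y..max x y} \<subseteq> T"
    and k: "set_integrable (chim P) T \<kappa>" "set_integrable (vsig P) T \<kappa>'"
    and nn: "\<And>t. 0 \<le> \<kappa> t" "\<And>t. 0 \<le> \<kappa>' t"
    and b: "\<And>t. t \<in> {min x y..max x y} \<Longrightarrow> cmod (lagrange_chi f ft g gt t) \<le> \<kappa> t"
      "\<And>t. t \<in> {min x y..max x y} \<Longrightarrow> cmod (lagrange_sig f1 ft1 g1 gt1 t) \<le> \<kappa>' t"
  shows "cmod (wronsk f1 ft g1 gt y - wronsk f1 ft g1 gt x) \<le> set_lebesgue_integral (chim P) T \<kappa> + set_lebesgue_integral (vsig P) T \<kappa>'"
proof -
  have mm: "min x y \<in> I" "max x y \<in> I" "min x y \<le> max x y" using xy by (auto simp: min_def max_def)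
  have "cmod (wronsk f1 ft g1 gt y - wronsk f1 ft g1 gt x) = cmod (wronsk f1 ft g1 gt (max x y) - wronsk f1 ft g1 gt (min x y))"
    by (cases "x \<le> y") (auto simp: max_def min_def norm_minus_commute)
  also have "\<dots> \<le> cmod (set_lebesgue_integral (chim P) {min x y..<max x y} (lagrange_chi f ft g gt))
      + cmod (set_lebesgue_integral (vsig P) {min x y..<max x y} (lagrange_sig f1 ft1 g1 gt1))"
    unfolding lagrange[OF f g mm] by (rule norm_triangle_ineq)
  also have "\<dots> \<le> set_lebesgue_integral (chim P) T \<kappa> + set_lebesgue_integral (vsig P) T \<kappa>'"
  proof (rule add_mono)
    have s: "{min x y..<max x y} \<subseteq> T"
      using sub by (meson atLeastLessThan_subseteq_atLeastAtMost_iff order_refl subset_trans)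
    show "cmod (set_lebesgue_integral (chim P) {min x y..<max x y} (lagrange_chi f ft g gt)) \<le> set_lebesgue_integral (chim P) T \<kappa>"
      by (rule set_integral_norm_le[OF k(1) _ s]) (use b(1) nn in auto)
    show "cmod (set_lebesgue_integral (vsig P) {min x y..<max x y} (lagrange_sig f1 ft1 g1 gt1)) \<le> set_lebesgue_integral (vsig P) T \<kappa>'"
      by (rule set_integral_norm_le[OF k(2) _ s]) (use b(2) nn in auto)
  qed
  finally show ?thesis .
qed

lemma wronsk_bounded:
  assumes "loc_pair f f1 ft ft1" "loc_pair g g1 gt gt1" "c \<in> I" "d \<in> I"
  shows "\<exists>B. \<forall>t\<in>{c..d}. cmod (wronsk f1 ft g1 gt t) \<le> B"
proof -
  note f = loc_pairD[OF assms(1)] and g = loc_pairD[OF assms(2)]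
  obtain B1 where B1: "\<forall>t\<in>{c..d}. cmod (f1 t) \<le> B1" using qd_bounded[OF f(1) assms(3,4)] by blast
  obtain B2 where B2: "\<forall>t\<in>{c..d}. cmod (ft t) \<le> B2" using acd_bounded[OF f(3) _ assms(3,4)] by auto
  obtain B3 where B3: "\<forall>t\<in>{c..d}. cmod (g1 t) \<le> B3" using qd_bounded[OF g(1) assms(3,4)] by blast
  obtain B4 where B4: "\<forall>t\<in>{c..d}. cmod (gt t) \<le> B4" using acd_bounded[OF g(3) _ assms(3,4)] by auto
  show ?thesis
  proof (intro exI ballI)
    fix t assume t: "t \<in> {c..d}"
    have "cmod (wronsk f1 ft g1 gt t) \<le> cmod (ft t) * cmod (g1 t) + cmod (f1 t) * cmod (gt t)"
      unfolding wronsk_def by (metis norm_triangle_ineq4 norm_mult)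
    also have "\<dots> \<le> B2 * B3 + B1 * B4"
      using B1 B2 B3 B4 t by (intro add_mono mult_mono) (auto intro: order_trans[OF norm_ge_zero])
    finally show "cmod (wronsk f1 ft g1 gt t) \<le> B2 * B3 + B1 * B4" .
  qed
qed

lemma loc_pair_sol:
  assumes "qd P u u1 (\<lambda>x. z * u x)" shows "loc_pair u u1 (\<lambda>x. z * u x) (\<lambda>x. z * u1 x)"
  unfolding loc_pair_def using assms qdD(1)[OF assms] acd_cmult by blast

text \<open>Expanding a solution in two such pairs, its coefficients are quotients of Wronskians, whose
  increments are integrals of the coefficients themselves against products of square integrable
  functions. On a tail where these products have small mass the coefficients are therefore bounded
  by twice their value at one point, and Gronwall's inequality is not needed.\<close>
lemma solutions_near_if_wronsk_limit_nonzero: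
  assumes F: "near_pair e f f1 ft ft1" and G: "near_pair e g g1 gt gt1"
    and L: "(wronsk f1 ft g1 gt \<longlongrightarrow> L) (end_filter e)" "L \<noteq> 0"
    and z: "z \<noteq> 0" and u: "qd P u u1 (\<lambda>x. z * u x)"
  shows "\<exists>c\<in>I. sq_int (chim P) (tail e c) u \<and> sq_int (vsig P) (tail e c) u1"
proof -
  note tf = near_pair_loc_pair[OF F] and tg = near_pair_loc_pair[OF G] and tu = loc_pair_sol[OF u]
  note f = loc_pairD[OF tf] and g = loc_pairD[OF tg] and u' = loc_pairD[OF tu]
  obtain c where c: "c \<in> I" "sq_int (chim P) (tail e c) f" "sq_int (vsig P) (tail e c) f1"
     "sq_int (chim P) (tail e c) ft" "sq_int (vsig P) (tail e c) ft1"
     "sq_int (chim P) (tail e c) g" "sq_int (vsig P) (tail e c) g1"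
     "sq_int (chim P) (tail e c) gt" "sq_int (vsig P) (tail e c) gt1"
    using near_pair_common[OF F G] by blast
  define m where "m = cmod L / 2"
  have m: "m > 0" "m < cmod L" using L(2) by (auto simp: m_def)
  have "\<forall>\<^sub>F x in end_filter e. m < cmod (wronsk f1 ft g1 gt x)"
    by (rule order_tendstoD(1)[OF tendsto_norm[OF L(1)] m(2)])
  then obtain d0 where d0: "d0 \<in> I" "\<And>x. x \<in> tail e d0 \<Longrightarrow> m < cmod (wronsk f1 ft g1 gt x)"
    unfolding eventually_end_filter by blast
  define Kc where "Kc t = (cmod (f t) + cmod (ft t) + cmod (g t) + cmod (gt t))\<^sup>2" for t
  define Ks where "Ks t = (cmod (f1 t) + cmod (ft1 t) + cmod (g1 t) + cmod (gt1 t))\<^sup>2" for t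
  have K0: "0 \<le> Kc t" "0 \<le> Ks t" for t by (auto simp: Kc_def Ks_def)
  have Ki: "set_integrable (chim P) (tail e c) Kc" "set_integrable (vsig P) (tail e c) Ks"
    unfolding Kc_def[abs_def] Ks_def[abs_def]
    by (intro sq_int_sum4 f g c locfin_measures tail_borel tail_sub)+
  \<comment> \<open>The factor 1/m comes from dividing by the Wronskian of f and g. The term 1/|z|
    pays for recovering u from z u, and |z| for the component z \<open>u1\<close> in the integrand
    for \<open>vsig\<close>.\<close>
  define C where "C = (1 / m) * (1 + 1 / cmod z + cmod z)"
  have C: "C > 0" unfolding C_def using m(1) z by (intro mult_pos_pos add_pos_nonneg) auto
  \<comment> \<open>With a mass of at most 1/(8C) for each of the two weights, the increments of
    \<open>WF\<close> and of \<open>WG\<close> are at most M/4 each, so A grows by at most M/2,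
    where M is its supremum.\<close>
  obtain dc where dc: "dc \<in> I" "tail e dc \<subseteq> tail e c" "set_lebesgue_integral (chim P) (tail e dc) (\<lambda>t. norm (Kc t)) < 1 / (8 * C)"
    using small_tail[OF Ki(1) locfin_measures(2) c(1), of "1 / (8 * C)"] C by auto
  obtain ds where ds: "ds \<in> I" "tail e ds \<subseteq> tail e c" "set_lebesgue_integral (vsig P) (tail e ds) (\<lambda>t. norm (Ks t)) < 1 / (8 * C)"
    using small_tail[OF Ki(2) locfin_measures(1) c(1), of "1 / (8 * C)"] C by auto
  obtain d1 where d1: "d1 \<in> I" "tail e d1 \<subseteq> tail e dc" "tail e d1 \<subseteq> tail e ds" using tail_inter[OF dc(1) ds(1)] by blast
  obtain d where d: "d \<in> I" "tail e d \<subseteq> tail e d1" "tail e d \<subseteq> tail e d0" using tail_inter[OF d1(1) d0(1)] by blast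
  let ?T = "tail e d"
  have Tc: "?T \<subseteq> tail e c" using d d1 dc by blast
  have KT: "set_integrable (chim P) ?T Kc" "set_integrable (vsig P) ?T Ks"
    using Ki Tc by (auto intro: set_integrable_subset)
  have small: "set_lebesgue_integral (chim P) ?T Kc \<le> 1 / (8 * C)" "set_lebesgue_integral (vsig P) ?T Ks \<le> 1 / (8 * C)"
  proof -
    have "norm (set_lebesgue_integral (chim P) ?T Kc) \<le> set_lebesgue_integral (chim P) (tail e dc) (\<lambda>t. norm (Kc t))"
      by (rule set_integral_norm_le[OF set_integrable_norm[OF set_integrable_subset[OF Ki(1) _ dc(2)]]])
        (use d d1 in auto)
    then show "set_lebesgue_integral (chim P) ?T Kc \<le> 1 / (8 * C)" using dc(3) by simp
    have "norm (set_lebesgue_integral (vsig P) ?T Ks) \<le> set_lebesgue_integral (vsig P) (tail e ds) (\<lambda>t. norm (Ks t))"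
      by (rule set_integral_norm_le[OF set_integrable_norm[OF set_integrable_subset[OF Ki(2) _ ds(2)]]])
        (use d d1 in auto)
    then show "set_lebesgue_integral (vsig P) ?T Ks \<le> 1 / (8 * C)" using ds(3) by simp
  qed
  \<comment> \<open>By Cramer's rule the vector (z u, \<open>u1\<close>) is a combination of
    (\<open>ft\<close>, \<open>f1\<close>) and (\<open>gt\<close>, \<open>g1\<close>); up to sign
    its coefficients are \<open>WG\<close> and \<open>WF\<close> divided by the Wronskian of f and
    g, which exceeds m in modulus on the tail.\<close>
  define WF where "WF = wronsk u1 (\<lambda>x. z * u x) f1 ft"
  define WG where "WG = wronsk u1 (\<lambda>x. z * u x) g1 gt"
  define A where "A t = cmod (WF t) + cmod (WG t)" for t
  have A0: "0 \<le> A t" for t by (simp add: A_def)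
  have pt: "cmod (z * u t) \<le> (1 / m) * A t * (cmod (ft t) + cmod (gt t))"
    "cmod (u1 t) \<le> (1 / m) * A t * (cmod (f1 t) + cmod (g1 t))" if t: "t \<in> ?T" for t
  proof -
    have W: "m < cmod (wronsk f1 ft g1 gt t)" using d0(2) d(3) t by blast
    have e: "wronsk f1 ft g1 gt t * (z * u t) = WG t * ft t - WF t * gt t"
      "wronsk f1 ft g1 gt t * u1 t = WG t * f1 t - WF t * g1 t"
      by (simp_all add: WF_def WG_def wronsk_def algebra_simps)
    have ab: "cmod (WG t * p - WF t * q) \<le> A t * (cmod p + cmod q)" for p q
    proof -
      have "cmod (WG t * p - WF t * q) \<le> cmod (WG t) * cmod p + cmod (WF t) * cmod q"
        by (metis norm_triangle_ineq4 norm_mult)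
      also have "\<dots> \<le> A t * cmod p + A t * cmod q"
        by (intro add_mono mult_right_mono) (auto simp: A_def)
      finally show ?thesis by (simp add: algebra_simps)
    qed
    have "m * cmod (z * u t) \<le> cmod (wronsk f1 ft g1 gt t * (z * u t))"
      unfolding norm_mult[of "wronsk f1 ft g1 gt t"] using W by (intro mult_right_mono) auto
    then have "m * cmod (z * u t) \<le> A t * (cmod (ft t) + cmod (gt t))" using ab[of "ft t" "gt t"] e(1) by simp
    then show "cmod (z * u t) \<le> (1 / m) * A t * (cmod (ft t) + cmod (gt t))"
      using m(1) by (simp add: field_simps)
    have "m * cmod (u1 t) \<le> cmod (wronsk f1 ft g1 gt t * u1 t)"
      unfolding norm_mult[of "wronsk f1 ft g1 gt t"] using W by (intro mult_right_mono) auto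
    then have "m * cmod (u1 t) \<le> A t * (cmod (f1 t) + cmod (g1 t))" using ab[of "f1 t" "g1 t"] e(2) by simp
    then show "cmod (u1 t) \<le> (1 / m) * A t * (cmod (f1 t) + cmod (g1 t))"
      using m(1) by (simp add: field_simps)
  qed
  have kb: "cmod (lagrange_chi u (\<lambda>x. z * u x) h ht t) \<le> C * A t * Kc t"
    if t: "t \<in> ?T" and h: "cmod (h t) + cmod (ht t) \<le> cmod (f t) + cmod (ft t) + cmod (g t) + cmod (gt t)" for t h ht
  proof -
    let ?S = "cmod (f t) + cmod (ft t) + cmod (g t) + cmod (gt t)"
    have zz: "cmod (u t) = cmod (z * u t) * (1 / cmod z)" using z by (simp add: norm_mult)
    have "cmod (lagrange_chi u (\<lambda>x. z * u x) h ht t) \<le> cmod (z * u t) * cmod (h t) + cmod (u t) * cmod (ht t)"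
      unfolding lagrange_chi_def by (metis norm_triangle_ineq4 norm_mult)
    also have "\<dots> = cmod (z * u t) * (cmod (h t) + (1 / cmod z) * cmod (ht t))"
      unfolding zz by (simp add: algebra_simps)
    also have "\<dots> \<le> ((1 / m) * A t * ?S) * ((1 + 1 / cmod z + cmod z) * ?S)"
    proof (rule mult_mono)
      have "(1 / m) * A t * (cmod (ft t) + cmod (gt t)) \<le> (1 / m) * A t * ?S"
        using m(1) A0 by (intro mult_left_mono) auto
      then show "cmod (z * u t) \<le> (1 / m) * A t * ?S" using pt(1)[OF t] by linarith
      have "cmod (h t) + (1 / cmod z) * cmod (ht t) \<le> (1 + 1 / cmod z + cmod z) * cmod (h t) + (1 + 1 / cmod z + cmod z) * cmod (ht t)"
      proof (rule add_mono)
        show "cmod (h t) \<le> (1 + 1 / cmod z + cmod z) * cmod (h t)"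
          by (rule mult_right_mono[of 1 _ "cmod (h t)", simplified]) auto
        show "1 / cmod z * cmod (ht t) \<le> (1 + 1 / cmod z + cmod z) * cmod (ht t)"
          by (rule mult_right_mono) auto
      qed
      also have "\<dots> = (1 + 1 / cmod z + cmod z) * (cmod (h t) + cmod (ht t))" by (simp only: distrib_left)
      also have "\<dots> \<le> (1 + 1 / cmod z + cmod z) * ?S" by (rule mult_left_mono[OF h]) auto
      finally show "cmod (h t) + (1 / cmod z) * cmod (ht t) \<le> (1 + 1 / cmod z + cmod z) * ?S" .
    qed (use m(1) A0 in auto)
    also have "\<dots> = C * A t * Kc t" by (simp only: C_def Kc_def power2_eq_square mult_ac)
    finally show ?thesis .
  qed
  have ksb: "cmod (lagrange_sig u1 (\<lambda>x. z * u1 x) h ht t) \<le> C * A t * Ks t"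
    if t: "t \<in> ?T" and h: "cmod (h t) + cmod (ht t) \<le> cmod (f1 t) + cmod (ft1 t) + cmod (g1 t) + cmod (gt1 t)" for t h ht
  proof -
    let ?S = "cmod (f1 t) + cmod (ft1 t) + cmod (g1 t) + cmod (gt1 t)"
    have "cmod (lagrange_sig u1 (\<lambda>x. z * u1 x) h ht t) \<le> cmod (z * u1 t) * cmod (h t) + cmod (u1 t) * cmod (ht t)"
      unfolding lagrange_sig_def by (metis norm_triangle_ineq4 norm_mult)
    also have "\<dots> = cmod (u1 t) * (cmod z * cmod (h t) + cmod (ht t))"
      by (simp add: algebra_simps norm_mult)
    also have "\<dots> \<le> ((1 / m) * A t * ?S) * ((1 + 1 / cmod z + cmod z) * ?S)"
    proof (rule mult_mono)
      have "(1 / m) * A t * (cmod (f1 t) + cmod (g1 t)) \<le> (1 / m) * A t * ?S"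
        using m(1) A0 by (intro mult_left_mono) auto
      then show "cmod (u1 t) \<le> (1 / m) * A t * ?S" using pt(2)[OF t] by linarith
      have "cmod z * cmod (h t) + cmod (ht t) \<le> (1 + 1 / cmod z + cmod z) * cmod (h t) + (1 + 1 / cmod z + cmod z) * cmod (ht t)"
      proof (rule add_mono)
        show "cmod (ht t) \<le> (1 + 1 / cmod z + cmod z) * cmod (ht t)"
          by (rule mult_right_mono[of 1 _ "cmod (ht t)", simplified]) auto
        show "cmod z * cmod (h t) \<le> (1 + 1 / cmod z + cmod z) * cmod (h t)"
          by (rule mult_right_mono) auto
      qed
      also have "\<dots> = (1 + 1 / cmod z + cmod z) * (cmod (h t) + cmod (ht t))" by (simp only: distrib_left)
      also have "\<dots> \<le> (1 + 1 / cmod z + cmod z) * ?S" by (rule mult_left_mono[OF h]) auto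
      finally show "cmod z * cmod (h t) + cmod (ht t) \<le> (1 + 1 / cmod z + cmod z) * ?S" .
    qed (use m(1) A0 in auto)
    also have "\<dots> = C * A t * Ks t" by (simp only: C_def Ks_def power2_eq_square mult_ac)
    finally show ?thesis .
  qed
  obtain x0 where x0: "x0 \<in> ?T" using tail_ne[OF d(1)] by blast
  have bound: "A x \<le> 2 * A x0" if x: "x \<in> ?T" for x
  proof -
    let ?J = "{min x x0..max x x0}"
    have xI: "x \<in> I" "x0 \<in> I" using x x0 tail_sub by blast+
    have JI: "min x x0 \<in> I" "max x x0 \<in> I" using xI by (auto simp: min_def max_def)
    have mT: "min x x0 \<in> ?T" "max x x0 \<in> ?T" using x x0 by (auto simp: min_def max_def)
    have JT: "?J \<subseteq> ?T"
    proof
      fix s assume "s \<in> ?J"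
      then show "s \<in> ?T" by (intro tail_between[OF mT]) auto
    qed
    obtain B1 where B1: "\<forall>t\<in>?J. cmod (WF t) \<le> B1" using wronsk_bounded[OF tu tf JI] unfolding WF_def by blast
    obtain B2 where B2: "\<forall>t\<in>?J. cmod (WG t) \<le> B2" using wronsk_bounded[OF tu tg JI] unfolding WG_def by blast
    have bdd: "bdd_above (A ` ?J)"
    proof (rule bdd_aboveI2)
      fix t assume "t \<in> ?J"
      then show "A t \<le> B1 + B2" using B1 B2 by (auto simp: A_def intro!: add_mono)
    qed
    \<comment> \<open>The supremum is taken over a compact interval, where A is bounded. So M is
      finite, and the inequality M \<le> A x0 + M/2 can be solved for M.\<close>
    define M where "M = (SUP t\<in>?J. A t)"
    have le: "A t \<le> M" if "t \<in> ?J" for t unfolding M_def by (rule cSUP_upper[OF that bdd])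
    have M0: "M \<ge> 0" using le[of x] A0[of x] by auto
    have inc: "cmod (wronsk u1 (\<lambda>x. z * u x) h1 ht t - wronsk u1 (\<lambda>x. z * u x) h1 ht x0) \<le> M / 4"
      if t: "t \<in> ?J" and H: "loc_pair h h1 ht ht1"
        and h: "\<And>t. cmod (h t) + cmod (ht t) \<le> cmod (f t) + cmod (ft t) + cmod (g t) + cmod (gt t)"
         "\<And>t. cmod (h1 t) + cmod (ht1 t) \<le> cmod (f1 t) + cmod (ft1 t) + cmod (g1 t) + cmod (gt1 t)" for t h h1 ht ht1
    proof -
      have tI: "t \<in> I" using t JT tail_sub by blast
      have sJ: "{min x0 t..max x0 t} \<subseteq> ?J" using t by auto
      have "cmod (wronsk u1 (\<lambda>x. z * u x) h1 ht t - wronsk u1 (\<lambda>x. z * u x) h1 ht x0) \<le>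
          set_lebesgue_integral (chim P) ?T (\<lambda>t. C * M * Kc t) + set_lebesgue_integral (vsig P) ?T (\<lambda>t. C * M * Ks t)"
      proof (rule wronsk_increment_bound[OF tu H tail_borel xI(2) tI])
        show "{min x0 t..max x0 t} \<subseteq> ?T" using sJ JT by blast
        show "set_integrable (chim P) ?T (\<lambda>t. C * M * Kc t)" "set_integrable (vsig P) ?T (\<lambda>t. C * M * Ks t)"
          using KT by (intro set_integrable_mult_right; simp)+
        show "0 \<le> C * M * Kc t" "0 \<le> C * M * Ks t" for t using C M0 K0 by auto
        fix s assume "s \<in> {min x0 t..max x0 t}"
        then have s: "s \<in> ?J" "s \<in> ?T" using sJ JT by blast+
        have "C * A s * Kc s \<le> C * M * Kc s" "C * A s * Ks s \<le> C * M * Ks s"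
          using le[OF s(1)] C K0 by (intro mult_right_mono mult_left_mono; simp)+
        then show "cmod (lagrange_chi u (\<lambda>x. z * u x) h ht s) \<le> C * M * Kc s" "cmod (lagrange_sig u1 (\<lambda>x. z * u1 x) h1 ht1 s) \<le> C * M * Ks s"
          using kb[of s h ht, OF s(2) h(1)[of s]] ksb[of s h1 ht1, OF s(2) h(2)[of s]] by linarith+
      qed
      also have "\<dots> = C * M * set_lebesgue_integral (chim P) ?T Kc + C * M * set_lebesgue_integral (vsig P) ?T Ks" by simp
      also have "\<dots> \<le> C * M * (1 / (8 * C)) + C * M * (1 / (8 * C))"
        using small C M0 by (intro add_mono mult_left_mono) auto
      also have "\<dots> = M / 4" using C by (simp add: field_simps)
      finally show ?thesis .
    qed
    have "A t \<le> A x0 + M / 2" if t: "t \<in> ?J" for t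
    proof -
      have "cmod (WF t - WF x0) \<le> M / 4" unfolding WF_def by (rule inc[OF t tf]) auto
      moreover have "cmod (WG t - WG x0) \<le> M / 4" unfolding WG_def by (rule inc[OF t tg]) auto
      ultimately show ?thesis
        using norm_triangle_sub[of "WF t" "WF x0"] norm_triangle_sub[of "WG t" "WG x0"] by (simp add: A_def)
    qed
    then have "M \<le> A x0 + M / 2" unfolding M_def[symmetric] by (subst M_def) (rule cSUP_least, auto)
    moreover have "A x \<le> M" by (rule le) auto
    ultimately show ?thesis by linarith
  qed
  have "sq_int (chim P) ?T u"
  proof (rule sq_int_bound[OF f(6) sq_int_subset[OF c(4) Tc] g(6) sq_int_subset[OF c(8) Tc] u'(4) locfin_measures(2) tail_borel tail_sub])
    fix t assume t: "t \<in> ?T"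
    have "cmod (u t) = cmod (z * u t) / cmod z" using z by (simp add: norm_mult)
    also have "\<dots> \<le> ((1 / m) * A t * (cmod (ft t) + cmod (gt t))) / cmod z"
      by (rule divide_right_mono[OF pt(1)[OF t]]) simp
    also have "\<dots> \<le> ((1 / m) * (2 * A x0) * (cmod (ft t) + cmod (gt t))) / cmod z"
      using bound[OF t] m(1) by (intro divide_right_mono mult_right_mono mult_left_mono) auto
    also have "\<dots> = ((1 / m) * (2 * A x0) / cmod z) * (cmod (ft t) + cmod (gt t))" by simp
    finally show "cmod (u t) \<le> ((1 / m) * (2 * A x0) / cmod z) * (cmod (ft t) + cmod (gt t))" .
  qed
  moreover have "sq_int (vsig P) ?T u1"
  proof (rule sq_int_bound[OF f(5) sq_int_subset[OF c(3) Tc] g(5) sq_int_subset[OF c(7) Tc] u'(5) locfin_measures(1) tail_borel tail_sub])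
    fix t assume t: "t \<in> ?T"
    have "cmod (u1 t) \<le> (1 / m) * A t * (cmod (f1 t) + cmod (g1 t))" by (rule pt(2)[OF t])
    also have "\<dots> \<le> (1 / m) * (2 * A x0) * (cmod (f1 t) + cmod (g1 t))"
      using bound[OF t] m(1) by (intro mult_right_mono mult_left_mono) auto
    finally show "cmod (u1 t) \<le> (1 / m) * (2 * A x0) * (cmod (f1 t) + cmod (g1 t))" .
  qed
  ultimately show ?thesis using d(1) by blast
qed

text \<open>Two-component vectors satisfy W(f,g) W(h,v) = W(f,h) W(g,v) - W(f,v) W(g,h). The right
  side tends to 0 since W(f,h) and W(g,h) converge, and h is there to divide by a nonzero
  limit.\<close>

lemma wronsk_limit_pluecker:
  assumes "near_pair e f f1 ft ft1" "near_pair e g g1 gt gt1" "near_pair e h h1 ht ht1"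
    and fv: "(wronsk f1 ft v1 vt \<longlongrightarrow> 0) (end_filter e)" and gv: "(wronsk g1 gt v1 vt \<longlongrightarrow> 0) (end_filter e)"
    and hv: "(wronsk h1 ht v1 vt \<longlongrightarrow> l) (end_filter e)" "l \<noteq> 0"
  shows "(wronsk f1 ft g1 gt \<longlongrightarrow> 0) (end_filter e)"
proof -
  obtain L1 where L1: "(wronsk f1 ft g1 gt \<longlongrightarrow> L1) (end_filter e)" using wronsk_limit assms(1,2) by blast
  obtain L2 where L2: "(wronsk f1 ft h1 ht \<longlongrightarrow> L2) (end_filter e)" using wronsk_limit assms(1,3) by blast
  obtain L3 where L3: "(wronsk g1 gt h1 ht \<longlongrightarrow> L3) (end_filter e)" using wronsk_limit assms(2,3) by blast
  have "((\<lambda>x. wronsk f1 ft g1 gt x * wronsk h1 ht v1 vt x) \<longlongrightarrow> L1 * l) (end_filter e)"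
    by (intro tendsto_mult L1 hv)
  moreover have "(\<lambda>x. wronsk f1 ft g1 gt x * wronsk h1 ht v1 vt x) =
    (\<lambda>x. wronsk f1 ft h1 ht x * wronsk g1 gt v1 vt x - wronsk f1 ft v1 vt x * wronsk g1 gt h1 ht x)"
    by (rule ext) (simp add: wronsk_def algebra_simps)
  moreover have "((\<lambda>x. wronsk f1 ft h1 ht x * wronsk g1 gt v1 vt x - wronsk f1 ft v1 vt x * wronsk g1 gt h1 ht x) \<longlongrightarrow> L2 * 0 - 0 * L3) (end_filter e)"
    by (intro tendsto_intros L2 L3 fv gv)
  ultimately have "L1 * l = 0" using tendsto_unique[OF end_filter_ne_bot] by fastforce
  then show ?thesis using L1 hv(2) by simp
qed

text \<open>Let p be the supremum of the points up to which u and \<open>u1\<close> vanish.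
  Integrals over [c,p) determine the values at p, so both vanish there too. An atom at p then
  contributes nothing beyond p, and the remaining open interval (p,q) can be given so small a mass
  that the supremum of |u| + |\<open>u1\<close>| is at most half of itself.\<close>

lemma sol_zero_right:
  assumes u: "qd P u u1 (\<lambda>x. z * u x)" and c: "c \<in> I" "u c = 0" "u1 c = 0" and x: "x \<in> I" "c \<le> x"
  shows "u x = 0" "u1 x = 0"
proof -
  note U = qdD[OF u]
  define B where "B = {y. c \<le> y \<and> y \<le> x \<and> (\<forall>t. c \<le> t \<and> t \<le> y \<longrightarrow> u t = 0 \<and> u1 t = 0)}"
  have cB: "c \<in> B" using c x by (auto simp: B_def)
  have bdd: "bdd_above B" by (auto simp: B_def intro!: bdd_aboveI[of _ x])
  define p where "p = Sup B"
  have cp: "c \<le> p" unfolding p_def by (rule cSup_upper[OF cB bdd])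
  have px: "p \<le> x" unfolding p_def by (rule cSup_least) (use cB in \<open>auto simp: B_def\<close>)
  have pI: "p \<in> I" by (rule Ivl_between[OF c(1) x(1) cp px])
  have zl: "u t = 0 \<and> u1 t = 0" if t: "c \<le> t" "t < p" for t
  proof -
    obtain y where "y \<in> B" "t < y" using less_cSupD[OF _ t(2)[unfolded p_def]] cB by blast
    then show ?thesis using t unfolding B_def by auto
  qed
  have zint: "set_lebesgue_integral M {s..<t} h = 0" if "\<And>r. s \<le> r \<Longrightarrow> r < t \<Longrightarrow> h r = 0" for M s t and h :: "real \<Rightarrow> complex"
  proof -
    have "(\<lambda>r. indicator {s..<t} r *\<^sub>R h r) = (\<lambda>r. 0)" using that by (auto split: split_indicator)
    then show ?thesis by (simp add: set_lebesgue_integral_def)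
  qed
  have up: "u p = 0" using acdD(2)[OF U(1) c(1) pI cp] zint[of c p u1] zl c(2) by simp
  have u1p: "u1 p = 0" using U(6)[OF c(1) pI cp] zint[of c p] zl c(3) by (simp add: qd_increment_def)
  have zp: "u t = 0 \<and> u1 t = 0" if "c \<le> t" "t \<le> p" for t
    using zl[OF that(1)] up u1p that(2) by (cases "t = p") auto
  have "p = x"
  proof (rule ccontr)
    assume "p \<noteq> x"
    then have px: "p < x" using px by simp
    \<comment> \<open>Each of the three integrands u, \<open>u1\<close> and z u is bounded by C
      times A.\<close>
    define C where "C = 1 + cmod z"
    have C: "C > 0" by (simp add: C_def add_pos_nonneg)
    have one: "set_integrable M {p<..<x} (\<lambda>t. 1::real)" if "locfin M" for M
      using locfin_finite[OF that _ _ pI x(1), of "{p<..<x}"] locfin_sets[OF that]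
      by (auto simp: set_integrable_def subset_eq less_imp_le)
    have lim: "(\<lambda>n::nat. set_lebesgue_integral M {p<..<min x (p + 1 / real (Suc n))} (\<lambda>t. 1::real)) \<longlonglongrightarrow> 0" if M: "locfin M" for M
    proof (rule set_integral_shrink[OF one[OF M]])
      fix s assume "s \<in> {p<..<x}"
      then obtain N where N: "1 / real (Suc N) < s - p" using nat_approx_posE[of "s - p"] by auto
      show "\<forall>\<^sub>F n in sequentially. s \<notin> {p<..<min x (p + 1 / real (Suc n))}"
        using eventually_ge_at_top[of N]
      proof eventually_elim
        case (elim n)
        then have "1 / real (Suc n) \<le> 1 / real (Suc N)" by (simp add: frac_le)
        then show ?case using N by auto
      qed
    qed (auto simp: locfin_sets[OF M])
    have ev: "\<forall>\<^sub>F n in sequentially. set_lebesgue_integral M {p<..<min x (p + 1 / real (Suc n))} (\<lambda>t. 1::real) < 1 / (8 * C)" if "locfin M" for M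
      using order_tendstoD(2)[OF lim[OF that]] C by simp
    have "\<forall>\<^sub>F n in sequentially. set_lebesgue_integral (vsig P) {p<..<min x (p + 1 / real (Suc n))} (\<lambda>t. 1::real) < 1 / (8 * C) \<and>
      set_lebesgue_integral (chim P) {p<..<min x (p + 1 / real (Suc n))} (\<lambda>t. 1::real) < 1 / (8 * C) \<and>
      set_lebesgue_integral (rho_p P) {p<..<min x (p + 1 / real (Suc n))} (\<lambda>t. 1::real) < 1 / (8 * C) \<and>
      set_lebesgue_integral (rho_m P) {p<..<min x (p + 1 / real (Suc n))} (\<lambda>t. 1::real) < 1 / (8 * C)"
      using ev[OF locfin_measures(1)] ev[OF locfin_measures(2)] ev[OF locfin_measures(3)] ev[OF locfin_measures(4)]
      by eventually_elim simp
    then obtain n where n: "set_lebesgue_integral (vsig P) {p<..<min x (p + 1 / real (Suc n))} (\<lambda>t. 1::real) < 1 / (8 * C)"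
      "set_lebesgue_integral (chim P) {p<..<min x (p + 1 / real (Suc n))} (\<lambda>t. 1::real) < 1 / (8 * C)"
      "set_lebesgue_integral (rho_p P) {p<..<min x (p + 1 / real (Suc n))} (\<lambda>t. 1::real) < 1 / (8 * C)"
      "set_lebesgue_integral (rho_m P) {p<..<min x (p + 1 / real (Suc n))} (\<lambda>t. 1::real) < 1 / (8 * C)"
      using eventually_happens'[OF sequentially_bot] by blast
    define q where "q = min x (p + 1 / real (Suc n))"
    have pq: "p < q" "q \<le> x" using px by (auto simp: q_def add_pos_nonneg)
    have qI: "q \<in> I" by (rule Ivl_between[OF pI x(1)]) (use pq in auto)
    define A where "A t = cmod (u t) + cmod (u1 t)" for t
    obtain B1 where B1: "\<forall>t\<in>{p..q}. cmod (u t) \<le> B1" using acd_bounded[OF U(1) _ pI qI] by auto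
    obtain B2 where B2: "\<forall>t\<in>{p..q}. cmod (u1 t) \<le> B2" using qd_bounded[OF u pI qI] by blast
    have bA: "bdd_above (A ` {p..q})"
    proof (rule bdd_aboveI2)
      fix t assume "t \<in> {p..q}"
      then show "A t \<le> B1 + B2" using B1 B2 by (auto simp: A_def intro!: add_mono)
    qed
    define M where "M = (SUP t\<in>{p..q}. A t)"
    have le: "A t \<le> M" if "t \<in> {p..q}" for t unfolding M_def by (rule cSUP_upper[OF that bA])
    have M0: "0 \<le> M" using le[of p] pq by (simp add: A_def up u1p)
    have ib: "cmod (set_lebesgue_integral N {p..<t} h) \<le> M / 8"
      if t: "t \<in> {p..q}" and N: "locfin N" "set_lebesgue_integral N {p<..<q} (\<lambda>t. 1::real) < 1 / (8 * C)"
        and h: "h p = 0" "\<And>s. s \<in> {p..q} \<Longrightarrow> cmod (h s) \<le> C * A s" for t N and h :: "real \<Rightarrow> complex"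
    proof -
      \<comment> \<open>Since h vanishes at p, the point p can be removed; only the mass of the open
        interval is small.\<close>
      have "set_lebesgue_integral N {p..<t} h = set_lebesgue_integral N {p<..<t} h"
        unfolding set_lebesgue_integral_def using h(1)
        by (intro Bochner_Integration.integral_cong) (auto split: split_indicator simp: less_le)
      also have "cmod \<dots> \<le> set_lebesgue_integral N {p<..<q} (\<lambda>s. C * M * 1)"
      proof (rule set_integral_norm_le)
        show "set_integrable N {p<..<q} (\<lambda>s. C * M * 1)"
          using one[OF N(1)] pq locfin_sets[OF N(1)] by (intro set_integrable_mult_right) (auto intro: set_integrable_subset)
        show "{p<..<t} \<in> sets N" "{p<..<t} \<subseteq> {p<..<q}" using t locfin_sets[OF N(1)] by auto
        show "0 \<le> C * M * 1" using C M0 by simp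
        fix s assume "s \<in> {p<..<t}"
        then have s: "s \<in> {p..q}" using t by auto
        show "cmod (h s) \<le> C * M * 1" using order_trans[OF h(2)[OF s] mult_left_mono[OF le[OF s] less_imp_le[OF C]]] by simp
      qed
      also have "\<dots> = C * M * set_lebesgue_integral N {p<..<q} (\<lambda>t. 1::real)" by (rule set_integral_mult_right)
      also have "\<dots> \<le> C * M * (1 / (8 * C))" using N(2) C M0 by (intro mult_left_mono) auto
      also have "\<dots> = M / 8" using C by simp
      finally show ?thesis .
    qed
    have hb: "cmod (u s) \<le> C * A s" "cmod (u1 s) \<le> C * A s" "cmod (z * u s) \<le> C * A s" for s
    proof -
      have "A s \<le> C * A s" by (simp add: C_def A_def algebra_simps)
      then show "cmod (u s) \<le> C * A s" "cmod (u1 s) \<le> C * A s" by (auto simp: A_def intro: order_trans[rotated])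
      show "cmod (z * u s) \<le> C * A s" unfolding norm_mult C_def A_def by (intro mult_mono) auto
    qed
    \<comment> \<open>One integral for u and three for \<open>u1\<close>, each at most M/8, add up
      to M/2.\<close>
    have "A t \<le> M / 2" if t: "t \<in> {p..q}" for t
    proof -
      have tI: "t \<in> I" "p \<le> t" using t by (auto intro: Ivl_between[OF pI qI])
      have "cmod (u t) \<le> M / 8"
        using acdD(2)[OF U(1) pI tI] up ib[OF t locfin_measures(1) n(1)[folded q_def], of u1] u1p hb by simp
      moreover have "u1 t = qd_increment p t u (\<lambda>x. z * u x)" using U(6)[OF pI tI] u1p by simp
      then have "cmod (u1 t) \<le> M / 8 + M / 8 + M / 8"
        unfolding qd_increment_def using ib[OF t locfin_measures(2) n(2)[folded q_def], of u] ib[OF t locfin_measures(3) n(3)[folded q_def], of "\<lambda>x. z * u x"]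
          ib[OF t locfin_measures(4) n(4)[folded q_def], of "\<lambda>x. z * u x"] up hb
        by (simp only:) (intro norm_triangle_le norm_triangle_le_diff add_mono, auto)
      ultimately show ?thesis by (simp add: A_def)
    qed
    then have "M \<le> M / 2" by (subst M_def) (rule cSUP_least, use pq in auto)
    then have "M = 0" using M0 by simp
    have "u t = 0 \<and> u1 t = 0" if "c \<le> t" "t \<le> q" for t
    proof (cases "t \<le> p")
      case False
      then have "A t \<le> 0" using le[of t] \<open>M = 0\<close> that by auto
      then show ?thesis using norm_ge_zero[of "u t"] norm_ge_zero[of "u1 t"] unfolding A_def
        by (metis add_nonneg_eq_0_iff antisym norm_eq_zero add_nonneg_nonneg)
    qed (use zp that in blast)
    then have "q \<in> B" using pq cp by (auto simp: B_def)
    then have "q \<le> p" unfolding p_def by (rule cSup_upper[OF _ bdd])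
    then show False using pq by simp
  qed
  then show "u x = 0" "u1 x = 0" using zp[of x] x by auto
qed

end

section \<open>Completeness of \<open>L\<^sup>2\<close> and point evaluations\<close>

text \<open>Fatou's lemma along the subsequence turns the Cauchy bound on
  \<open>h n - h (r i)\<close> into a bound on \<open>h n - g\<close>. As n is not tied to the
  subsequence, the whole sequence converges in the mean.\<close>

lemma L2_Fatou:
  fixes h :: "nat \<Rightarrow> 'a \<Rightarrow> complex"
  assumes h: "\<And>n. h n \<in> borel_measurable M" and g: "g \<in> borel_measurable M" and r: "strict_mono r"
    and lim: "AE x in M. (\<lambda>i. h (r i) x) \<longlonglongrightarrow> g x"
    and i: "\<And>n m. integrable M (\<lambda>x. (cmod (h n x - h m x))\<^sup>2)"
    and c: "\<And>e. e > 0 \<Longrightarrow> \<exists>N. \<forall>i\<ge>N. \<forall>j\<ge>N. (\<integral>x. (cmod (h i x - h j x))\<^sup>2 \<partial>M) < e"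
    and e: "e > 0"
  shows "\<exists>N. \<forall>n\<ge>N. integrable M (\<lambda>x. (cmod (h n x - g x))\<^sup>2) \<and> (\<integral>x. (cmod (h n x - g x))\<^sup>2 \<partial>M) \<le> e"
proof -
  note [measurable] = h g
  obtain N where N: "\<And>i j. i \<ge> N \<Longrightarrow> j \<ge> N \<Longrightarrow> (\<integral>x. (cmod (h i x - h j x))\<^sup>2 \<partial>M) < e" using c[OF e] by blast
  show ?thesis
  proof (intro exI[of _ N] allI impI)
    fix n assume n: "n \<ge> N"
    have "(\<integral>\<^sup>+x. ennreal ((cmod (h n x - g x))\<^sup>2) \<partial>M) = (\<integral>\<^sup>+x. liminf (\<lambda>i. ennreal ((cmod (h n x - h (r i) x))\<^sup>2)) \<partial>M)"
    proof (rule nn_integral_cong_AE, use lim in eventually_elim)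
      fix x assume "(\<lambda>i. h (r i) x) \<longlonglongrightarrow> g x"
      then have "(\<lambda>i. ennreal ((cmod (h n x - h (r i) x))\<^sup>2)) \<longlonglongrightarrow> ennreal ((cmod (h n x - g x))\<^sup>2)"
        by (intro tendsto_intros)
      then show "ennreal ((cmod (h n x - g x))\<^sup>2) = liminf (\<lambda>i. ennreal ((cmod (h n x - h (r i) x))\<^sup>2))"
        by (intro lim_imp_Liminf[symmetric]) auto
    qed
    also have "\<dots> \<le> liminf (\<lambda>i. \<integral>\<^sup>+x. ennreal ((cmod (h n x - h (r i) x))\<^sup>2) \<partial>M)"
      by (rule nn_integral_liminf) measurable
    also have "\<dots> \<le> ennreal e"
    proof (rule Liminf_le)
      show "\<forall>\<^sub>F i in sequentially. (\<integral>\<^sup>+x. ennreal ((cmod (h n x - h (r i) x))\<^sup>2) \<partial>M) \<le> ennreal e"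
        using eventually_ge_at_top[of N]
      proof eventually_elim
        case (elim k)
        have "r k \<ge> N" using elim seq_suble[OF r, of k] by simp
        then have "(\<integral>x. (cmod (h n x - h (r k) x))\<^sup>2 \<partial>M) \<le> e" using N[OF n] by (simp add: less_imp_le)
        then show ?case by (subst nn_integral_eq_integral[OF i]) (auto intro: ennreal_leI)
      qed
    qed simp
    finally have *: "(\<integral>\<^sup>+x. ennreal ((cmod (h n x - g x))\<^sup>2) \<partial>M) \<le> ennreal e" .
    have int: "integrable M (\<lambda>x. (cmod (h n x - g x))\<^sup>2)"
    proof (rule integrableI_nonneg)
      show "(\<integral>\<^sup>+x. ennreal ((cmod (h n x - g x))\<^sup>2) \<partial>M) < \<infinity>" using le_less_trans[OF * ennreal_less_top] by simp
    qed auto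
    moreover have "(\<integral>x. (cmod (h n x - g x))\<^sup>2 \<partial>M) \<le> e"
      using * e by (subst (asm) nn_integral_eq_integral[OF int]) auto
    ultimately show "integrable M (\<lambda>x. (cmod (h n x - g x))\<^sup>2) \<and> (\<integral>x. (cmod (h n x - g x))\<^sup>2 \<partial>M) \<le> e" by blast
  qed
qed

text \<open>Young's inequality with a free weight t takes the place of the Cauchy-Schwarz
  inequality: choosing t suitably recovers a bound of the same order.\<close>

lemma le_scaled_squares: "0 < t \<Longrightarrow> a * b \<le> (t * a\<^sup>2 + b\<^sup>2 / t) / (2::real)"
proof -
  assume t: "0 < t"
  have "0 \<le> (t * a - b)\<^sup>2 / t" using t by simp
  also have "\<dots> = t * a\<^sup>2 + b\<^sup>2 / t - 2 * (a * b)" using t by (simp add: power2_eq_square field_simps)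
  finally show ?thesis by simp
qed

text \<open>On a measure of infinite mass convergence in the mean square does not control the L1
  norm. A positive integrable weight w \<le> 1, which is then square integrable, makes the sequence
  \<open>w h n\<close> Cauchy in L1; it has a subsequence converging almost everywhere, and w can be
  divided out.\<close>

lemma L2_complete:
  fixes h :: "nat \<Rightarrow> 'a \<Rightarrow> complex"
  assumes M: "sigma_finite_measure M" and h: "\<And>n. h n \<in> borel_measurable M"
    and hi: "\<And>n. integrable M (\<lambda>x. (cmod (h n x))\<^sup>2)"
    and i: "\<And>n m. integrable M (\<lambda>x. (cmod (h n x - h m x))\<^sup>2)"
    and c: "\<And>e. e > 0 \<Longrightarrow> \<exists>N. \<forall>i\<ge>N. \<forall>j\<ge>N. (\<integral>x. (cmod (h i x - h j x))\<^sup>2 \<partial>M) < e"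
  shows "\<exists>g\<in>borel_measurable M. \<forall>e>0. \<exists>N. \<forall>n\<ge>N. integrable M (\<lambda>x. (cmod (h n x - g x))\<^sup>2) \<and> (\<integral>x. (cmod (h n x - g x))\<^sup>2 \<partial>M) \<le> e"
proof -
  note [measurable] = h
  obtain w :: "'a \<Rightarrow> real" where w: "w \<in> borel_measurable M" "\<And>x. w x > 0" "\<And>x. w x \<le> 1" "integrable M w"
    using sigma_finite_measure.obtain_positive_integrable_function[OF M] by blast
  note [measurable] = w(1)
  have w2: "integrable M (\<lambda>x. (w x)\<^sup>2)"
  proof (rule Bochner_Integration.integrable_bound[OF w(4)])
    show "AE x in M. norm ((w x)\<^sup>2) \<le> norm (w x)"
      using w(2,3) by (intro AE_I2) (auto simp: power2_eq_square abs_of_pos mult_left_le less_imp_le)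
  qed measurable
  have wi: "integrable M (\<lambda>x. w x *\<^sub>R h n x)" for n
  proof (rule Bochner_Integration.integrable_bound[OF Bochner_Integration.integrable_add[OF w2 hi[of n]]])
    show "AE x in M. norm (w x *\<^sub>R h n x) \<le> norm ((w x)\<^sup>2 + (cmod (h n x))\<^sup>2)"
    proof (rule AE_I2)
      fix x
      have "w x * cmod (h n x) \<le> (1 * (w x)\<^sup>2 + (cmod (h n x))\<^sup>2 / 1) / 2" by (rule le_scaled_squares) simp
      also have "\<dots> \<le> (w x)\<^sup>2 + (cmod (h n x))\<^sup>2" by simp
      finally show "norm (w x *\<^sub>R h n x) \<le> norm ((w x)\<^sup>2 + (cmod (h n x))\<^sup>2)" using w(2)[of x] by simp
    qed
  qed measurable
  have L1: "\<exists>N. \<forall>i\<ge>N. \<forall>j\<ge>N. (\<integral>x. norm (w x *\<^sub>R h i x - w x *\<^sub>R h j x) \<partial>M) < e" if e: "e > 0" for e :: real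
  proof -
    define W where "W = (\<integral>x. (w x)\<^sup>2 \<partial>M)"
    have W: "W \<ge> 0" by (simp add: W_def)
    \<comment> \<open>Then t W \<le> e, and a mean square distance below e t contributes less than
      e; the average of the two is below e.\<close>
    define t where "t = e / (W + 1)"
    have t: "t > 0" using e W by (simp add: t_def)
    obtain N where N: "\<And>i j. i \<ge> N \<Longrightarrow> j \<ge> N \<Longrightarrow> (\<integral>x. (cmod (h i x - h j x))\<^sup>2 \<partial>M) < e * t" using c[of "e * t"] e t by auto
    show ?thesis
    proof (intro exI[of _ N] allI impI)
      fix k j assume kj: "N \<le> k" "N \<le> j"
      have "(\<integral>x. norm (w x *\<^sub>R h k x - w x *\<^sub>R h j x) \<partial>M) \<le> (\<integral>x. (t * (w x)\<^sup>2 + (cmod (h k x - h j x))\<^sup>2 / t) / 2 \<partial>M)"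
      proof (rule integral_mono)
        show "integrable M (\<lambda>x. norm (w x *\<^sub>R h k x - w x *\<^sub>R h j x))" using wi by (intro integrable_norm Bochner_Integration.integrable_diff)
        show "integrable M (\<lambda>x. (t * (w x)\<^sup>2 + (cmod (h k x - h j x))\<^sup>2 / t) / 2)"
          using w2 i by (intro integrable_divide Bochner_Integration.integrable_add integrable_mult_right)
        show "norm (w x *\<^sub>R h k x - w x *\<^sub>R h j x) \<le> (t * (w x)\<^sup>2 + (cmod (h k x - h j x))\<^sup>2 / t) / 2" for x
          using le_scaled_squares[OF t, of "w x" "cmod (h k x - h j x)"] w(2)[of x]
          by (simp flip: scaleR_diff_right)
      qed
      also have "\<dots> = (t * W + (\<integral>x. (cmod (h k x - h j x))\<^sup>2 \<partial>M) / t) / 2"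
        unfolding W_def using w2 i by (simp add: Bochner_Integration.integral_add)
      also have "\<dots> < (e + e) / 2"
      proof (intro divide_strict_right_mono add_le_less_mono)
        show "t * W \<le> e" using e W by (simp add: t_def field_simps)
        show "(\<integral>x. (cmod (h k x - h j x))\<^sup>2 \<partial>M) / t < e" using N[OF kj] t by (simp add: field_simps)
      qed simp
      finally show "(\<integral>x. norm (w x *\<^sub>R h k x - w x *\<^sub>R h j x) \<partial>M) < e" by simp
    qed
  qed
  obtain r where r: "strict_mono r" "AE x in M. Cauchy (\<lambda>i. w x *\<^sub>R h (r i) x)"
    using cauchy_L1_AE_cauchy_subseq[of M "\<lambda>n x. w x *\<^sub>R h n x", OF wi L1] by blast
  define g where "g x = lim (\<lambda>i. h (r i) x)" for x
  have g[measurable]: "g \<in> borel_measurable M" unfolding g_def[abs_def] by measurable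
  have lim: "AE x in M. (\<lambda>i. h (r i) x) \<longlonglongrightarrow> g x"
    using r(2)
  proof eventually_elim
    case (elim x)
    then have "convergent (\<lambda>i. w x *\<^sub>R h (r i) x)" by (simp add: Cauchy_convergent_iff)
    then obtain L where "(\<lambda>i. w x *\<^sub>R h (r i) x) \<longlonglongrightarrow> L" by (auto simp: convergent_def)
    then have "(\<lambda>i. (1 / w x) *\<^sub>R (w x *\<^sub>R h (r i) x)) \<longlonglongrightarrow> (1 / w x) *\<^sub>R L" by (intro tendsto_intros)
    then have "(\<lambda>i. h (r i) x) \<longlonglongrightarrow> (1 / w x) *\<^sub>R L" using w(2)[of x] by simp
    then show ?case unfolding g_def by (metis limI)
  qed
  show ?thesis using L2_Fatou[OF h g r(1) lim i c] g by blast
qed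

context sturm_liouville
begin

section \<open>The space \<open>H1\<close> and its inner product\<close>

lemma H1D:
  assumes "f \<in> H1 P"
  shows "acd P (vsig P) f (sder P f)" "sq_int (chim P) I f" "sq_int (vsig P) I (sder P f)"
    "borel_on f" "borel_on (sder P f)" "\<And>x. x \<notin> I \<Longrightarrow> f x = 0"
proof -
  obtain h where h: "acd P (vsig P) f h" "sq_int (chim P) I f" "sq_int (vsig P) I h" "\<forall>x. x \<notin> I \<longrightarrow> f x = 0"
    using assms unfolding H1_def by blast
  show a: "acd P (vsig P) f (sder P f)" by (rule sder_acd[OF h(1)])
  show "sq_int (chim P) I f" "\<And>x. x \<notin> I \<Longrightarrow> f x = 0" using h by auto
  show "sq_int (vsig P) I (sder P f)"
    using sq_int_AE_cong[OF sder_AE[OF h(1)] order_refl] h(3) by simp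
  show "borel_on f" "borel_on (sder P f)" using acd_borel_on[OF a locfin_measures(1)] loc_int_borel_on[OF acdD(1)[OF a] locfin_measures(1)] by auto
qed

lemma H1I:
  assumes "acd P (vsig P) f h" "sq_int (chim P) I f" "sq_int (vsig P) I h" "\<And>x. x \<notin> I \<Longrightarrow> f x = 0"
  shows "f \<in> H1 P"
  using assms unfolding H1_def by blast

lemma H1_add: assumes "f \<in> H1 P" "g \<in> H1 P" shows "(\<lambda>x. f x + g x) \<in> H1 P"
  by (rule H1I[OF acd_add[OF H1D(1)[OF assms(1)] H1D(1)[OF assms(2)]]])
    (auto intro!: sq_int_add H1D[OF assms(1)] H1D[OF assms(2)] simp: H1D(6)[OF assms(1)] H1D(6)[OF assms(2)])

lemma H1_cmult: assumes "f \<in> H1 P" shows "(\<lambda>x. a * f x) \<in> H1 P"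
  by (rule H1I[OF acd_cmult[OF H1D(1)[OF assms]]])
    (auto intro!: sq_int_cmult H1D[OF assms] simp: H1D(6)[OF assms])

lemma H1_diff: assumes "f \<in> H1 P" "g \<in> H1 P" shows "(\<lambda>x. f x - g x) \<in> H1 P"
  using H1_add[OF assms(1) H1_cmult[OF assms(2), of "-1"]] by simp

lemma H1_cnj: assumes "f \<in> H1 P" shows "(\<lambda>x. cnj (f x)) \<in> H1 P"
  by (rule H1I[OF acd_cnj[OF H1D(1)[OF assms]]])
    (auto simp: sq_int_cnj H1D[OF assms])

lemma H1_zero: "(\<lambda>x. 0) \<in> H1 P"
proof (rule H1I)
  show "acd P (vsig P) (\<lambda>x. 0) (\<lambda>x. 0)" by (rule acdI) (auto simp: loc_int_def set_integrable_def)
qed (auto simp: sq_int_def)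

lemma set_integral_AE_cong:
  fixes f g :: "real \<Rightarrow> complex"
  assumes "AE t in M. t \<in> I \<longrightarrow> f t = g t" "borel_on f" "borel_on g" "locfin M" "A \<in> sets borel" "A \<subseteq> I"
  shows "set_lebesgue_integral M A f = set_lebesgue_integral M A g"
  unfolding set_lebesgue_integral_def
proof (rule integral_cong_AE)
  show "(\<lambda>x. indicator A x *\<^sub>R f x) \<in> borel_measurable M" "(\<lambda>x. indicator A x *\<^sub>R g x) \<in> borel_measurable M"
    using borel_on_sub[OF assms(2,4-6)] borel_on_sub[OF assms(3,4-6)] by (simp_all add: set_borel_measurable_def)
  show "AE x in M. indicator A x *\<^sub>R f x = indicator A x *\<^sub>R g x"
    using assms(1) by eventually_elim (use assms(6) in \<open>auto split: split_indicator\<close>)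
qed

text \<open>Any two derivatives agree almost everywhere for \<open>vsig\<close>, so the choice made
  by \<open>sder\<close> does not matter and a convenient derivative may be used.\<close>

lemma h1_inner_eq:
  assumes f: "acd P (vsig P) f h" and g: "acd P (vsig P) g k"
  shows "h1_inner P f g = set_lebesgue_integral (chim P) I (\<lambda>y. f y * cnj (g y))
     + set_lebesgue_integral (vsig P) I (\<lambda>y. h y * cnj (k y))"
proof -
  have m: "borel_on h'" if "acd P (vsig P) f' h'" for f' h' by (rule loc_int_borel_on[OF acdD(1)[OF that] locfin_measures(1)])
  have "set_lebesgue_integral (vsig P) I (\<lambda>y. sder P f y * cnj (sder P g y)) = set_lebesgue_integral (vsig P) I (\<lambda>y. h y * cnj (k y))"
  proof (rule set_integral_AE_cong[OF _ _ _ locfin_measures(1) borel_Ivl order_refl])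
    show "AE t in vsig P. t \<in> I \<longrightarrow> sder P f t * cnj (sder P g t) = h t * cnj (k t)"
      using sder_AE[OF f] sder_AE[OF g] by eventually_elim simp
  qed (intro set_borel_measurable_mult set_borel_measurable_cnj m[OF f] m[OF g] m[OF sder_acd[OF f]] m[OF sder_acd[OF g]])+
  then show ?thesis by (simp add: h1_inner_def)
qed

lemma sq_int_mult_cnj:
  assumes "borel_on f" "sq_int M I f" "borel_on g" "sq_int M I g" "locfin M"
  shows "set_integrable M I (\<lambda>t. f t * cnj (g t))"
  using assms by (intro sq_int_mult set_borel_measurable_cnj) (auto simp: sq_int_cnj)

lemma H1_products:
  assumes "f \<in> H1 P" "g \<in> H1 P"
  shows "set_integrable (chim P) I (\<lambda>t. f t * cnj (g t))" "set_integrable (vsig P) I (\<lambda>t. sder P f t * cnj (sder P g t))"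
  by (intro sq_int_mult_cnj H1D[OF assms(1)] H1D[OF assms(2)] locfin_measures)+

lemma h1_inner_add:
  assumes f: "f \<in> H1 P" and g: "g \<in> H1 P" and k: "k \<in> H1 P"
  shows "h1_inner P (\<lambda>x. f x + g x) k = h1_inner P f k + h1_inner P g k"
  unfolding h1_inner_eq[OF acd_add[OF H1D(1)[OF f] H1D(1)[OF g] locfin_measures(1)] H1D(1)[OF k]] distrib_right
  using H1_products[OF f k] H1_products[OF g k] by (simp add: h1_inner_def set_integral_add(2))

lemma h1_inner_cmult:
  assumes f: "f \<in> H1 P" and k: "k \<in> H1 P"
  shows "h1_inner P (\<lambda>x. a * f x) k = a * h1_inner P f k"
  unfolding h1_inner_eq[OF acd_cmult[OF H1D(1)[OF f]] H1D(1)[OF k]]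
  by (simp add: h1_inner_def mult.assoc distrib_left)

lemma h1_inner_commute: "h1_inner P k f = cnj (h1_inner P f k)"
proof -
  have "(\<lambda>y. k y * cnj (f y)) = (\<lambda>y. cnj (f y * cnj (k y)))" "(\<lambda>y. sder P k y * cnj (sder P f y)) = (\<lambda>y. cnj (sder P f y * cnj (sder P k y)))"
    by auto
  then show ?thesis unfolding h1_inner_def by (simp only: set_integral_cnj complex_cnj_add)
qed

lemma h1_inner_cnj:
  assumes f: "f \<in> H1 P" and k: "k \<in> H1 P"
  shows "h1_inner P (\<lambda>x. cnj (f x)) (\<lambda>x. cnj (k x)) = cnj (h1_inner P f k)"
  unfolding h1_inner_eq[OF acd_cnj[OF H1D(1)[OF f]] acd_cnj[OF H1D(1)[OF k]]]
  by (simp only: complex_cnj_mult[symmetric] set_integral_cnj complex_cnj_add[symmetric] h1_inner_def)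

lemma h1_inner_diff:
  assumes f: "f \<in> H1 P" and g: "g \<in> H1 P" and k: "k \<in> H1 P"
  shows "h1_inner P (\<lambda>x. f x - g x) k = h1_inner P f k - h1_inner P g k"
  using h1_inner_add[OF f H1_cmult[OF g, of "-1"] k] h1_inner_cmult[OF g k, of "-1"] by simp

lemma h1_inner_add_right:
  assumes f: "f \<in> H1 P" and g: "g \<in> H1 P" and k: "k \<in> H1 P"
  shows "h1_inner P k (\<lambda>x. f x + g x) = h1_inner P k f + h1_inner P k g"
  unfolding h1_inner_commute[of k] using h1_inner_add[OF f g k] by simp

lemma h1_inner_diff_right:
  assumes f: "f \<in> H1 P" and g: "g \<in> H1 P" and k: "k \<in> H1 P"
  shows "h1_inner P k (\<lambda>x. f x - g x) = h1_inner P k f - h1_inner P k g"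
  unfolding h1_inner_commute[of k] using h1_inner_diff[OF f g k] by simp

lemma h1_inner_cmult_right:
  assumes f: "f \<in> H1 P" and k: "k \<in> H1 P"
  shows "h1_inner P k (\<lambda>x. a * f x) = cnj a * h1_inner P k f"
  unfolding h1_inner_commute[of k] using h1_inner_cmult[OF f k] by simp

definition h1_normsq where "h1_normsq f = Re (h1_inner P f f)"

lemma h1_inner_self: "h1_inner P f f = complex_of_real (set_lebesgue_integral (chim P) I (\<lambda>t. (cmod (f t))\<^sup>2)
    + set_lebesgue_integral (vsig P) I (\<lambda>t. (cmod (sder P f t))\<^sup>2))"
  unfolding h1_inner_def complex_norm_square[symmetric] set_integral_complex_of_real by simp

lemma h1_normsq_eq: "h1_normsq f = set_lebesgue_integral (chim P) I (\<lambda>t. (cmod (f t))\<^sup>2)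
    + set_lebesgue_integral (vsig P) I (\<lambda>t. (cmod (sder P f t))\<^sup>2)"
  unfolding h1_normsq_def h1_inner_self by (rule Re_complex_of_real)

lemma h1_inner_h1_normsq: "h1_inner P f f = complex_of_real (h1_normsq f)"
  unfolding h1_normsq_eq h1_inner_self ..

lemma set_integral_nonneg_real: "(\<And>t. 0 \<le> k t) \<Longrightarrow> 0 \<le> set_lebesgue_integral M A (k :: 'a \<Rightarrow> real)"
  unfolding set_lebesgue_integral_def by (intro integral_nonneg_AE AE_I2) (simp add: indicator_def)

lemma h1_normsq_nonneg: "0 \<le> h1_normsq f"
  unfolding h1_normsq_eq by (intro add_nonneg_nonneg set_integral_nonneg_real) auto

lemma h1_normsq_parts: "set_lebesgue_integral (chim P) I (\<lambda>t. (cmod (f t))\<^sup>2) \<le> h1_normsq f"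
    "set_lebesgue_integral (vsig P) I (\<lambda>t. (cmod (sder P f t))\<^sup>2) \<le> h1_normsq f"
  unfolding h1_normsq_eq by (auto intro!: set_integral_nonneg_real)

lemma h1_normsq_eq':
  assumes f: "acd P (vsig P) f h"
  shows "h1_normsq f = set_lebesgue_integral (chim P) I (\<lambda>t. (cmod (f t))\<^sup>2) + set_lebesgue_integral (vsig P) I (\<lambda>t. (cmod (h t))\<^sup>2)"
  unfolding h1_normsq_def h1_inner_eq[OF f f] complex_norm_square[symmetric] set_integral_complex_of_real by simp

text \<open>This expansion is the source of the variational bound, of the parallelogram law and of
  the scaling of the norm.\<close>

lemma h1_normsq_add_cmult:
  assumes d: "d \<in> H1 P" and k: "k \<in> H1 P"
  shows "h1_normsq (\<lambda>x. d x + t * k x) = h1_normsq d + 2 * Re (t * h1_inner P k d) + (cmod t)\<^sup>2 * h1_normsq k"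
proof -
  note tk = H1_cmult[OF k, of t]
  have "h1_inner P (\<lambda>x. d x + t * k x) (\<lambda>x. d x + t * k x) =
    h1_inner P d d + t * h1_inner P k d + cnj (t * h1_inner P k d) + (t * cnj t) * h1_inner P k k"
    by (simp add: h1_inner_add[OF d tk H1_add[OF d tk]] h1_inner_add_right[OF d tk] d tk
      h1_inner_cmult[OF k] h1_inner_cmult_right[OF k] k h1_inner_commute[of d k] algebra_simps)
  also have "t * cnj t = complex_of_real ((cmod t)\<^sup>2)" by (rule complex_norm_square[symmetric])
  finally show ?thesis unfolding h1_normsq_def by (simp add: h1_inner_h1_normsq)
qed

text \<open>If d is within \<epsilon> of minimal along the line in direction k, the linear term of
  the quadratic in t must be small. For \<epsilon> equal to the squared norm of d the hypothesis
  always holds, and the result is a weak Cauchy-Schwarz inequality.\<close>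

lemma h1_inner_le_if_almost_minimal:
  assumes d: "d \<in> H1 P" and k: "k \<in> H1 P" and min: "\<And>t. h1_normsq d - \<epsilon> \<le> h1_normsq (\<lambda>x. d x + t * k x)"
  shows "(cmod (h1_inner P k d))\<^sup>2 \<le> (h1_normsq k + 1) * \<epsilon>"
proof -
  define b where "b = h1_inner P k d"
  \<comment> \<open>The minimising step length would be the inverse of the squared norm of k; adding
    1 admits directions of norm zero.\<close>
  define s where "s = 1 / (h1_normsq k + 1)"
  have k1: "h1_normsq k + 1 > 0" using h1_normsq_nonneg[of k] by simp
  have s: "s > 0" using k1 by (simp add: s_def)
  have sk: "s * h1_normsq k \<le> 1" using h1_normsq_nonneg[of k] by (simp add: s_def)
  define t where "t = - complex_of_real s * cnj b"
  have "t * b = - complex_of_real (s * (cmod b)\<^sup>2)"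
    by (simp add: t_def complex_norm_square mult_ac del: of_real_power)
  then have "Re (t * b) = - (s * (cmod b)\<^sup>2)" by (metis Re_complex_of_real uminus_complex.sel(1))
  moreover have "(cmod t)\<^sup>2 = s\<^sup>2 * (cmod b)\<^sup>2" using s by (simp add: t_def norm_mult power_mult_distrib)
  ultimately have "- \<epsilon> \<le> 2 * (- (s * (cmod b)\<^sup>2)) + s\<^sup>2 * (cmod b)\<^sup>2 * h1_normsq k"
    using min[of t] unfolding h1_normsq_add_cmult[OF d k] b_def[symmetric] by simp
  also have "\<dots> = s * (cmod b)\<^sup>2 * (s * h1_normsq k) - 2 * (s * (cmod b)\<^sup>2)" by (simp add: power2_eq_square)
  also have "\<dots> \<le> s * (cmod b)\<^sup>2 * 1 - 2 * (s * (cmod b)\<^sup>2)"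
    using s sk by (intro diff_right_mono mult_left_mono) auto
  finally have "s * (cmod b)\<^sup>2 \<le> \<epsilon>" by simp
  then show ?thesis using k1 unfolding s_def b_def by (simp add: field_simps)
qed

text \<open>A compact interval K around x of positive mass for \<open>chim\<close> exists because
  \<open>chim\<close> is not zero on (a,b). For y in K, |f x| is at most |f y| plus the integral of
  the derivative's modulus over K; averaging over y against \<open>chim\<close> brings in the
  norm.\<close>

lemma point_evaluation_bounded:
  assumes x: "x \<in> I"
  obtains C where "C \<ge> 0" "\<And>f. f \<in> H1 P \<Longrightarrow> (cmod (f x))\<^sup>2 \<le> C * h1_normsq f"
proof -
  obtain l u where lu: "\<And>n. l n \<in> I" "\<And>n. u n \<in> I" "decseq l" "incseq u"
    "\<And>x. x \<in> I \<Longrightarrow> eventually (\<lambda>n. l n < x \<and> x < u n) sequentially"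
    by (rule Ivl_exhaustion) blast
  have chiI: "emeasure (chim P) I \<noteq> 0" using setting unfolding sl_setting_def by blast
  have UI: "I = (\<Union>n. {l n..u n})"
  proof
    show "I \<subseteq> (\<Union>n. {l n..u n})"
    proof
      fix y assume "y \<in> I"
      then obtain n where "l n < y \<and> y < u n" using eventually_happens'[OF sequentially_bot lu(5)] by blast
      then show "y \<in> (\<Union>n. {l n..u n})" by (auto intro!: exI[of _ n])
    qed
    show "(\<Union>n. {l n..u n}) \<subseteq> I" using Icc_sub_Ivl[OF lu(1,2)] by blast
  qed
  have inc: "incseq (\<lambda>n. {l n..u n})"
    unfolding incseq_def
  proof (intro allI impI)
    fix i j :: nat assume "i \<le> j"
    then have "l j \<le> l i" "u i \<le> u j" using lu(3,4) by (auto simp: incseq_def decseq_def)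
    then show "{l i..u i} \<subseteq> {l j..u j}" by auto
  qed
  have "(\<lambda>n. emeasure (chim P) {l n..u n}) \<longlonglongrightarrow> emeasure (chim P) I"
    unfolding UI by (rule Lim_emeasure_incseq[where A="\<lambda>n. {l n..u n}", OF _ inc]) auto
  then have "\<forall>\<^sub>F n in sequentially. 0 < emeasure (chim P) {l n..u n}"
    by (rule order_tendstoD(1)) (use chiI in \<open>simp add: zero_less_iff_neq_zero\<close>)
  with lu(5)[OF x] have "\<forall>\<^sub>F n in sequentially. 0 < emeasure (chim P) {l n..u n} \<and> l n < x \<and> x < u n"
    by eventually_elim simp
  then obtain n where n: "0 < emeasure (chim P) {l n..u n}" "l n < x" "x < u n"
    using eventually_happens'[OF sequentially_bot] by blast
  define K where "K = {l n..u n}"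
  have KI: "K \<subseteq> I" unfolding K_def by (rule Icc_sub_Ivl[OF lu(1,2)])
  have Kb: "K \<in> sets borel" by (simp add: K_def)
  have xK: "x \<in> K" using n by (simp add: K_def)
  have fin: "emeasure M K < \<infinity>" if "locfin M" for M
    by (rule locfin_finite[OF that Kb _ lu(1,2)[of n]]) (simp add: K_def)
  define m where "m = measure (chim P) K"
  define \<sigma> where "\<sigma> = measure (vsig P) K"
  have m: "m > 0" using n(1) fin[OF locfin_measures(2)] by (simp add: m_def K_def measure_def enn2real_positive_iff)
  have \<sigma>: "\<sigma> \<ge> 0" by (simp add: \<sigma>_def)
  \<comment> \<open>These are the coefficients of t and of the squared norm divided by t in the
    estimate \<open>main\<close>, after dividing by the mass m.\<close>
  define a where "a = (1 + \<sigma>) / 2"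
  define b where "b = (1 / m + 1) / 2"
  have a: "a \<ge> 0" using \<sigma> by (simp add: a_def)
  have b: "b \<ge> 0" using m by (simp add: b_def)
  have cst: "set_integrable M K (\<lambda>t. c)" "set_lebesgue_integral M K (\<lambda>t. c) = c * measure M K" if "locfin M" for M and c :: real
    using fin[OF that] Kb locfin_sets[OF that] by (auto simp: set_integrable_def set_lebesgue_integral_def)
  have main: "cmod (f x) \<le> a * t + b * (h1_normsq f / t)" if f: "f \<in> H1 P" and t: "t > 0" for f t
  proof -
    note F = H1D[OF f]
    let ?h = "sder P f"
    have ci: "set_integrable (chim P) K (\<lambda>y. (cmod (f y))\<^sup>2)" "set_integrable (vsig P) K (\<lambda>y. (cmod (?h y))\<^sup>2)"
      using sq_int_subset[OF F(2) KI] sq_int_subset[OF F(3) KI] unfolding sq_int_iff[OF F(4) locfin_measures(2) Kb KI] sq_int_iff[OF F(5) locfin_measures(1) Kb KI] by auto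
    have le: "set_lebesgue_integral (chim P) K (\<lambda>y. (cmod (f y))\<^sup>2) \<le> h1_normsq f" "set_lebesgue_integral (vsig P) K (\<lambda>y. (cmod (?h y))\<^sup>2) \<le> h1_normsq f"
    proof -
      have "norm (set_lebesgue_integral (chim P) K (\<lambda>y. (cmod (f y))\<^sup>2)) \<le> set_lebesgue_integral (chim P) I (\<lambda>y. (cmod (f y))\<^sup>2)"
        by (rule set_integral_norm_le) (use F(2) Kb KI in \<open>auto simp: sq_int_iff[OF F(4) locfin_measures(2) borel_Ivl order_refl]\<close>)
      then show "set_lebesgue_integral (chim P) K (\<lambda>y. (cmod (f y))\<^sup>2) \<le> h1_normsq f" using h1_normsq_parts(1)[of f] by simp
      have "norm (set_lebesgue_integral (vsig P) K (\<lambda>y. (cmod (?h y))\<^sup>2)) \<le> set_lebesgue_integral (vsig P) I (\<lambda>y. (cmod (?h y))\<^sup>2)"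
        by (rule set_integral_norm_le) (use F(3) Kb KI in \<open>auto simp: sq_int_iff[OF F(5) locfin_measures(1) borel_Ivl order_refl]\<close>)
      then show "set_lebesgue_integral (vsig P) K (\<lambda>y. (cmod (?h y))\<^sup>2) \<le> h1_normsq f" using h1_normsq_parts(2)[of f] by simp
    qed
    define S where "S = set_lebesgue_integral (vsig P) K (\<lambda>y. cmod (?h y))"
    have hK: "set_integrable (vsig P) K (\<lambda>y. cmod (?h y))"
      by (rule set_integrable_norm, rule loc_int_sub[OF acdD(1)[OF F(1)] locfin_measures(1) Kb _ lu(1,2)[of n]]) (simp add: K_def)
    have "S \<le> set_lebesgue_integral (vsig P) K (\<lambda>y. (t + (cmod (?h y))\<^sup>2 / t) / 2)"
      unfolding S_def
    proof (rule set_integral_mono[OF hK])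
      show "set_integrable (vsig P) K (\<lambda>y. (t + (cmod (?h y))\<^sup>2 / t) / 2)"
        using cst(1)[OF locfin_measures(1), of t] ci(2) by (intro set_integrable_divide set_integral_add)
      show "cmod (?h y) \<le> (t + (cmod (?h y))\<^sup>2 / t) / 2" for y
        using le_scaled_squares[OF t, of 1 "cmod (?h y)"] by simp
    qed
    also have "\<dots> = (t * \<sigma> + set_lebesgue_integral (vsig P) K (\<lambda>y. (cmod (?h y))\<^sup>2) / t) / 2"
      using cst[OF locfin_measures(1), of t] ci(2) t by (simp add: set_integral_add(2) \<sigma>_def)
    also have "\<dots> \<le> (t * \<sigma> + h1_normsq f / t) / 2"
      using le(2) t by (intro divide_right_mono add_mono) auto
    finally have S: "S \<le> (t * \<sigma> + h1_normsq f / t) / 2" .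
    have fxy: "cmod (f x) \<le> cmod (f y) + S" if y: "y \<in> K" for y
    proof -
      have nb: "cmod (set_lebesgue_integral (vsig P) {p..<q} ?h) \<le> S" if "p \<in> K" "q \<in> K" for p q
        unfolding S_def by (rule set_integral_norm_le[OF hK]) (use that in \<open>auto simp: K_def\<close>)
      have I': "x \<in> I" "y \<in> I" using x y KI by auto
      show ?thesis
      proof (cases "x \<le> y")
        case True
        have e: "f x = f y - set_lebesgue_integral (vsig P) {x..<y} ?h" using acdD(2)[OF F(1) I' True] by simp
        show ?thesis unfolding e using nb[OF xK y] norm_triangle_ineq4[of "f y" "set_lebesgue_integral (vsig P) {x..<y} ?h"] by linarith
      next
        case False
        then have e: "f x = f y + set_lebesgue_integral (vsig P) {y..<x} ?h" by (intro acdD(2)[OF F(1) I'(2,1)]) simp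
        show ?thesis unfolding e using nb[OF y xK] norm_triangle_ineq[of "f y" "set_lebesgue_integral (vsig P) {y..<x} ?h"] by linarith
      qed
    qed
    have "cmod (f x) * m = set_lebesgue_integral (chim P) K (\<lambda>y. cmod (f x))" using cst(2)[OF locfin_measures(2)] by (simp add: m_def)
    also have "\<dots> \<le> set_lebesgue_integral (chim P) K (\<lambda>y. (t + (cmod (f y))\<^sup>2 / t) / 2 + S)"
    proof (rule set_integral_mono[OF cst(1)[OF locfin_measures(2)]])
      show "set_integrable (chim P) K (\<lambda>y. (t + (cmod (f y))\<^sup>2 / t) / 2 + S)"
        using cst(1)[OF locfin_measures(2), of t] cst(1)[OF locfin_measures(2), of S] ci(1) by (intro set_integrable_divide set_integral_add)
      fix y assume "y \<in> K"
      moreover have "cmod (f y) \<le> (t + (cmod (f y))\<^sup>2 / t) / 2"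
        using le_scaled_squares[OF t, of 1 "cmod (f y)"] by simp
      ultimately show "cmod (f x) \<le> (t + (cmod (f y))\<^sup>2 / t) / 2 + S"
        using fxy[of y] by linarith
    qed
    also have "\<dots> = (t * m + set_lebesgue_integral (chim P) K (\<lambda>y. (cmod (f y))\<^sup>2) / t) / 2 + S * m"
      using cst[OF locfin_measures(2), of t] cst[OF locfin_measures(2), of S] ci(1) by (simp add: set_integral_add(2) set_integral_add(1) m_def)
    also have "\<dots> \<le> (t * m + h1_normsq f / t) / 2 + (t * \<sigma> + h1_normsq f / t) / 2 * m"
      using le(1) t S m by (intro add_mono divide_right_mono mult_right_mono) auto
    also have "\<dots> = (a * t + b * (h1_normsq f / t)) * m" using m t unfolding a_def b_def by (simp add: field_simps)
    finally show ?thesis using m by simp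
  qed
  show thesis
  proof (rule that[of "(a + b)\<^sup>2"])
    fix f assume f: "f \<in> H1 P"
    show "(cmod (f x))\<^sup>2 \<le> (a + b)\<^sup>2 * h1_normsq f"
    \<comment> \<open>For positive norm the choice of t as the norm balances the two terms of
      \<open>main\<close>; for norm zero, t is sent to 0.\<close>
    proof (cases "h1_normsq f = 0")
      case True
      have "cmod (f x) \<le> a * t" if "t > 0" for t using main[OF f that] True by simp
      then have "cmod (f x) \<le> 0 + e" if "e > 0" for e
      proof -
        have "cmod (f x) \<le> a * (e / (a + 1))" using \<open>\<And>t. t > 0 \<Longrightarrow> cmod (f x) \<le> a * t\<close>[of "e / (a + 1)"] that a by simp
        also have "\<dots> \<le> e" using that a by (simp add: field_simps)
        finally show ?thesis by simp
      qed
      then have "cmod (f x) \<le> 0" by (rule field_le_epsilon)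
      then show ?thesis using True by simp
    next
      case False
      then have p: "h1_normsq f > 0" using h1_normsq_nonneg[of f] by simp
      then have "cmod (f x) \<le> a * sqrt (h1_normsq f) + b * (h1_normsq f / sqrt (h1_normsq f))" by (intro main[OF f]) simp
      also have "\<dots> = (a + b) * sqrt (h1_normsq f)" using p by (simp add: real_div_sqrt algebra_simps)
      finally have "(cmod (f x))\<^sup>2 \<le> ((a + b) * sqrt (h1_normsq f))\<^sup>2" by (intro power_mono) auto
      then show ?thesis using p by (simp add: power_mult_distrib)
    qed
  qed simp
qed

end

section \<open>Riesz representation of point evaluations\<close>

context sturm_liouville
begin

section \<open>Transfer of the L2 results to the interval\<close>

lemma density_Ivl:
  fixes k :: "real \<Rightarrow> 'b::{banach, second_countable_topology}"
  assumes M: "locfin M" and k: "k \<in> borel_measurable borel" and kk: "\<And>t. t \<in> I \<Longrightarrow> k t = k' t"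
  shows "integral\<^sup>L (density M (\<lambda>t. ennreal (indicator I t))) k = set_lebesgue_integral M I k'"
    and "integrable (density M (\<lambda>t. ennreal (indicator I t))) k \<longleftrightarrow> set_integrable M I k'"
proof -
  have "k \<in> borel_measurable M" using k measurable_cong_sets[OF locfin_sets[OF M] refl] by blast
  note d = integral_density_indicator[OF this, of I]
  have "set_lebesgue_integral M I k = set_lebesgue_integral M I k'"
    using kk locfin_sets[OF M] by (intro set_lebesgue_integral_cong) auto
  moreover have "set_integrable M I k = set_integrable M I k'" by (rule set_integrable_cong[OF refl refl kk])
  ultimately show "integral\<^sup>L (density M (\<lambda>t. ennreal (indicator I t))) k = set_lebesgue_integral M I k'"
    "integrable (density M (\<lambda>t. ennreal (indicator I t))) k \<longleftrightarrow> set_integrable M I k'"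
    using d locfin_sets[OF M] by auto
qed

text \<open>The setting does not bound the mass outside (a,b). The density vanishes there, so the
  complement is a null set and completes the countable cover by compact intervals.\<close>

lemma sigma_finite_density_Ivl:
  assumes M: "locfin M"
  shows "sigma_finite_measure (density M (\<lambda>t. ennreal (indicator I t)))"
proof -
  obtain l u where lu: "\<And>n. l n \<in> I" "\<And>n. u n \<in> I"
    "\<And>x. x \<in> I \<Longrightarrow> eventually (\<lambda>n. l n < x \<and> x < u n) sequentially"
    using Ivl_exhaustion by metis
  let ?D = "density M (\<lambda>t. ennreal (indicator I t))"
  have em: "emeasure ?D A = emeasure M (I \<inter> A)" if "A \<in> sets borel" for A
  proof -
    have "ennreal (indicator I s) * indicator A s = indicator (I \<inter> A) s" for s
      by (auto split: split_indicator)
    then have "emeasure ?D A = (\<integral>\<^sup>+ s. indicator (I \<inter> A) s \<partial>M)"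
      using locfin_sets[OF M] that by (subst emeasure_density) auto
    then show ?thesis using locfin_sets[OF M] that by simp
  qed
  show ?thesis
  proof (rule sigma_finite_measure.intro, intro exI conjI)
    show "countable (insert (- I) (range (\<lambda>n. {l n..u n})))" by simp
    show "insert (- I) (range (\<lambda>n. {l n..u n})) \<subseteq> sets ?D"
      using borel_comp[OF borel_Ivl] by (simp add: locfin_sets[OF M] image_subset_iff)
    show "\<Union> (insert (- I) (range (\<lambda>n. {l n..u n}))) = space ?D"
    proof -
      have "x \<in> (\<Union>n. {l n..u n})" if xI: "x \<in> I" for x
      proof -
        obtain n where "l n < x \<and> x < u n" using eventually_happens'[OF sequentially_bot lu(3)[OF xI]] by blast
        then show ?thesis by (auto intro!: exI[of _ n])
      qed
      then show ?thesis using sets_eq_imp_space_eq[OF locfin_sets[OF M]] by auto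
    qed
    show "\<forall>a\<in>insert (- I) (range (\<lambda>n. {l n..u n})). emeasure ?D a \<noteq> \<infinity>"
    proof
      fix a assume "a \<in> insert (- I) (range (\<lambda>n. {l n..u n}))"
      then consider "a = - I" | n where "a = {l n..u n}" by auto
      then show "emeasure ?D a \<noteq> \<infinity>"
      proof cases
        case 1
        then show ?thesis by (simp add: em borel_comp)
      next
        case (2 n)
        have "emeasure M (I \<inter> {l n..u n}) < \<infinity>" by (rule locfin_finite[OF M _ _ lu(1,2)[of n]]) auto
        then show ?thesis using 2 by (simp add: em)
      qed
    qed
  qed
qed

text \<open>Here the limit function is prescribed, which keeps its pointwise values;
  \<open>Ivl_L2_complete\<close> produces an unspecified limit and serves for derivatives.\<close>

lemma Ivl_L2_Fatou:
  assumes M: "locfin M" and h: "\<And>n. borel_on (h n)" and g: "borel_on g"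
    and lim: "\<And>x. x \<in> I \<Longrightarrow> (\<lambda>i. h i x) \<longlonglongrightarrow> g x"
    and i: "\<And>n m. set_integrable M I (\<lambda>x. (cmod (h n x - h m x))\<^sup>2)"
    and c: "\<And>e. e > 0 \<Longrightarrow> \<exists>N. \<forall>i\<ge>N. \<forall>j\<ge>N. set_lebesgue_integral M I (\<lambda>x. (cmod (h i x - h j x))\<^sup>2) < e"
    and e: "e > 0"
  shows "\<exists>N. \<forall>n\<ge>N. set_integrable M I (\<lambda>x. (cmod (h n x - g x))\<^sup>2) \<and> set_lebesgue_integral M I (\<lambda>x. (cmod (h n x - g x))\<^sup>2) \<le> e"
proof -
  let ?D = "density M (\<lambda>t. ennreal (indicator I t))"
  define h' where "h' n x = indicator I x *\<^sub>R h n x" for n x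
  define g' where "g' x = indicator I x *\<^sub>R g x" for x
  have m[measurable]: "h' n \<in> borel_measurable borel" "g' \<in> borel_measurable borel" for n
    using h g by (auto simp: h'_def[abs_def] g'_def[abs_def] set_borel_measurable_def)
  have m2: "(\<lambda>x. (cmod (h' n x - h' m x))\<^sup>2) \<in> borel_measurable borel" "(\<lambda>x. (cmod (h' n x - g' x))\<^sup>2) \<in> borel_measurable borel" for n m
    by measurable
  have mD: "k \<in> borel_measurable ?D" if "k \<in> borel_measurable borel" for k :: "real \<Rightarrow> complex"
    using that measurable_cong_sets[of ?D borel borel borel] locfin_sets[OF M] by simp
  have t1: "integral\<^sup>L ?D (\<lambda>x. (cmod (h' n x - h' m x))\<^sup>2) = set_lebesgue_integral M I (\<lambda>x. (cmod (h n x - h m x))\<^sup>2)"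
    "integrable ?D (\<lambda>x. (cmod (h' n x - h' m x))\<^sup>2) \<longleftrightarrow> set_integrable M I (\<lambda>x. (cmod (h n x - h m x))\<^sup>2)" for n m
    by (rule density_Ivl[OF M m2(1)]; simp add: h'_def)+
  have t2: "integral\<^sup>L ?D (\<lambda>x. (cmod (h' n x - g' x))\<^sup>2) = set_lebesgue_integral M I (\<lambda>x. (cmod (h n x - g x))\<^sup>2)"
    "integrable ?D (\<lambda>x. (cmod (h' n x - g' x))\<^sup>2) \<longleftrightarrow> set_integrable M I (\<lambda>x. (cmod (h n x - g x))\<^sup>2)" for n
    by (rule density_Ivl[OF M m2(2)]; simp add: h'_def g'_def)+
  have l: "(\<lambda>i. h' (id i) x) \<longlonglongrightarrow> g' x" for x
    using lim[of x] by (cases "x \<in> I") (auto simp: h'_def g'_def)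
  show ?thesis unfolding t2[symmetric]
  proof (rule L2_Fatou[OF _ _ _ _ _ _ e])
    show "h' n \<in> borel_measurable ?D" "g' \<in> borel_measurable ?D" for n using m mD by blast+
    show "strict_mono (id :: nat \<Rightarrow> nat)" by (simp add: strict_mono_def)
    show "AE x in ?D. (\<lambda>i. h' (id i) x) \<longlonglongrightarrow> g' x" using l by (rule AE_I2)
    show "integrable ?D (\<lambda>x. (cmod (h' n x - h' m x))\<^sup>2)" for n m unfolding t1 by (rule i)
    show "\<exists>N. \<forall>i\<ge>N. \<forall>j\<ge>N. (\<integral>x. (cmod (h' i x - h' j x))\<^sup>2 \<partial>?D) < e" if "0 < e" for e
      unfolding t1 by (rule c[OF that])
  qed
qed

lemma Ivl_L2_complete:
  fixes h :: "nat \<Rightarrow> real \<Rightarrow> complex"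
  assumes M: "locfin M" and h: "\<And>n. borel_on (h n)" and s: "\<And>n. sq_int M I (h n)"
    and c: "\<And>e. e > 0 \<Longrightarrow> \<exists>N. \<forall>i\<ge>N. \<forall>j\<ge>N. set_lebesgue_integral M I (\<lambda>x. (cmod (h i x - h j x))\<^sup>2) < e"
  shows "\<exists>g. borel_on g \<and> (\<forall>e>0. \<exists>N. \<forall>n\<ge>N. set_integrable M I (\<lambda>x. (cmod (h n x - g x))\<^sup>2) \<and> set_lebesgue_integral M I (\<lambda>x. (cmod (h n x - g x))\<^sup>2) \<le> e)"
proof -
  let ?D = "density M (\<lambda>t. ennreal (indicator I t))"
  define h' where "h' n x = indicator I x *\<^sub>R h n x" for n x
  have m[measurable]: "h' n \<in> borel_measurable borel" for n
    using h by (auto simp: h'_def[abs_def] set_borel_measurable_def)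
  have m2: "(\<lambda>x. (cmod (h' n x - h' m x))\<^sup>2) \<in> borel_measurable borel" "(\<lambda>x. (cmod (h' n x))\<^sup>2) \<in> borel_measurable borel" for n m
    by measurable
  have mD: "k \<in> borel_measurable ?D \<longleftrightarrow> k \<in> borel_measurable borel" for k :: "real \<Rightarrow> complex"
  proof -
    have "sets ?D = sets borel" by (simp add: locfin_sets[OF M])
    then have "borel_measurable ?D = (borel_measurable borel :: (real \<Rightarrow> complex) set)"
      by (rule measurable_cong_sets) simp
    then show ?thesis by blast
  qed
  have t1: "integral\<^sup>L ?D (\<lambda>x. (cmod (h' n x - h' m x))\<^sup>2) = set_lebesgue_integral M I (\<lambda>x. (cmod (h n x - h m x))\<^sup>2)"
    "integrable ?D (\<lambda>x. (cmod (h' n x - h' m x))\<^sup>2) \<longleftrightarrow> set_integrable M I (\<lambda>x. (cmod (h n x - h m x))\<^sup>2)" for n m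
    by (rule density_Ivl[OF M m2(1)]; simp add: h'_def)+
  have t2: "integrable ?D (\<lambda>x. (cmod (h' n x))\<^sup>2) \<longleftrightarrow> set_integrable M I (\<lambda>x. (cmod (h n x))\<^sup>2)" for n
    by (rule density_Ivl[OF M m2(2)]) (simp add: h'_def)
  have si: "set_integrable M I (\<lambda>x. (cmod (h n x))\<^sup>2)" for n
    using s[of n] unfolding sq_int_iff[OF h M borel_Ivl order_refl] .
  have "sq_int M I (\<lambda>x. h n x + (-1) * h m x)" for n m
    by (intro sq_int_add sq_int_cmult h s M borel_Ivl order_refl set_borel_measurable_cmult)
  then have sd: "set_integrable M I (\<lambda>x. (cmod (h n x - h m x))\<^sup>2)" for n m
    using sq_int_iff[OF set_borel_measurable_diff[OF h h] M borel_Ivl order_refl] by simp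
  have "\<exists>g\<in>borel_measurable ?D. \<forall>e>0. \<exists>N. \<forall>n\<ge>N. integrable ?D (\<lambda>x. (cmod (h' n x - g x))\<^sup>2) \<and> (\<integral>x. (cmod (h' n x - g x))\<^sup>2 \<partial>?D) \<le> e"
  proof (rule L2_complete[OF sigma_finite_density_Ivl[OF M]])
    show "h' n \<in> borel_measurable ?D" for n using m mD by blast
    show "integrable ?D (\<lambda>x. (cmod (h' n x))\<^sup>2)" for n unfolding t2 by (rule si)
    show "integrable ?D (\<lambda>x. (cmod (h' n x - h' m x))\<^sup>2)" for n m unfolding t1 by (rule sd)
    show "\<exists>N. \<forall>i\<ge>N. \<forall>j\<ge>N. (\<integral>x. (cmod (h' i x - h' j x))\<^sup>2 \<partial>?D) < e" if "0 < e" for e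
      unfolding t1 by (rule c[OF that])
  qed
  then obtain g where g: "g \<in> borel_measurable ?D" "\<And>e. e > 0 \<Longrightarrow> \<exists>N. \<forall>n\<ge>N. integrable ?D (\<lambda>x. (cmod (h' n x - g x))\<^sup>2) \<and> (\<integral>x. (cmod (h' n x - g x))\<^sup>2 \<partial>?D) \<le> e"
    by blast
  have gm[measurable]: "g \<in> borel_measurable borel" using g(1) mD by blast
  have m3: "(\<lambda>x. (cmod (h' n x - g x))\<^sup>2) \<in> borel_measurable borel" for n by measurable
  have t3: "integral\<^sup>L ?D (\<lambda>x. (cmod (h' n x - g x))\<^sup>2) = set_lebesgue_integral M I (\<lambda>x. (cmod (h n x - g x))\<^sup>2)"
    "integrable ?D (\<lambda>x. (cmod (h' n x - g x))\<^sup>2) \<longleftrightarrow> set_integrable M I (\<lambda>x. (cmod (h n x - g x))\<^sup>2)" for n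
    by (rule density_Ivl[OF M m3]; simp add: h'_def)+
  have "borel_on g" unfolding set_borel_measurable_def by measurable
  then show ?thesis using g(2) unfolding t3 by blast
qed

lemma sq_int_loc_int:
  assumes h: "borel_on h" "sq_int M I h" and M: "locfin M"
  shows "loc_int P M h"
  unfolding loc_int_def
proof (intro allI impI)
  fix c d assume cd: "c \<in> I" "d \<in> I"
  have K: "{c..d} \<in> sets borel" "{c..d} \<subseteq> I" using Icc_sub_Ivl[OF cd] by auto
  have cst: "set_integrable M {c..d} (\<lambda>t. 1::real)"
    using locfin_finite[OF M K(1) order_refl cd] locfin_sets[OF M] by (auto simp: set_integrable_def)
  show "set_integrable M {c..d} h"
  proof (rule set_integrable_bound)
    show "set_integrable M {c..d} (\<lambda>t. 1 + (cmod (h t))\<^sup>2)"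
      using sq_int_subset[OF h(2) K(2)] cst unfolding sq_int_iff[OF h(1) M K] by (intro set_integral_add)
    show "set_borel_measurable M {c..d} h" by (rule borel_on_sub[OF h(1) M K])
    show "AE x in M. x \<in> {c..d} \<longrightarrow> norm (h x) \<le> norm (1 + (cmod (h x))\<^sup>2)"
    proof (intro AE_I2 impI)
      fix x
      have "1 * cmod (h x) \<le> (1 * 1\<^sup>2 + (cmod (h x))\<^sup>2 / 1) / 2" by (rule le_scaled_squares) simp
      then have "2 * cmod (h x) \<le> 1 + (cmod (h x))\<^sup>2" by simp
      then have "cmod (h x) \<le> 1 + (cmod (h x))\<^sup>2" using norm_ge_zero[of "h x"] by linarith
      then show "norm (h x) \<le> norm (1 + (cmod (h x))\<^sup>2)" by (simp add: abs_of_nonneg)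
    qed
  qed
qed

text \<open>The interval [x,y) has finite mass, so convergence in the mean square implies
  convergence in L1 on it.\<close>

lemma L2_imp_Ico_convergence:
  assumes h: "\<And>n. borel_on (h n)" "\<And>n. sq_int M I (h n)" and g: "borel_on g" "sq_int M I g" and M: "locfin M"
    and c: "\<And>e. e > 0 \<Longrightarrow> \<exists>N. \<forall>n\<ge>N. set_integrable M I (\<lambda>x. (cmod (h n x - g x))\<^sup>2) \<and> set_lebesgue_integral M I (\<lambda>x. (cmod (h n x - g x))\<^sup>2) \<le> e"
    and xy: "x \<in> I" "y \<in> I"
  shows "(\<lambda>n. set_lebesgue_integral M {x..<y} (h n)) \<longlonglongrightarrow> set_lebesgue_integral M {x..<y} g"
proof (rule LIMSEQ_I)
  fix e :: real assume e: "e > 0"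
  have li: "loc_int P M (h n)" "loc_int P M g" for n by (intro sq_int_loc_int h g M)+
  have K: "{x..<y} \<in> sets borel" "{x..<y} \<subseteq> {x..y}" "{x..<y} \<subseteq> I"
    using Icc_sub_Ivl[OF xy] by (auto simp: subset_eq)
  define m where "m = measure M {x..<y}"
  have m: "m \<ge> 0" by (simp add: m_def)
  have cst: "set_integrable M {x..<y} (\<lambda>t. c)" "set_lebesgue_integral M {x..<y} (\<lambda>t. c) = c * m" for c :: real
    using locfin_finite[OF M K(1,2) xy] locfin_sets[OF M] by (auto simp: set_integrable_def set_lebesgue_integral_def m_def)
  \<comment> \<open>Then t m \<le> e, and a squared distance of at most e t / 2 gives the bound (e +
    e/2)/2 < e.\<close>
  define t where "t = e / (m + 1)"
  have t: "t > 0" using e m by (simp add: t_def)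
  obtain N where N: "\<And>n. n \<ge> N \<Longrightarrow> set_integrable M I (\<lambda>x. (cmod (h n x - g x))\<^sup>2)"
    "\<And>n. n \<ge> N \<Longrightarrow> set_lebesgue_integral M I (\<lambda>x. (cmod (h n x - g x))\<^sup>2) \<le> e * t / 2"
    using c[of "e * t / 2"] e t by auto
  show "\<exists>no. \<forall>n\<ge>no. norm (set_lebesgue_integral M {x..<y} (h n) - set_lebesgue_integral M {x..<y} g) < e"
  proof (intro exI[of _ N] allI impI)
    fix n assume n: "n \<ge> N"
    have i2: "set_integrable M {x..<y} (\<lambda>s. (cmod (h n s - g s))\<^sup>2)"
      by (rule set_integrable_subset[OF N(1)[OF n]]) (use K locfin_sets[OF M] in auto)
    have le2: "set_lebesgue_integral M {x..<y} (\<lambda>s. (cmod (h n s - g s))\<^sup>2) \<le> e * t / 2"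
    proof -
      have "norm (set_lebesgue_integral M {x..<y} (\<lambda>s. (cmod (h n s - g s))\<^sup>2)) \<le> set_lebesgue_integral M I (\<lambda>s. (cmod (h n s - g s))\<^sup>2)"
        by (rule set_integral_norm_le[OF N(1)[OF n]]) (use K locfin_sets[OF M] in auto)
      then show ?thesis using N(2)[OF n] by simp
    qed
    have "set_lebesgue_integral M {x..<y} (h n) - set_lebesgue_integral M {x..<y} g = set_lebesgue_integral M {x..<y} (\<lambda>s. h n s - g s)"
      by (rule set_integral_diff(2)[symmetric]) (intro loc_int_Ico li M xy)+
    also have "norm \<dots> \<le> set_lebesgue_integral M {x..<y} (\<lambda>s. (t + (cmod (h n s - g s))\<^sup>2 / t) / 2)"
    proof (rule set_integral_norm_le)
      show "set_integrable M {x..<y} (\<lambda>s. (t + (cmod (h n s - g s))\<^sup>2 / t) / 2)"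
        using cst(1)[of t] i2 by (intro set_integrable_divide set_integral_add)
      show "norm (h n s - g s) \<le> (t + (cmod (h n s - g s))\<^sup>2 / t) / 2" for s
        using le_scaled_squares[OF t, of 1 "cmod (h n s - g s)"] by simp
    qed (use K locfin_sets[OF M] t in auto)
    also have "\<dots> = (t * m + set_lebesgue_integral M {x..<y} (\<lambda>s. (cmod (h n s - g s))\<^sup>2) / t) / 2"
      using cst[of t] i2 by (simp add: set_integral_add(2))
    also have "\<dots> \<le> (t * m + (e * t / 2) / t) / 2"
      using le2 t by (intro divide_right_mono add_left_mono) auto
    also have "\<dots> < e"
    proof -
      have "t * m \<le> e" using e m by (simp add: t_def field_simps)
      then show ?thesis using e t by simp
    qed
    finally show "norm (set_lebesgue_integral M {x..<y} (h n) - set_lebesgue_integral M {x..<y} g) < e" .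
  qed
qed

text \<open>The limit must be a definite function, not a class modulo \<open>chim\<close>, which may
  be a single point mass. Bounded point evaluations give a pointwise limit g, and the derivatives
  converge in the mean square to some k. Passing to the limit in the increments over [x,y) shows
  that k is a derivative of g.\<close>

lemma H1_complete:
  assumes f: "\<And>n::nat. f n \<in> H1 P" and c: "\<And>e. e > 0 \<Longrightarrow> \<exists>N. \<forall>i\<ge>N. \<forall>j\<ge>N. h1_normsq (\<lambda>x. f i x - f j x) < e"
  obtains g where "g \<in> H1 P" "\<And>e. e > 0 \<Longrightarrow> \<exists>N. \<forall>n\<ge>N. h1_normsq (\<lambda>x. f n x - g x) \<le> e"
    "\<And>x. x \<in> I \<Longrightarrow> (\<lambda>n. f n x) \<longlonglongrightarrow> g x"
proof -
  define h where "h n = sder P (f n)" for n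
  note F = H1D[OF f, folded h_def]
  have ad: "acd P (vsig P) (\<lambda>x. f i x - f j x) (\<lambda>x. h i x - h j x)" for i j by (intro acd_diff F locfin_measures)
  have parts: "set_lebesgue_integral (chim P) I (\<lambda>t. (cmod (f i t - f j t))\<^sup>2) \<le> h1_normsq (\<lambda>x. f i x - f j x)"
    "set_lebesgue_integral (vsig P) I (\<lambda>t. (cmod (h i t - h j t))\<^sup>2) \<le> h1_normsq (\<lambda>x. f i x - f j x)" for i j
    unfolding h1_normsq_eq'[OF ad] by (auto intro!: set_integral_nonneg_real)
  have cc: "\<exists>N. \<forall>i\<ge>N. \<forall>j\<ge>N. set_lebesgue_integral (chim P) I (\<lambda>t. (cmod (f i t - f j t))\<^sup>2) < e"
    "\<exists>N. \<forall>i\<ge>N. \<forall>j\<ge>N. set_lebesgue_integral (vsig P) I (\<lambda>t. (cmod (h i t - h j t))\<^sup>2) < e" if e: "e > 0" for e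
    using c[OF e] le_less_trans[OF parts(1)] le_less_trans[OF parts(2)] by blast+
  define g where "g y = (if y \<in> I then lim (\<lambda>n. f n y) else 0)" for y
  have lim: "(\<lambda>n. f n y) \<longlonglongrightarrow> g y" if y: "y \<in> I" for y
  proof -
    obtain C where C: "C \<ge> 0" "\<And>f. f \<in> H1 P \<Longrightarrow> (cmod (f y))\<^sup>2 \<le> C * h1_normsq f" using point_evaluation_bounded[OF y] by blast
    have "Cauchy (\<lambda>n. f n y)"
    proof (rule CauchyI)
      fix e :: real assume e: "e > 0"
      obtain N where N: "\<forall>i\<ge>N. \<forall>j\<ge>N. h1_normsq (\<lambda>x. f i x - f j x) < e\<^sup>2 / (C + 1)" using c[of "e\<^sup>2 / (C + 1)"] e C(1) by auto
      show "\<exists>M. \<forall>m\<ge>M. \<forall>n\<ge>M. norm (f m y - f n y) < e"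
      proof (intro exI[of _ N] allI impI)
        fix i j assume ij: "N \<le> i" "N \<le> j"
        have "(cmod (f i y - f j y))\<^sup>2 \<le> C * h1_normsq (\<lambda>x. f i x - f j x)" by (rule C(2)[OF H1_diff[OF f f]])
        also have "\<dots> \<le> (C + 1) * h1_normsq (\<lambda>x. f i x - f j x)" using h1_normsq_nonneg by (intro mult_right_mono) auto
        also have "\<dots> < (C + 1) * (e\<^sup>2 / (C + 1))" using N ij C(1) by (intro mult_strict_left_mono) auto
        also have "\<dots> = e\<^sup>2" using C(1) by simp
        finally show "norm (f i y - f j y) < e" by (rule power2_less_imp_less) (use e in simp)
      qed
    qed
    then have "convergent (\<lambda>n. f n y)" by (simp add: Cauchy_convergent_iff)
    then show ?thesis using y by (simp add: g_def convergent_LIMSEQ_iff)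
  qed
  have mg: "borel_on g" unfolding set_borel_measurable_def
  proof (rule borel_measurable_LIMSEQ_metric[where f="\<lambda>n x. indicator I x *\<^sub>R f n x"])
    show "(\<lambda>x. indicator I x *\<^sub>R f n x) \<in> borel_measurable borel" for n
      using F(4) by (simp add: set_borel_measurable_def)
    show "(\<lambda>n. indicator I x *\<^sub>R f n x) \<longlonglongrightarrow> indicator I x *\<^sub>R g x" for x
      using lim[of x] by (cases "x \<in> I") auto
  qed
  obtain k where k: "borel_on k" "\<And>e. e > 0 \<Longrightarrow> \<exists>N. \<forall>n\<ge>N. set_integrable (vsig P) I (\<lambda>x. (cmod (h n x - k x))\<^sup>2) \<and> set_lebesgue_integral (vsig P) I (\<lambda>x. (cmod (h n x - k x))\<^sup>2) \<le> e"
    using Ivl_L2_complete[of "vsig P" h, OF _ F(5) F(3) cc(2)] by auto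
  have "sq_int (chim P) I (\<lambda>x. f n x + (-1) * f m x)" for n m
    by (intro sq_int_add sq_int_cmult F borel_Ivl order_refl set_borel_measurable_cmult locfin_measures)
  then have sd: "set_integrable (chim P) I (\<lambda>x. (cmod (f n x - f m x))\<^sup>2)" for n m
    using sq_int_iff[OF set_borel_measurable_diff[OF F(4) F(4)] _ borel_Ivl order_refl, of "chim P" n m] by simp
  have gc: "\<exists>N. \<forall>n\<ge>N. set_integrable (chim P) I (\<lambda>x. (cmod (f n x - g x))\<^sup>2) \<and> set_lebesgue_integral (chim P) I (\<lambda>x. (cmod (f n x - g x))\<^sup>2) \<le> e"
    if "e > 0" for e by (rule Ivl_L2_Fatou[OF locfin_measures(2) F(4) mg lim sd cc(1) that])
  have sub: "sq_int M I a" if a: "borel_on a" and b: "borel_on b" "sq_int M I b" and M: "locfin M"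
    and d: "set_integrable M I (\<lambda>x. (cmod (b x - a x))\<^sup>2)" for M a b
  proof -
    have "sq_int M I (\<lambda>x. b x - a x)" using d sq_int_iff[OF set_borel_measurable_diff[OF b(1) a] M borel_Ivl order_refl] by simp
    then have "sq_int M I (\<lambda>x. b x + (-1) * (b x - a x))"
      by (intro sq_int_add sq_int_cmult b borel_Ivl order_refl set_borel_measurable_cmult set_borel_measurable_diff a M)
    then show ?thesis by simp
  qed
  have sg: "sq_int (chim P) I g"
    using gc[OF zero_less_one] sub[OF mg F(4) F(2) locfin_measures(2)] by blast
  have sk: "sq_int (vsig P) I k"
    using k(2)[OF zero_less_one] sub[OF k(1) F(5) F(3) locfin_measures(1)] by blast
  have ag: "acd P (vsig P) g k"
  proof (rule acdI)
    show "loc_int P (vsig P) k" by (rule sq_int_loc_int[OF k(1) sk locfin_measures(1)])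
    fix x y assume xy: "x \<in> I" "y \<in> I" "x < y"
    have "(\<lambda>n. f n x + set_lebesgue_integral (vsig P) {x..<y} (h n)) \<longlonglongrightarrow> g x + set_lebesgue_integral (vsig P) {x..<y} k"
      by (intro tendsto_add lim[OF xy(1)] L2_imp_Ico_convergence[OF F(5) F(3) k(1) sk locfin_measures(1) k(2) xy(1,2)])
    moreover have "f n x + set_lebesgue_integral (vsig P) {x..<y} (h n) = f n y" for n
      using acdD(2)[OF F(1) xy(1,2) less_imp_le[OF xy(3)]] by simp
    ultimately show "g y = g x + set_lebesgue_integral (vsig P) {x..<y} k"
      using LIMSEQ_unique[OF lim[OF xy(2)]] by simp
  qed
  show thesis
  proof (rule that[OF _ _ lim])
    show "g \<in> H1 P" by (rule H1I[OF ag sg sk]) (simp add: g_def)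
    fix e :: real assume "e > 0"
    then have e2: "e / 2 > 0" by simp
    obtain N1 where N1: "\<forall>n\<ge>N1. set_lebesgue_integral (chim P) I (\<lambda>x. (cmod (f n x - g x))\<^sup>2) \<le> e / 2" using gc[OF e2] by blast
    obtain N2 where N2: "\<forall>n\<ge>N2. set_lebesgue_integral (vsig P) I (\<lambda>x. (cmod (h n x - k x))\<^sup>2) \<le> e / 2" using k(2)[OF e2] by blast
    show "\<exists>N. \<forall>n\<ge>N. h1_normsq (\<lambda>x. f n x - g x) \<le> e"
    proof (intro exI[of _ "max N1 N2"] allI impI)
      fix n assume "n \<ge> max N1 N2"
      then show "h1_normsq (\<lambda>x. f n x - g x) \<le> e"
        unfolding h1_normsq_eq'[OF acd_diff[OF F(1) ag locfin_measures(1)]] using N1[rule_format, of n] N2[rule_format, of n] by simp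
    qed
  qed
qed

lemma h1_normsq_cmult: "f \<in> H1 P \<Longrightarrow> h1_normsq (\<lambda>x. a * f x) = (cmod a)\<^sup>2 * h1_normsq f"
proof -
  assume f: "f \<in> H1 P"
  have "h1_normsq (\<lambda>x. 0 + a * f x) = h1_normsq (\<lambda>x. 0) + 2 * Re (a * h1_inner P f (\<lambda>x. 0)) + (cmod a)\<^sup>2 * h1_normsq f"
    by (rule h1_normsq_add_cmult[OF H1_zero f])
  moreover have "h1_inner P f (\<lambda>x. 0) = 0" "h1_normsq (\<lambda>x. 0) = 0"
    using h1_inner_cmult_right[OF f f, of 0] h1_inner_cmult_right[OF f H1_zero, of 0] by (simp_all add: h1_normsq_def)
  ultimately show ?thesis by simp
qed

text \<open>The element g of least norm with g x = 1 is orthogonal to all elements vanishing at x.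
  Applied to \<open>k - k x * g\<close> this gives the inner product of k and g as k x times the
  squared norm of g, so g divided by its squared norm represents the evaluation.\<close>

lemma riesz_point_evaluation:
  assumes x: "x \<in> I"
  shows "\<exists>d\<in>H1 P. \<forall>f\<in>H1 P. h1_inner P f d = f x"
proof (cases "\<exists>f\<in>H1 P. f x \<noteq> 0")
  \<comment> \<open>The zero function represents an evaluation that vanishes identically; this case
    spares the construction of an element not vanishing at x.\<close>
  case False
  have "h1_inner P f (\<lambda>x. 0) = 0" if "f \<in> H1 P" for f using h1_inner_cmult_right[OF that that, of 0] by simp
  then show ?thesis using False H1_zero by (intro bexI[of _ "\<lambda>x. 0"]) auto
next
  case True
  then obtain f0 where f0: "f0 \<in> H1 P" "f0 x \<noteq> 0" by blast
  define E where "E = {f \<in> H1 P. f x = 1}"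
  have "(\<lambda>y. (1 / f0 x) * f0 y) \<in> E" using f0(2) H1_cmult[OF f0(1), of "1 / f0 x"] by (simp add: E_def)
  then have Ene: "E \<noteq> {}" by blast
  have bdd: "bdd_below (h1_normsq ` E)" by (rule bdd_belowI2[of _ 0]) (rule h1_normsq_nonneg)
  define J where "J = (INF f\<in>E. h1_normsq f)"
  have J: "J \<le> h1_normsq f" if "f \<in> E" for f unfolding J_def by (rule cINF_lower[OF bdd that])
  have "\<exists>f\<in>E. h1_normsq f < J + 1 / real (Suc n)" for n
    using cINF_less_iff[OF Ene bdd, of "J + 1 / real (Suc n)"] unfolding J_def[symmetric] by simp
  then obtain f where f: "\<And>n. f n \<in> E" "\<And>n. h1_normsq (f n) < J + 1 / real (Suc n)" by metis
  have fH: "f n \<in> H1 P" "f n x = 1" for n using f(1)[of n] by (auto simp: E_def)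
  \<comment> \<open>By the parallelogram law, since the midpoint of two members of \<open>E\<close>
    lies in \<open>E\<close> and so has squared norm at least J.\<close>
  have par: "h1_normsq (\<lambda>y. f i y - f j y) \<le> 2 / real (Suc i) + 2 / real (Suc j)" for i j
  proof -
    have "h1_normsq (\<lambda>y. f i y + (-1) * f j y) + h1_normsq (\<lambda>y. f i y + 1 * f j y) = 2 * h1_normsq (f i) + 2 * h1_normsq (f j)"
      unfolding h1_normsq_add_cmult[OF fH(1) fH(1)] by simp
    moreover have m: "(\<lambda>y. (1/2) * (f i y + f j y)) \<in> E"
      using H1_cmult[OF H1_add[OF fH(1) fH(1)], of "1/2"] fH(2) by (simp add: E_def)
    have "J \<le> h1_normsq (\<lambda>y. f i y + f j y) / 4"
      using J[OF m] unfolding h1_normsq_cmult[OF H1_add[OF fH(1) fH(1)]] by (simp add: power2_eq_square)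
    ultimately show ?thesis using f(2)[of i] f(2)[of j] by simp
  qed
  have cau: "\<exists>N. \<forall>i\<ge>N. \<forall>j\<ge>N. h1_normsq (\<lambda>y. f i y - f j y) < e" if e: "e > 0" for e
  proof -
    obtain N where N: "1 / real (Suc N) < e / 4" using nat_approx_posE[of "e / 4"] e by auto
    show ?thesis
    proof (intro exI[of _ N] allI impI)
      fix i j assume ij: "i \<ge> N" "j \<ge> N"
      have "1 / real (Suc i) \<le> 1 / real (Suc N)" "1 / real (Suc j) \<le> 1 / real (Suc N)" using ij by (simp_all add: frac_le)
      then show "h1_normsq (\<lambda>y. f i y - f j y) < e" using par[of i j] N by simp
    qed
  qed
  obtain g where g: "g \<in> H1 P" "\<And>e. e > 0 \<Longrightarrow> \<exists>N. \<forall>n\<ge>N. h1_normsq (\<lambda>x. f n x - g x) \<le> e" "\<And>y. y \<in> I \<Longrightarrow> (\<lambda>n. f n y) \<longlonglongrightarrow> g y"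
    using H1_complete[OF fH(1) cau] by blast
  have gx: "g x = 1" using g(3)[OF x] by (simp add: fH(2) LIMSEQ_const_iff)
  obtain C where C: "C \<ge> 0" "\<And>f. f \<in> H1 P \<Longrightarrow> (cmod (f x))\<^sup>2 \<le> C * h1_normsq f" using point_evaluation_bounded[OF x] by blast
  have gn: "h1_normsq g > 0" using C(2)[OF g(1)] gx h1_normsq_nonneg[of g] by (cases "h1_normsq g = 0") auto
  have orth: "h1_inner P k g = 0" if k: "k \<in> H1 P" "k x = 0" for k
  proof -
    have b1: "(cmod (h1_inner P k (f n)))\<^sup>2 \<le> (h1_normsq k + 1) * (1 / real (Suc n))" for n
    proof (rule h1_inner_le_if_almost_minimal[OF fH(1) k(1)])
      fix t
      have "(\<lambda>y. f n y + t * k y) \<in> E" using H1_add[OF fH(1) H1_cmult[OF k(1)]] fH(2) k(2) by (simp add: E_def)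
      then show "h1_normsq (f n) - 1 / real (Suc n) \<le> h1_normsq (\<lambda>y. f n y + t * k y)" using J f(2)[of n] by force
    qed
    \<comment> \<open>The case where \<epsilon> is the full squared norm, in which almost minimality
      is trivial; it lets \<open>f n\<close> be replaced by its limit g.\<close>
    have b2: "(cmod (h1_inner P k (\<lambda>x. f n x - g x)))\<^sup>2 \<le> (h1_normsq k + 1) * h1_normsq (\<lambda>x. f n x - g x)" for n
      by (rule h1_inner_le_if_almost_minimal[OF H1_diff[OF fH(1) g(1)] k(1)]) (simp add: h1_normsq_nonneg)
    have nk: "h1_normsq k + 1 > 0" using h1_normsq_nonneg[of k] by simp
    have "cmod (h1_inner P k g) \<le> 0 + e" if e: "e > 0" for e
    proof -
      define \<eta> where "\<eta> = (e / 2)\<^sup>2 / (h1_normsq k + 1)"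
      have \<eta>: "\<eta> > 0" using e nk by (simp add: \<eta>_def)
      obtain N1 where N1: "1 / real (Suc N1) < \<eta>" using nat_approx_posE[OF \<eta>] by auto
      obtain N2 where N2: "\<forall>n\<ge>N2. h1_normsq (\<lambda>x. f n x - g x) \<le> \<eta>" using g(2)[OF \<eta>] by blast
      define n where "n = max N1 N2"
      have "1 / real (Suc n) \<le> 1 / real (Suc N1)" by (simp add: n_def frac_le)
      then have "(h1_normsq k + 1) * (1 / real (Suc n)) \<le> (h1_normsq k + 1) * \<eta>" using N1 nk by (intro mult_left_mono) auto
      moreover have "(h1_normsq k + 1) * \<eta> = (e / 2)\<^sup>2" using nk by (simp add: \<eta>_def)
      moreover have "(h1_normsq k + 1) * h1_normsq (\<lambda>x. f n x - g x) \<le> (h1_normsq k + 1) * \<eta>"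
        using N2 nk by (intro mult_left_mono) (auto simp: n_def)
      ultimately have "(cmod (h1_inner P k (f n)))\<^sup>2 \<le> (e / 2)\<^sup>2" "(cmod (h1_inner P k (\<lambda>x. f n x - g x)))\<^sup>2 \<le> (e / 2)\<^sup>2"
        using b1[of n] b2[of n] by linarith+
      then have le: "cmod (h1_inner P k (f n)) \<le> e / 2" "cmod (h1_inner P k (\<lambda>x. f n x - g x)) \<le> e / 2"
        using e by (auto intro: power2_le_imp_le)
      have "h1_inner P k g = h1_inner P k (f n) - h1_inner P k (\<lambda>x. f n x - g x)"
        unfolding h1_inner_diff_right[OF fH(1) g(1) k(1)] by simp
      then have "cmod (h1_inner P k g) \<le> cmod (h1_inner P k (f n)) + cmod (h1_inner P k (\<lambda>x. f n x - g x))"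
        using norm_triangle_ineq4 by metis
      then show ?thesis using le by simp
    qed
    then have "cmod (h1_inner P k g) \<le> 0" by (rule field_le_epsilon)
    then show ?thesis by simp
  qed
  show ?thesis
  proof (intro bexI ballI)
    show dH: "(\<lambda>y. complex_of_real (1 / h1_normsq g) * g y) \<in> H1 P" by (rule H1_cmult[OF g(1)])
    fix k assume k: "k \<in> H1 P"
    note kg = H1_cmult[OF g(1), of "k x"]
    have "h1_inner P (\<lambda>y. k y - k x * g y) g = 0" by (rule orth[OF H1_diff[OF k kg]]) (simp add: gx)
    then have "h1_inner P k g = k x * complex_of_real (h1_normsq g)"
      unfolding h1_inner_diff[OF k kg g(1)] h1_inner_cmult[OF g(1) g(1)] h1_inner_h1_normsq by simp
    then show "h1_inner P k (\<lambda>y. complex_of_real (1 / h1_normsq g) * g y) = k x"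
      unfolding h1_inner_cmult_right[OF g(1) k] using gn by simp
  qed
qed

text \<open>The difference has norm zero, and bounded point evaluations turn this into vanishing at
  every point of (a,b).\<close>

lemma reproducing_unique:
  assumes d: "d \<in> H1 P" "\<And>f. f \<in> H1 P \<Longrightarrow> h1_inner P f d = f x"
    and d': "d' \<in> H1 P" "\<And>f. f \<in> H1 P \<Longrightarrow> h1_inner P f d' = f x"
  shows "d = d'"
proof
  fix y
  have dd: "(\<lambda>y. d y - d' y) \<in> H1 P" by (rule H1_diff[OF d(1) d'(1)])
  have "h1_normsq (\<lambda>y. d y - d' y) = 0"
    unfolding h1_normsq_def h1_inner_diff_right[OF d(1) d'(1) dd] using d(2)[OF dd] d'(2)[OF dd] by simp
  then show "d y = d' y"
  proof (cases "y \<in> I")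
    case True
    obtain C where "\<And>f. f \<in> H1 P \<Longrightarrow> (cmod (f y))\<^sup>2 \<le> C * h1_normsq f" using point_evaluation_bounded[OF True] by blast
    from this[OF dd] \<open>h1_normsq _ = 0\<close> show ?thesis by simp
  qed (simp add: H1D(6)[OF d(1)] H1D(6)[OF d'(1)])
qed

text \<open>The conjugate of the representing element represents the same evaluation, so by
  uniqueness it is real-valued. This makes the delta term of the Green function unaffected by the
  conjugation in the inner product.\<close>

lemma delta_props:
  assumes x: "x \<in> I"
  shows "delta P x \<in> H1 P" "\<And>f. f \<in> H1 P \<Longrightarrow> h1_inner P f (delta P x) = f x"
    "\<And>y. cnj (delta P x y) = delta P x y"
proof -
  obtain d where d: "d \<in> H1 P" "\<forall>f\<in>H1 P. h1_inner P f d = f x" using riesz_point_evaluation[OF x] by blast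
  have "delta P x = d" unfolding delta_def
    using d by (intro the_equality conjI ballI) (auto intro: reproducing_unique)
  then show 1: "delta P x \<in> H1 P" "\<And>f. f \<in> H1 P \<Longrightarrow> h1_inner P f (delta P x) = f x" using d by auto
  have "(\<lambda>y. cnj (delta P x y)) = delta P x"
  proof (rule reproducing_unique[OF H1_cnj[OF 1(1)] _ 1])
    fix f assume f: "f \<in> H1 P"
    show "h1_inner P f (\<lambda>y. cnj (delta P x y)) = f x"
      using h1_inner_cnj[OF H1_cnj[OF f] 1(1)] 1(2)[OF H1_cnj[OF f]] by simp
  qed
  then show "\<And>y. cnj (delta P x y) = delta P x y" by metis
qed

end

section \<open>The resolvent\<close>

context sturm_liouville
begin

section \<open>Both endpoints in one notation\<close>

definition near_end where
  "near_end e f \<longleftrightarrow> (\<exists>h. acd P (vsig P) f h \<and> (\<exists>c\<in>I. sq_int (chim P) (tail e c) f \<and> sq_int (vsig P) (tail e c) h))"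

definition lc where "lc e \<longleftrightarrow> (\<forall>z u. z \<noteq> 0 \<longrightarrow> is_sol P z u \<longrightarrow> near_end e u)"

definition Vend where "Vend e p q = Lim (end_filter e) (Vw P p q)"

lemma near_end_eq: "H1_near_a P f \<longleftrightarrow> near_end True f" "H1_near_b P f \<longleftrightarrow> near_end False f"
  by (simp_all add: H1_near_a_def H1_near_b_def near_end_def tail_def)

lemma lc_eq: "lc_a P \<longleftrightarrow> lc True" "lc_b P \<longleftrightarrow> lc False"
  by (simp_all add: lc_a_def lc_b_def lc_def near_end_eq)

lemma Vend_eq: "Vw_a P p q = Vend True p q" "Vw_b P p q = Vend False p q"
  by (simp_all add: Vw_a_def Vw_b_def Vend_def end_filter_def)

text \<open>The second components may be any functions: \<open>Vw\<close> depends on the first ones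
  through their quasi-derivatives only, so \<open>ft'\<close> and \<open>gt'\<close> are not tied to
  \<open>ft\<close> and \<open>gt\<close>.\<close>

lemma Vw_eq_wronsk:
  assumes "qd P f f1 ft'" "qd P g g1 gt'" "x \<in> I"
  shows "Vw P (f, ft) (g, gt) x = wronsk f1 ft g1 gt x"
  by (simp add: Vw_def wronsk_def qder_eq[OF assms(1,3)] qder_eq[OF assms(2,3)])

lemma Vend_eqI:
  assumes f: "qd P f f1 ft'" and g: "qd P g g1 gt'" and L: "(wronsk f1 ft g1 gt \<longlongrightarrow> L) (end_filter e)"
  shows "Vend e (f, ft) (g, gt) = L"
proof -
  have "(Vw P (f, ft) (g, gt) \<longlongrightarrow> L) (end_filter e)"
    by (rule Lim_transform_eventually[OF L], use end_filter_Ivl in eventually_elim) (simp add: Vw_eq_wronsk[OF f g])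
  then show ?thesis unfolding Vend_def by (rule tendsto_Lim[OF end_filter_ne_bot])
qed

text \<open>A value of \<open>Lim\<close> says nothing unless the limit exists; existence is what
  membership near the endpoint provides.\<close>

lemma wronsk_tendsto_Vend:
  assumes f: "near_pair e f f1 ft ft1" and g: "near_pair e g g1 gt gt1"
  shows "(wronsk f1 ft g1 gt \<longlongrightarrow> Vend e (f, ft) (g, gt)) (end_filter e)"
proof -
  obtain L where L: "(wronsk f1 ft g1 gt \<longlongrightarrow> L) (end_filter e)" using wronsk_limit[OF f g] by blast
  show ?thesis
    using L Vend_eqI[OF loc_pairD(1)[OF near_pair_loc_pair[OF f]] loc_pairD(1)[OF near_pair_loc_pair[OF g]] L] by simp
qed

lemma near_pair_Tmax:
  assumes f: "(f, ft) \<in> Tmax P" and q: "qd P f f1 ft" and a: "acd P (vsig P) ft ft1"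
  shows "near_pair e f f1 ft ft1"
proof -
  have H: "f \<in> H1 P" "ft \<in> H1 P" using f by (auto simp: Tmax_def)
  obtain c where c: "c \<in> I" using Ivl_nonempty .
  have "sq_int (vsig P) I f1" "sq_int (vsig P) I ft1"
    using sq_int_AE_cong[OF sder_AE[OF qdD(1)[OF q]] order_refl] sq_int_AE_cong[OF sder_AE[OF a] order_refl] H1D(3)[OF H(1)] H1D(3)[OF H(2)]
    by auto
  then show ?thesis
    unfolding near_pair_def loc_pair_def using q a H1D(2)[OF H(1)] H1D(2)[OF H(2)] c tail_sub by (blast intro: sq_int_subset)
qed

lemma Tmax_near_pair:
  assumes f: "(f, ft) \<in> Tmax P"
  obtains f1 ft1 where "\<And>e. near_pair e f f1 ft ft1"
proof -
  obtain f1 ft1 where "qd P f f1 ft" "acd P (vsig P) ft ft1" using f by (auto simp: Tmax_def Tloc_def)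
  then show thesis using that near_pair_Tmax[OF f] by blast
qed

lemma near_pair_cnj:
  assumes "near_pair e f f1 ft ft1"
  shows "near_pair e (\<lambda>x. cnj (f x)) (\<lambda>x. cnj (f1 x)) (\<lambda>x. cnj (ft x)) (\<lambda>x. cnj (ft1 x))"
  using assms unfolding near_pair_def loc_pair_def sq_int_cnj by (blast intro: qd_cnj acd_cnj)

lemma near_pair_sol:
  assumes u: "qd P u u1 (\<lambda>x. z * u x)"
    and c: "c \<in> I" "sq_int (chim P) (tail e c) u" "sq_int (vsig P) (tail e c) u1"
  shows "near_pair e u u1 (\<lambda>x. z * u x) (\<lambda>x. z * u1 x)"
proof -
  note t = loc_pair_sol[OF u]
  show ?thesis unfolding near_pair_def
    using t c loc_pairD[OF t] by (intro conjI bexI[of _ c] sq_int_cmult locfin_measures tail_borel tail_sub) auto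
qed

lemma near_pair_sol_near_end:
  assumes u: "qd P u u1 (\<lambda>x. z * u x)" and n: "near_end e u"
  shows "near_pair e u u1 (\<lambda>x. z * u x) (\<lambda>x. z * u1 x)"
proof -
  obtain h c where h: "acd P (vsig P) u h" "c \<in> I" "sq_int (chim P) (tail e c) u" "sq_int (vsig P) (tail e c) h"
    using n unfolding near_end_def by blast
  have "sq_int (vsig P) (tail e c) u1"
    using sq_int_AE_cong[OF acd_AE_unique[OF h(1) qdD(1)[OF u] locfin_measures(1)] tail_sub] h(4) by simp
  then show ?thesis using near_pair_sol[OF u h(2,3)] by blast
qed

lemma wronsk_vanish_at_end:
  assumes v: "v \<in> Tmax P" and vl: "lc e \<Longrightarrow> \<exists>f\<in>Tmax P. Vend e f (cnjp v) \<noteq> 0"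
    and f: "near_pair e f f1 ft ft1" "lc e \<Longrightarrow> Vend e (f, ft) (cnjp v) = 0"
    and g: "near_pair e g g1 gt gt1" "lc e \<Longrightarrow> Vend e (g, gt) (cnjp v) = 0"
  shows "(wronsk f1 ft g1 gt \<longlongrightarrow> 0) (end_filter e)"
proof (cases "lc e")
  case True
  obtain v0 vt where ve: "v = (v0, vt)" by (cases v)
  obtain v1 vt1 where "near_pair e v0 v1 vt vt1" using Tmax_near_pair v unfolding ve by blast
  note nv = near_pair_cnj[OF this]
  have c: "cnjp v = ((\<lambda>x. cnj (v0 x)), (\<lambda>x. cnj (vt x)))" by (simp add: ve cnjp_def)
  obtain h ht where h: "(h, ht) \<in> Tmax P" "Vend e (h, ht) (cnjp v) \<noteq> 0" using vl[OF True] by auto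
  obtain h1 ht1 where nh: "near_pair e h h1 ht ht1" using Tmax_near_pair[OF h(1)] by blast
  show ?thesis
    using wronsk_limit_pluecker[OF f(1) g(1) nh] wronsk_tendsto_Vend[OF f(1) nv] wronsk_tendsto_Vend[OF g(1) nv] wronsk_tendsto_Vend[OF nh nv]
      f(2)[OF True] g(2)[OF True] h(2) unfolding c by simp
next
  case False
  \<comment> \<open>Failure of the limit-circle condition yields a solution for some nonzero
    parameter, unrelated to the spectral parameter of the theorem. This is why
    \<open>solutions_near_if_wronsk_limit_nonzero\<close> treats every nonzero parameter.\<close>
  then obtain z u where zu: "z \<noteq> 0" "is_sol P z u" "\<not> near_end e u" unfolding lc_def by blast
  obtain u1 where u1: "qd P u u1 (\<lambda>x. z * u x)" using zu(2) unfolding is_sol_def by blast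
  obtain L where L: "(wronsk f1 ft g1 gt \<longlongrightarrow> L) (end_filter e)" using wronsk_limit[OF f(1) g(1)] by blast
  have "L = 0"
  proof (rule ccontr)
    assume "L \<noteq> 0"
    from solutions_near_if_wronsk_limit_nonzero[OF f(1) g(1) L this zu(1) u1]
    show False using zu(3) qdD(1)[OF u1] unfolding near_end_def by blast
  qed
  then show ?thesis using L by simp
qed

text \<open>Between the two tails lies a compact interval, possibly empty, on which f is
  bounded.\<close>

lemma sq_int_global:
  assumes f: "borel_on f" and M: "locfin M" and c: "c \<in> I" "sq_int M (tail True c) f" and d: "d \<in> I" "sq_int M (tail False d) f"
    and b: "\<And>c d. c \<in> I \<Longrightarrow> d \<in> I \<Longrightarrow> \<exists>B. \<forall>t\<in>{c..d}. norm (f t) \<le> B"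
  shows "sq_int M I f"
  unfolding sq_int_iff[OF f M borel_Ivl order_refl]
proof -
  have K: "{c..d} \<in> sets borel" "{c..d} \<subseteq> I" using Icc_sub_Ivl[OF c(1) d(1)] by auto
  have "loc_int P M (\<lambda>t. f t * f t)"
    by (rule loc_int_mult_bounded[OF f b borel_on_bounded_loc_int[OF f M b] M])
  then have "set_integrable M {c..d} (\<lambda>t. f t * f t)" using c(1) d(1) unfolding loc_int_def by blast
  then have "set_integrable M {c..d} (\<lambda>t. norm (f t * f t))" by (rule set_integrable_norm)
  then have i: "set_integrable M {c..d} (\<lambda>t. (cmod (f t))\<^sup>2)" by (simp add: norm_mult power2_eq_square)
  have e: "I = (tail True c \<union> {c..d}) \<union> tail False d"
  proof
    show "I \<subseteq> (tail True c \<union> {c..d}) \<union> tail False d" by (auto simp: tail_def)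
    show "(tail True c \<union> {c..d}) \<union> tail False d \<subseteq> I" using K(2) tail_sub by blast
  qed
  show "set_integrable M I (\<lambda>t. (cmod (f t))\<^sup>2)"
    unfolding e using c(2) d(2) K(1) i unfolding sq_int_iff[OF f M tail_borel tail_sub]
    by (intro set_integrable_Un) (simp_all add: locfin_sets[OF M])
qed

end

section \<open>Solutions satisfying the boundary conditions\<close>

locale spectral_problem = sturm_liouville +
  fixes v :: "bool \<Rightarrow> cpair" and z :: complex
  assumes v_Tmax: "v e \<in> Tmax P"
    and v_lc: "lc e \<Longrightarrow> \<exists>f\<in>Tmax P. Vend e f (cnjp (v e)) \<noteq> 0"
    and z_nz: "z \<noteq> 0"
    and z_res: "z \<in> res_set P (Ssep P (v True) (v False))"
begin

abbreviation S where "S \<equiv> Ssep P (v True) (v False)"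

definition bc_sol where
  "bc_sol e u u1 \<longleftrightarrow> near_pair e u u1 (\<lambda>x. z * u x) (\<lambda>x. z * u1 x) \<and> Vend e (u, \<lambda>x. z * u x) (cnjp (v e)) = 0"

lemma cnj_v_near_pair:
  obtains c c1 ct ct1 where "cnjp (v e) = (c, ct)" "near_pair e c c1 ct ct1"
proof -
  obtain v0 vt where ve: "v e = (v0, vt)" by (cases "v e")
  obtain v1 vt1 where "near_pair e v0 v1 vt vt1" using Tmax_near_pair v_Tmax[of e] unfolding ve by blast
  from that[OF _ near_pair_cnj[OF this]] show thesis by (simp add: ve cnjp_def)
qed

text \<open>The relation S imposes its boundary conditions in the limit-point case as well. There
  they hold automatically: \<open>wronsk_vanish_at_end\<close> is applied to u and the conjugate of
  the boundary function.\<close>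

lemma bc_solI:
  assumes n: "near_pair e u u1 (\<lambda>x. z * u x) (\<lambda>x. z * u1 x)" and l: "lc e \<Longrightarrow> Vend e (u, \<lambda>x. z * u x) (cnjp (v e)) = 0"
  shows "bc_sol e u u1"
proof (cases "lc e")
  case False
  obtain c c1 ct ct1 where c: "cnjp (v e) = (c, ct)" "near_pair e c c1 ct ct1" using cnj_v_near_pair .
  have "(wronsk u1 (\<lambda>x. z * u x) c1 ct \<longlongrightarrow> 0) (end_filter e)"
    by (rule wronsk_vanish_at_end[OF v_Tmax v_lc n _ c(2)]) (use False in auto)
  then have "Vend e (u, \<lambda>x. z * u x) (c, ct) = 0"
    by (rule Vend_eqI[OF loc_pairD(1)[OF near_pair_loc_pair[OF n]] loc_pairD(1)[OF near_pair_loc_pair[OF c(2)]]])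
  then show ?thesis using n by (simp add: bc_sol_def c(1))
qed (use assms in \<open>simp add: bc_sol_def\<close>)

text \<open>Integrability near e and the boundary Wronskian only see a tail. With k = 0 this covers
  solutions that vanish near e.\<close>

lemma bc_sol_transfer:
  assumes u: "bc_sol e u u1" and w: "qd P w w1 (\<lambda>x. z * w x)" and c: "c \<in> I"
    and eq: "\<And>x. x \<in> tail e c \<Longrightarrow> w x = k * u x" "\<And>x. x \<in> tail e c \<Longrightarrow> w1 x = k * u1 x"
  shows "bc_sol e w w1"
proof -
  have nu: "near_pair e u u1 (\<lambda>x. z * u x) (\<lambda>x. z * u1 x)" using u by (simp add: bc_sol_def)
  note tu = loc_pairD[OF near_pair_loc_pair[OF nu]]
  obtain d where d: "d \<in> I" "sq_int (chim P) (tail e d) u" "sq_int (vsig P) (tail e d) u1"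
    using nu unfolding near_pair_def by blast
  obtain m where m: "m \<in> I" "tail e m \<subseteq> tail e c" "tail e m \<subseteq> tail e d" using tail_inter[OF c d(1)] by blast
  have su: "sq_int (chim P) (tail e m) (\<lambda>x. k * u x)" "sq_int (vsig P) (tail e m) (\<lambda>x. k * u1 x)"
    by (intro sq_int_cmult tu sq_int_subset[OF d(2) m(3)] sq_int_subset[OF d(3) m(3)] locfin_measures tail_borel tail_sub)+
  have sc: "sq_int M (tail e m) a" if "sq_int M (tail e m) b" "\<And>x. x \<in> tail e m \<Longrightarrow> a x = b x" for M a b
  proof -
    have "(\<integral>\<^sup>+ y. indicator (tail e m) y * ennreal ((cmod (a y))\<^sup>2) \<partial>M) = (\<integral>\<^sup>+ y. indicator (tail e m) y * ennreal ((cmod (b y))\<^sup>2) \<partial>M)"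
      using that(2) by (intro nn_integral_cong) (auto split: split_indicator)
    then show ?thesis using that(1) by (simp add: sq_int_def)
  qed
  have n: "near_pair e w w1 (\<lambda>x. z * w x) (\<lambda>x. z * w1 x)"
    by (rule near_pair_sol[OF w m(1) sc[OF su(1)] sc[OF su(2)]]) (use eq m(2) in auto)
  obtain p p1 pt pt1 where p: "cnjp (v e) = (p, pt)" "near_pair e p p1 pt pt1" using cnj_v_near_pair .
  have "(wronsk u1 (\<lambda>x. z * u x) p1 pt \<longlongrightarrow> 0) (end_filter e)"
    using wronsk_tendsto_Vend[OF nu p(2)] u by (simp add: bc_sol_def p(1))
  then have "((\<lambda>x. k * wronsk u1 (\<lambda>x. z * u x) p1 pt x) \<longlongrightarrow> k * 0) (end_filter e)" by (intro tendsto_intros)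
  moreover have "\<forall>\<^sub>F x in end_filter e. k * wronsk u1 (\<lambda>x. z * u x) p1 pt x = wronsk w1 (\<lambda>x. z * w x) p1 pt x"
    unfolding eventually_end_filter
  proof (intro bexI[OF _ c] ballI)
    fix x assume "x \<in> tail e c"
    then show "k * wronsk u1 (\<lambda>x. z * u x) p1 pt x = wronsk w1 (\<lambda>x. z * w x) p1 pt x"
      by (simp add: wronsk_def eq algebra_simps)
  qed
  ultimately have "(wronsk w1 (\<lambda>x. z * w x) p1 pt \<longlongrightarrow> 0) (end_filter e)" using Lim_transform_eventually by fastforce
  then have "Vend e (w, \<lambda>x. z * w x) (p, pt) = 0"
    by (rule Vend_eqI[OF w loc_pairD(1)[OF near_pair_loc_pair[OF p(2)]]])
  then show ?thesis using n by (simp add: bc_sol_def p(1))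
qed

text \<open>Elements of \<open>H1\<close> vanish outside (a,b), hence the truncation. The form
  \<open>0 + z * _\<close> is the membership condition of the resolvent for the right-hand side
  zero.\<close>

lemma sol_in_S:
  assumes w: "\<And>e. bc_sol e w w1"
  shows "(\<lambda>x. if x \<in> I then w x else 0, \<lambda>x. 0 + z * (if x \<in> I then w x else 0)) \<in> S"
proof -
  let ?w = "\<lambda>x. if x \<in> I then w x else 0"
  have n: "near_pair e w w1 (\<lambda>x. z * w x) (\<lambda>x. z * w1 x)" for e using w by (simp add: bc_sol_def)
  have t: "loc_pair w w1 (\<lambda>x. z * w x) (\<lambda>x. z * w1 x)" by (rule near_pair_loc_pair[OF n])
  note W = loc_pairD[OF t]
  obtain c where c: "c \<in> I" "sq_int (chim P) (tail True c) w" "sq_int (vsig P) (tail True c) w1" using n[of True] unfolding near_pair_def by blast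
  obtain d where d: "d \<in> I" "sq_int (chim P) (tail False d) w" "sq_int (vsig P) (tail False d) w1" using n[of False] unfolding near_pair_def by blast
  have s: "sq_int (chim P) I w" by (rule sq_int_global[OF W(4) locfin_measures(2) c(1,2) d(1,2)]) (rule acd_bounded[OF W(2) locfin_measures(1)])
  have s1: "sq_int (vsig P) I w1" by (rule sq_int_global[OF W(5) locfin_measures(1) c(1,3) d(1,3)]) (rule qd_bounded[OF W(1)])
  have q: "qd P ?w w1 (\<lambda>x. z * ?w x)" by (rule qd_cong[OF W(1)]) auto
  have "sq_int (chim P) I ?w" using s sq_int_AE_cong[where M="chim P" and f=w and g="?w" and A=I] by simp
  then have H: "?w \<in> H1 P" by (rule H1I[OF qdD(1)[OF q] _ s1]) auto
  have T: "(?w, \<lambda>x. 0 + z * ?w x) \<in> Tmax P"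
    using H H1_cmult[OF H, of z] q H1D(1)[OF H1_cmult[OF H, of z]] unfolding Tmax_def Tloc_def by auto
  have "Vend e (?w, \<lambda>x. 0 + z * ?w x) (cnjp (v e)) = 0" for e
  proof -
    obtain p p1 pt pt1 where p: "cnjp (v e) = (p, pt)" "near_pair e p p1 pt pt1" using cnj_v_near_pair .
    have "(wronsk w1 (\<lambda>x. z * w x) p1 pt \<longlongrightarrow> 0) (end_filter e)"
      using wronsk_tendsto_Vend[OF n p(2)] w[of e] by (simp add: bc_sol_def p(1))
    then have "(wronsk w1 (\<lambda>x. 0 + z * ?w x) p1 pt \<longlongrightarrow> 0) (end_filter e)"
      by (rule Lim_transform_eventually, use end_filter_Ivl in eventually_elim) (simp add: wronsk_def)
    then show ?thesis unfolding p(1) by (rule Vend_eqI[OF q loc_pairD(1)[OF near_pair_loc_pair[OF p(2)]]])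
  qed
  then show ?thesis using T unfolding Ssep_def Vend_eq by blast
qed

lemma zero_sol: "qd P (\<lambda>x. 0) (\<lambda>x. 0) (\<lambda>x. z * 0)"
  by (rule qdI, rule acdI) (auto simp: loc_int_def set_integrable_def qd_increment_def)

lemma bc_sol_zero: "bc_sol e (\<lambda>x. 0) (\<lambda>x. 0)"
proof -
  obtain c where c: "c \<in> I" using Ivl_nonempty .
  have n: "near_pair e (\<lambda>x. 0) (\<lambda>x. 0) (\<lambda>x. z * 0) (\<lambda>x. z * 0)"
    by (rule near_pair_sol[OF zero_sol c]) (simp_all add: sq_int_def)
  obtain p p1 pt pt1 where p: "cnjp (v e) = (p, pt)" "near_pair e p p1 pt pt1" using cnj_v_near_pair .
  have "Vend e (\<lambda>x. 0, \<lambda>x. z * 0) (p, pt) = 0"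
    by (rule Vend_eqI[OF zero_sol loc_pairD(1)[OF near_pair_loc_pair[OF p(2)]]]) (simp add: wronsk_def[abs_def])
  then show ?thesis using n by (simp add: bc_sol_def p(1))
qed

text \<open>Both w and zero solve the resolvent equation with right-hand side zero, whose solution
  is unique because z lies in the resolvent set.\<close>

lemma bc_sol_trivial:
  assumes w: "\<And>e. bc_sol e w w1" and x: "x \<in> I"
  shows "w x = 0"
proof -
  have "\<forall>g\<in>H1 P. \<exists>!f. (f, \<lambda>x. g x + z * f x) \<in> S" using z_res unfolding res_set_def by blast
  from bspec[OF this H1_zero] have "\<exists>!f. (f, \<lambda>x. 0 + z * f x) \<in> S" .
  moreover note sol_in_S[OF w] sol_in_S[OF bc_sol_zero]
  ultimately have "(\<lambda>x. if x \<in> I then w x else 0) = (\<lambda>x. if x \<in> I then 0 else 0)" by blast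
  from fun_cong[OF this, of x] show ?thesis using x by simp
qed

lemma wronskian_nonzero:
  assumes ua: "bc_sol True ua ua1" "\<exists>x\<in>I. ua x \<noteq> 0" and ub: "bc_sol False ub ub1" "\<exists>x\<in>I. ub x \<noteq> 0"
  shows "\<exists>c\<in>I. ub c * ua1 c - ub1 c * ua c \<noteq> 0"
proof (rule ccontr)
  assume "\<not> ?thesis"
  then have W: "ub c * ua1 c = ub1 c * ua c" if "c \<in> I" for c using that by auto
  have qa: "qd P ua ua1 (\<lambda>x. z * ua x)" and qb: "qd P ub ub1 (\<lambda>x. z * ub x)"
    using ua(1) ub(1) unfolding bc_sol_def near_pair_def loc_pair_def by blast+
  \<comment> \<open>If \<open>ua\<close> and \<open>ua1\<close> vanished at c, then
    \<open>ua\<close> would be zero to the right of c and so satisfy the condition at b as well. No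
    uniqueness to the left of c is required.\<close>
  have da: "\<not> (ua c = 0 \<and> ua1 c = 0)" if c: "c \<in> I" for c
  proof
    assume "ua c = 0 \<and> ua1 c = 0"
    then have zr: "ua x = 0" "ua1 x = 0" if "x \<in> tail False c" for x
      using sol_zero_right[OF qa c] that by (auto simp: tail_def)
    have "bc_sol False ua ua1" by (rule bc_sol_transfer[OF bc_sol_zero qa c, of _ 0]) (use zr in auto)
    then have "bc_sol e ua ua1" for e using ua(1) by (cases e) auto
    then show False using bc_sol_trivial ua(2) by blast
  qed
  \<comment> \<open>At such a point \<open>ua\<close> is also nonzero: otherwise the vanishing
    Wronskian would give \<open>ua1 c = 0\<close>, against \<open>da\<close>. Hence the two vectors
    of initial data are proportional at c.\<close>
  obtain c where c: "c \<in> I" "ub c \<noteq> 0" using ub(2) by blast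
  have "ua c \<noteq> 0" using da[OF c(1)] W[OF c(1)] c(2) by auto
  define k where "k = ub c / ua c"
  have k: "k * ua c = ub c" "k * ua1 c = ub1 c"
    using W[OF c(1)] \<open>ua c \<noteq> 0\<close> by (simp_all add: k_def field_simps)
  define w where "w t = (if t < c then k * ua t else ub t)" for t
  define w1 where "w1 t = (if t < c then k * ua1 t else ub1 t)" for t
  have "qd P w w1 (\<lambda>t. if t < c then k * (z * ua t) else z * ub t)"
    unfolding w_def[abs_def] w1_def[abs_def]
    using qd_glue[OF qd_cmult[OF qa, of k] qb c(1)] k by simp
  then have qw: "qd P w w1 (\<lambda>x. z * w x)" by (rule qd_cong) (auto simp: w_def)
  have "bc_sol True w w1" by (rule bc_sol_transfer[OF ua(1) qw c(1), of k]) (auto simp: tail_def w_def w1_def)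
  moreover have "bc_sol False w w1" by (rule bc_sol_transfer[OF ub(1) qw c(1), of 1]) (auto simp: tail_def w_def w1_def)
  ultimately have "bc_sol e w w1" for e by (cases e) auto
  then have "w c = 0" using bc_sol_trivial c(1) by blast
  then show False using c(2) by (simp add: w_def)
qed

lemma wronsk_sol_const:
  assumes u: "qd P u u1 (\<lambda>x. z * u x)" and w: "qd P w w1 (\<lambda>x. z * w x)" and xy: "x \<in> I" "y \<in> I"
  shows "wronsk u1 (\<lambda>x. z * u x) w1 (\<lambda>x. z * w x) x = wronsk u1 (\<lambda>x. z * u x) w1 (\<lambda>x. z * w x) y"
proof -
  have k: "lagrange_chi u (\<lambda>x. z * u x) w (\<lambda>x. z * w x) = (\<lambda>t. 0)" "lagrange_sig u1 (\<lambda>x. z * u1 x) w1 (\<lambda>x. z * w1 x) = (\<lambda>t. 0)"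
    by (auto simp: lagrange_chi_def lagrange_sig_def fun_eq_iff)
  show ?thesis
    using lagrange[OF loc_pair_sol[OF u] loc_pair_sol[OF w] xy] lagrange[OF loc_pair_sol[OF u] loc_pair_sol[OF w] xy(2,1)]
    unfolding k by (cases "x \<le> y") auto
qed

lemma resolvent_representation:
  assumes ua: "bc_sol True ua ua1" "\<exists>x\<in>I. ua x \<noteq> 0" and ub: "bc_sol False ub ub1" "\<exists>x\<in>I. ub x \<noteq> 0"
    and g: "g \<in> H1 P" and x: "x \<in> I"
  shows "resolv S z g x = h1_inner P g (\<lambda>y. cnj (Green P z ua ub x y))"
proof -
  have na: "near_pair True ua ua1 (\<lambda>x. z * ua x) (\<lambda>x. z * ua1 x)" and nb: "near_pair False ub ub1 (\<lambda>x. z * ub x) (\<lambda>x. z * ub1 x)"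
    using ua(1) ub(1) unfolding bc_sol_def by blast+
  have qa: "qd P ua ua1 (\<lambda>x. z * ua x)" and qb: "qd P ub ub1 (\<lambda>x. z * ub x)"
    using na nb unfolding near_pair_def loc_pair_def by blast+
  define D where "D c = ub c * ua1 c - ub1 c * ua c" for c
  \<comment> \<open>For solutions the second components are z u, so the modified Wronskian is z
    times the classical one.\<close>
  have Dw: "wronsk ub1 (\<lambda>x. z * ub x) ua1 (\<lambda>x. z * ua x) c = z * D c" for c by (simp add: wronsk_def D_def algebra_simps)
  have Dc: "D c = D x" if "c \<in> I" for c
    using wronsk_sol_const[OF qb qa that x] z_nz unfolding Dw by simp
  have D0: "D x \<noteq> 0" using wronskian_nonzero[OF ua ub] Dc unfolding D_def[symmetric] by auto
  have V: "Vsol P z ub ua = z * D x"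
  proof -
    have "(SOME c. c \<in> I) \<in> I" using x by (rule someI)
    then show ?thesis unfolding Vsol_def by (simp add: Vw_eq_wronsk[OF qb qa] Dw Dc)
  qed
  define V where "V = z * D x"
  have V0: "V \<noteq> 0" using D0 z_nz by (simp add: V_def)
  define f where "f = resolv S z g"
  have "\<exists>!f. (f, \<lambda>x. g x + z * f x) \<in> S" using z_res g unfolding res_set_def by blast
  then have fS: "(f, \<lambda>x. g x + z * f x) \<in> S" unfolding f_def resolv_def by (rule theI')
  then have fT: "(f, \<lambda>x. g x + z * f x) \<in> Tmax P"
    and fV: "Vend e (f, \<lambda>x. g x + z * f x) (cnjp (v e)) = 0" for e
    unfolding Ssep_def Vend_eq by (auto, cases e, auto)
  obtain f1 where f1: "qd P f f1 (\<lambda>x. g x + z * f x)" using fT by (auto simp: Tmax_def Tloc_def)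
  define g1 where "g1 = sder P g"
  note G = H1D[OF g, folded g1_def]
  have nf: "near_pair e f f1 (\<lambda>x. g x + z * f x) (\<lambda>x. g1 x + z * f1 x)" for e
    by (rule near_pair_Tmax[OF fT f1 acd_add[OF G(1) acd_cmult[OF qdD(1)[OF f1]] locfin_measures(1)]])
  \<comment> \<open>The terms with z f u cancel because f and u belong to the same parameter z; only
    g u is left under the integrals.\<close>
  have kc: "lagrange_chi f (\<lambda>x. g x + z * f x) u (\<lambda>x. z * u x) = (\<lambda>y. g y * u y)" for u
    by (auto simp: lagrange_chi_def fun_eq_iff algebra_simps)
  have ks: "lagrange_sig f1 (\<lambda>x. g1 x + z * f1 x) u (\<lambda>x. z * u x) = (\<lambda>y. g1 y * u y)" for u
    by (auto simp: lagrange_sig_def fun_eq_iff algebra_simps)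
  have la: "(wronsk f1 (\<lambda>x. g x + z * f x) ua1 (\<lambda>x. z * ua x) \<longlongrightarrow> 0) (end_filter True)"
    by (rule wronsk_vanish_at_end[OF v_Tmax v_lc nf fV na]) (use ua(1) in \<open>auto simp: bc_sol_def\<close>)
  have lb: "(wronsk f1 (\<lambda>x. g x + z * f x) ub1 (\<lambda>x. z * ub x) \<longlongrightarrow> 0) (end_filter False)"
    by (rule wronsk_vanish_at_end[OF v_Tmax v_lc nf fV nb]) (use ub(1) in \<open>auto simp: bc_sol_def\<close>)
  let ?L = "{y \<in> I. y < x}" and ?R = "{y \<in> I. x \<le> y}"
  have LR: "?L \<in> sets borel" "?R \<in> sets borel" "?L \<inter> ?R = {}" "?L \<union> ?R = I"
  proof -
    have "?L = I \<inter> {..<x}" "?R = I \<inter> {x..}" by auto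
    then show "?L \<in> sets borel" "?R \<in> sets borel" by simp_all
  qed auto
  have ea: "set_lebesgue_integral (chim P) ?L (\<lambda>y. g y * ua y) + set_lebesgue_integral (vsig P) ?L (\<lambda>y. g1 y * ua1 y)
      = wronsk f1 (\<lambda>x. g x + z * f x) ua1 (\<lambda>x. z * ua x) x"
    using tendsto_unique[OF end_filter_ne_bot la wronsk_near_left[OF nf na x]] unfolding kc ks by simp
  have eb: "set_lebesgue_integral (chim P) ?R (\<lambda>y. g y * ub y) + set_lebesgue_integral (vsig P) ?R (\<lambda>y. g1 y * ub1 y)
      = - wronsk f1 (\<lambda>x. g x + z * f x) ub1 (\<lambda>x. z * ub x) x"
    by (rule add.inverse_unique[symmetric], rule tendsto_unique[OF end_filter_ne_bot wronsk_near_right[OF nf nb x, unfolded kc ks] lb])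
  have ia: "set_integrable (chim P) ?L (\<lambda>y. g y * ua y)" "set_integrable (vsig P) ?L (\<lambda>y. g1 y * ua1 y)"
  proof -
    note l = lagrange_integrands_loc_int[OF near_pair_loc_pair[OF nf[of True]] near_pair_loc_pair[OF na], unfolded kc ks]
    obtain c where "c \<in> I" "set_integrable (chim P) (tail True c) (\<lambda>y. g y * ua y)" "set_integrable (vsig P) (tail True c) (\<lambda>y. g1 y * ua1 y)"
      using lagrange_integrands_near[OF nf na] unfolding kc ks by blast
    then show "set_integrable (chim P) ?L (\<lambda>y. g y * ua y)" "set_integrable (vsig P) ?L (\<lambda>y. g1 y * ua1 y)"
      using set_integrable_left_extend[OF l(1) _ locfin_measures(2) _ x] set_integrable_left_extend[OF l(2) _ locfin_measures(1) _ x] by blast+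
  qed
  have ib: "set_integrable (chim P) ?R (\<lambda>y. g y * ub y)" "set_integrable (vsig P) ?R (\<lambda>y. g1 y * ub1 y)"
  proof -
    note l = lagrange_integrands_loc_int[OF near_pair_loc_pair[OF nf[of False]] near_pair_loc_pair[OF nb], unfolded kc ks]
    obtain c where "c \<in> I" "set_integrable (chim P) (tail False c) (\<lambda>y. g y * ub y)" "set_integrable (vsig P) (tail False c) (\<lambda>y. g1 y * ub1 y)"
      using lagrange_integrands_near[OF nf nb] unfolding kc ks by blast
    then show "set_integrable (chim P) ?R (\<lambda>y. g y * ub y)" "set_integrable (vsig P) ?R (\<lambda>y. g1 y * ub1 y)"
      using set_integrable_right_extend[OF l(1) _ locfin_measures(2) _ x] set_integrable_right_extend[OF l(2) _ locfin_measures(1) _ x] by blast+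
  qed
  \<comment> \<open>At y = x both branches of \<open>K\<close> agree, so it equals the kernel split
    at y \<le> x. For \<open>K1\<close> the point x must go with \<open>ub1\<close>: an atom of
    \<open>vsig\<close> at x counts in the integrals over [x,y).\<close>
  define K where "K y = (if y < x then ub x * ua y else ua x * ub y)" for y
  define K1 where "K1 y = (if y < x then ub x * ua1 y else ua x * ub1 y)" for y
  have aK: "acd P (vsig P) K K1" unfolding K_def[abs_def] K1_def[abs_def]
    by (rule acd_glue[OF acd_cmult[OF qdD(1)[OF qa]] acd_cmult[OF qdD(1)[OF qb]] locfin_measures(1) x]) (simp add: mult.commute)
  have split: "set_integrable M I (\<lambda>y. h y * (if y < x then ub x * p y else ua x * q y))"
    "set_lebesgue_integral M I (\<lambda>y. h y * (if y < x then ub x * p y else ua x * q y)) =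
      ub x * set_lebesgue_integral M ?L (\<lambda>y. h y * p y) + ua x * set_lebesgue_integral M ?R (\<lambda>y. h y * q y)"
    if i: "set_integrable M ?L (\<lambda>y. h y * p y)" "set_integrable M ?R (\<lambda>y. h y * q y)" and M: "locfin M" for M h p q
  proof -
    let ?k = "\<lambda>y. h y * (if y < x then ub x * p y else ua x * q y)"
    have "set_integrable M ?L ?k \<longleftrightarrow> set_integrable M ?L (\<lambda>y. ub x * (h y * p y))" by (rule set_integrable_cong) auto
    then have kL: "set_integrable M ?L ?k" using i(1) by simp
    have "set_integrable M ?R ?k \<longleftrightarrow> set_integrable M ?R (\<lambda>y. ua x * (h y * q y))" by (rule set_integrable_cong) auto
    then have kR: "set_integrable M ?R ?k" using i(2) by simp
    show "set_integrable M I ?k" using set_integrable_Un[OF kL kR] LR locfin_sets[OF M] by simp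
    have "set_lebesgue_integral M I ?k = set_lebesgue_integral M ?L ?k + set_lebesgue_integral M ?R ?k"
      using set_integral_Un[OF LR(3) kL kR] LR(4) by simp
    also have "set_lebesgue_integral M ?L ?k = set_lebesgue_integral M ?L (\<lambda>y. ub x * (h y * p y))"
      using LR locfin_sets[OF M] by (intro set_lebesgue_integral_cong) auto
    also have "set_lebesgue_integral M ?R ?k = set_lebesgue_integral M ?R (\<lambda>y. ua x * (h y * q y))"
      using LR locfin_sets[OF M] by (intro set_lebesgue_integral_cong) auto
    finally show "set_lebesgue_integral M I ?k =
      ub x * set_lebesgue_integral M ?L (\<lambda>y. h y * p y) + ua x * set_lebesgue_integral M ?R (\<lambda>y. h y * q y)" by simp
  qed
  note sc = split[OF ia(1) ib(1) locfin_measures(2), folded K_def] and ss = split[OF ia(2) ib(2) locfin_measures(1), folded K1_def]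
  define d where "d = delta P x"
  note dp = delta_props[OF x, folded d_def]
  define d1 where "d1 = sder P d"
  have ad: "acd P (vsig P) d d1" unfolding d1_def by (rule H1D(1)[OF dp(1)])
  have di: "set_integrable (chim P) I (\<lambda>y. g y * cnj (d y))" "set_integrable (vsig P) I (\<lambda>y. g1 y * cnj (d1 y))"
    unfolding g1_def d1_def by (rule H1_products[OF g dp(1)])+
  have dv: "set_lebesgue_integral (chim P) I (\<lambda>y. g y * cnj (d y)) + set_lebesgue_integral (vsig P) I (\<lambda>y. g1 y * cnj (d1 y)) = g x"
    using dp(2)[OF g] unfolding h1_inner_eq[OF G(1) ad] .
  have "acd P (vsig P) (\<lambda>y. cnj (1 / V * K y) - cnj (1 / z) * d y) (\<lambda>y. cnj (1 / V * K1 y) - cnj (1 / z) * d1 y)"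
    by (intro acd_diff acd_cnj acd_cmult aK ad locfin_measures)
  then have aG: "acd P (vsig P) (\<lambda>y. cnj (Green P z ua ub x y)) (\<lambda>y. cnj (1 / V * K1 y) - cnj (1 / z) * d1 y)"
  proof (rule acd_cong)
    fix y assume "y \<in> I"
    moreover have "K y = (if y \<le> x then ua y * ub x else ua x * ub y)" by (auto simp: K_def)
    ultimately have "Green P z ua ub x y = 1 / V * K y - d y / z"
      by (simp add: Green_def V V_def[symmetric] d_def)
    then show "cnj (1 / V * K y) - cnj (1 / z) * d y = cnj (Green P z ua ub x y)"
      using dp(3)[of y] by simp
  qed simp
  have GI: "set_lebesgue_integral (chim P) I (\<lambda>y. g y * cnj (cnj (Green P z ua ub x y))) =
      set_lebesgue_integral (chim P) I (\<lambda>y. 1 / V * (g y * K y) - 1 / z * (g y * cnj (d y)))"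
  proof (rule set_lebesgue_integral_cong)
    show "\<forall>y. y \<in> I \<longrightarrow> g y * cnj (cnj (Green P z ua ub x y)) = 1 / V * (g y * K y) - 1 / z * (g y * cnj (d y))"
    proof (intro allI impI)
      fix y assume "y \<in> I"
      moreover have "K y = (if y \<le> x then ua y * ub x else ua x * ub y)" by (auto simp: K_def)
      ultimately have "Green P z ua ub x y = 1 / V * K y - d y / z"
        by (simp add: Green_def V V_def[symmetric] d_def)
      then show "g y * cnj (cnj (Green P z ua ub x y)) = 1 / V * (g y * K y) - 1 / z * (g y * cnj (d y))"
        unfolding complex_cnj_cnj dp(3)[of y] by (simp add: right_diff_distrib mult.commute)
    qed
  qed simp
  have sub: "set_lebesgue_integral M I (\<lambda>y. 1 / V * p y - 1 / z * q y) = 1 / V * set_lebesgue_integral M I p - 1 / z * set_lebesgue_integral M I q"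
    if "set_integrable M I p" "set_integrable M I q" for M p q
    using that by (subst set_integral_diff(2)) (auto intro!: set_integrable_mult_right)
  have "h1_inner P g (\<lambda>y. cnj (Green P z ua ub x y)) =
      set_lebesgue_integral (chim P) I (\<lambda>y. 1 / V * (g y * K y) - 1 / z * (g y * cnj (d y))) +
      set_lebesgue_integral (vsig P) I (\<lambda>y. 1 / V * (g1 y * K1 y) - 1 / z * (g1 y * cnj (d1 y)))"
  proof -
    have "(\<lambda>y. g1 y * cnj (cnj (1 / V * K1 y) - cnj (1 / z) * d1 y)) = (\<lambda>y. 1 / V * (g1 y * K1 y) - 1 / z * (g1 y * cnj (d1 y)))"
      by (auto simp: fun_eq_iff algebra_simps)
    then show ?thesis unfolding h1_inner_eq[OF G(1) aG] GI by simp
  qed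
  also have "\<dots> = 1 / V * (set_lebesgue_integral (chim P) I (\<lambda>y. g y * K y) + set_lebesgue_integral (vsig P) I (\<lambda>y. g1 y * K1 y)) - 1 / z * g x"
    unfolding sub[OF sc(1) di(1)] sub[OF ss(1) di(2)] dv[symmetric] by (simp add: algebra_simps)
  also have "set_lebesgue_integral (chim P) I (\<lambda>y. g y * K y) + set_lebesgue_integral (vsig P) I (\<lambda>y. g1 y * K1 y)
     = ub x * (set_lebesgue_integral (chim P) ?L (\<lambda>y. g y * ua y) + set_lebesgue_integral (vsig P) ?L (\<lambda>y. g1 y * ua1 y))
     + ua x * (set_lebesgue_integral (chim P) ?R (\<lambda>y. g y * ub y) + set_lebesgue_integral (vsig P) ?R (\<lambda>y. g1 y * ub1 y))"
    unfolding sc(2) ss(2) by (simp add: algebra_simps)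
  \<comment> \<open>The combination of the two boundary values at x eliminates \<open>f1 x\<close>;
    what survives is the second component of f times the classical Wronskian. The summand g x is
    then removed by the delta term.\<close>
  also have "\<dots> = (g x + z * f x) * D x"
    unfolding ea eb by (simp add: wronsk_def D_def algebra_simps)
  also have "1 / V * ((g x + z * f x) * D x) - 1 / z * g x = f x"
    using D0 z_nz by (simp add: V_def field_simps)
  finally show ?thesis by (simp add: f_def)
qed

end

theorem theorem3p5:
  fixes P :: sl_data and va vb :: cpair and z :: complex and ua ub :: "real \<Rightarrow> complex"
  assumes "sl_setting P"
    and "bc_fun_a P va" and "bc_fun_b P vb"
    and "z \<in> res_set P (Ssep P va vb)" and "z \<noteq> 0"
    and "is_sol P z ua" and "\<exists>x\<in>Ivl P. ua x \<noteq> 0"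
    and "is_sol P z ub" and "\<exists>x\<in>Ivl P. ub x \<noteq> 0"
    and "lc_a P \<Longrightarrow> Vw_a P (ua, \<lambda>x. z * ua x) (cnjp va) = 0"
    and "\<not> lc_a P \<Longrightarrow> H1_near_a P ua"
    and "lc_b P \<Longrightarrow> Vw_b P (ub, \<lambda>x. z * ub x) (cnjp vb) = 0"
    and "\<not> lc_b P \<Longrightarrow> H1_near_b P ub"
  shows "\<forall>g\<in>H1 P. \<forall>x\<in>Ivl P.
           resolv (Ssep P va vb) z g x = h1_inner P g (\<lambda>y. cnj (Green P z ua ub x y))"
proof -
  interpret sturm_liouville P by unfold_locales (rule assms(1))
  interpret spectral_problem P "\<lambda>e. if e then va else vb" z
  proof
    fix e
    show "(if e then va else vb) \<in> Tmax P" using assms(2,3) by (simp add: bc_fun_a_def bc_fun_b_def)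
    show "\<exists>f\<in>Tmax P. Vend e f (cnjp (if e then va else vb)) \<noteq> 0" if "lc e"
      using assms(2,3) that unfolding bc_fun_a_def bc_fun_b_def lc_eq Vend_eq by (cases e) auto
  qed (use assms in simp_all)
  obtain ua1 where a1: "qd P ua ua1 (\<lambda>x. z * ua x)" using assms(6) unfolding is_sol_def by blast
  obtain ub1 where b1: "qd P ub ub1 (\<lambda>x. z * ub x)" using assms(8) unfolding is_sol_def by blast
  \<comment> \<open>In the limit-circle case every solution for nonzero z has this property; in the
    limit-point case it is assumed.\<close>
  have "near_end True ua"
    using assms(5,6,11) unfolding near_end_eq lc_eq lc_def by blast
  then have "bc_sol True ua ua1"
    using assms(10) by (intro bc_solI near_pair_sol_near_end[OF a1]) (auto simp: lc_eq Vend_eq)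
  moreover have "near_end False ub"
    using assms(5,8,13) unfolding near_end_eq lc_eq lc_def by blast
  then have "bc_sol False ub ub1"
    using assms(12) by (intro bc_solI near_pair_sol_near_end[OF b1]) (auto simp: lc_eq Vend_eq)
  ultimately show ?thesis
    using resolvent_representation[OF _ assms(7) _ assms(9)] by simp
qed

end
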